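(* Let $d\ge4$. Let $T\in(\mathbb{C}^3)^{\otimes d}$ be such that $Z=E(T)$ is reduced of dimension $0$. Then the Laguerre map $\lambda_Z$ is generically finite of degree $d-1$ and its finite fibers consist of zero-dimensional subschemes of degree $d-1$ contained in a line. Moreover, every curve contracted by $\lambda_Z$ is a line, and the number $\nu$ of contracted lines satisfies $\nu\le3(d-1)$. As a consequence, if $k\in\{2,\dots,d-1\}$, then no $kd$ points of $E(T)$ lie on a curve of degree $k$.
   Context: A tensor $T=(T_{i_1\dots i_d})\in(\mathbb{C}^3)^{\otimes d}$ determines forms $g_i=\sum T_{i\,i_2\dots i_d}x_{i_2}\cdots x_{i_d}$ of degree $d-1$ ($i=0,1,2$), and the eigenscheme $E(T)\subseteq\mathbb{P}^2$ is defined by the ideal generated by $f_0=x_1g_2-x_2g_1$, $f_1=x_2g_0-x_0g_2$, $f_2=x_0g_1-x_1g_0$. When $Z=E(T)$ is zero-dimensional and reduced, $f_0,f_1,f_2$ is a basis of the degree $d$ part $I_Z(d)$ of the ideal of $Z$. The Laguerre map is the rational map $\lambda_Z:\mathbb{P}^2\dashrightarrow\mathbb{P}^2$, $P\mapsto(f_0(P):f_1(P):f_2(P))$, with indeterminacy locus $Z$; it is resolved by the morphism $\widetilde\lambda_Z:\mathrm{Bl}_Z\mathbb{P}^2\to\mathbb{P}^2$, the restriction of the second projection to $\mathrm{Bl}_Z\mathbb{P}^2\subseteq\mathbb{P}^2\times\mathbb{P}^2$ (the closure of the graph of $\lambda_Z$). The fiber of $\lambda_Z$ over $Q$ is understood as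 the fiber of $\widetilde\lambda_Z$ over $Q$, regarded as a subscheme of $\mathbb{P}^2=\mathbb{P}^2\times\{Q\}$. An irreducible curve $C\subseteq\mathbb{P}^2$ is contracted by $\lambda_Z$ if $\lambda_Z(C\setminus Z)$ is a point. *)

theory Defs
  imports
    "HOL-Analysis.Finite_Cartesian_Product"
    "HOL-Library.Poly_Mapping"
    "HOL-Library.Numeral_Type"
    "HOL-Computational_Algebra.Fraction_Field"
    "HOL-Algebra.Embedded_Algebras"
    "HOL-Algebra.Algebraic_Closure_Type"
begin

section \<open>Polynomials over the complex numbers in finitely many variables\<close>

text \<open>
  The three variables of the plane are indexed by the type \<^typ>\<open>3\<close>, whose elements are 0, 1, 2.
  Polynomials on the product of two planes use the index type \<^typ>\<open>3 + 3\<close>.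
\<close>

type_synonym 'v cpoly = "('v \<Rightarrow>\<^sub>0 nat) \<Rightarrow>\<^sub>0 complex"

definition Const :: "complex \<Rightarrow> 'v cpoly" where
  "Const c = Poly_Mapping.single 0 c"

definition Var :: "'v \<Rightarrow> 'v cpoly" where
  "Var i = Poly_Mapping.single (Poly_Mapping.single i 1) 1"

definition cpoly_eval :: "('v::finite \<Rightarrow> complex) \<Rightarrow> 'v cpoly \<Rightarrow> complex" where
  "cpoly_eval v F =
     (\<Sum>m\<in>Poly_Mapping.keys F. Poly_Mapping.lookup F m * (\<Prod>i\<in>UNIV. v i ^ Poly_Mapping.lookup m i))"

definition cpoly_subst :: "('v::finite \<Rightarrow> 'w cpoly) \<Rightarrow> 'v cpoly \<Rightarrow> 'w cpoly" where
  "cpoly_subst \<sigma> F =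
     (\<Sum>m\<in>Poly_Mapping.keys F. Const (Poly_Mapping.lookup F m) * (\<Prod>i\<in>UNIV. \<sigma> i ^ Poly_Mapping.lookup m i))"

text \<open>Homogeneous polynomials; the zero polynomial is a form of every degree.\<close>

definition forms :: "nat \<Rightarrow> 'v::finite cpoly set" where
  "forms n = {F. \<forall>m\<in>Poly_Mapping.keys F. (\<Sum>i\<in>UNIV. Poly_Mapping.lookup m i) = n}"

definition biforms :: "nat \<Rightarrow> nat \<Rightarrow> (3 + 3) cpoly set" where
  "biforms a b = {F. \<forall>m\<in>Poly_Mapping.keys F.
      (\<Sum>i\<in>UNIV. Poly_Mapping.lookup m (Inl i)) = a \<and> (\<Sum>i\<in>UNIV. Poly_Mapping.lookup m (Inr i)) = b}"

definition ideal_gen :: "'v cpoly set \<Rightarrow> 'v cpoly set" where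
  "ideal_gen S = Modules.module.span (*) S"

definition cscale :: "complex \<Rightarrow> 'v cpoly \<Rightarrow> 'v cpoly" where
  "cscale c F = Const c * F"

lemma module_cpoly_times: "Modules.module ((*) :: 'v cpoly \<Rightarrow> 'v cpoly \<Rightarrow> 'v cpoly)"
  by standard (simp_all add: algebra_simps)

lemma vector_space_cscale: "vector_space (cscale :: complex \<Rightarrow> 'v cpoly \<Rightarrow> 'v cpoly)"
proof -
  have "Const (a + b) = Const a + (Const b :: 'v cpoly)"
    and "Const (a * b) = Const a * (Const b :: 'v cpoly)"
    and "Const 1 = (1 :: 'v cpoly)" for a b
    by (simp_all add: Const_def single_add mult_single)
  then show ?thesis
    by unfold_locales (simp_all add: cscale_def algebra_simps)
qed

definition cdim :: "'v cpoly set \<Rightarrow> nat" where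
  "cdim = vector_space.dim cscale"

section \<open>The projective plane, its Zariski topology, and curves\<close>

text \<open>A point of the plane is identified with the set of all its homogeneous coordinate vectors.\<close>

type_synonym point = "(complex ^ 3) set"

definition proj_pt :: "complex ^ 3 \<Rightarrow> point" where
  "proj_pt v = {c *s v | c. c \<noteq> 0}"

definition P2 :: "point set" where
  "P2 = proj_pt ` {v. v \<noteq> 0}"

definition zero_locus :: "3 cpoly set \<Rightarrow> point set" where
  "zero_locus S = {P \<in> P2. \<forall>F\<in>S. \<forall>v\<in>P. cpoly_eval (($) v) F = 0}"

definition zariski_closed :: "point set \<Rightarrow> bool" where
  "zariski_closed W \<longleftrightarrow> (\<exists>S. (\<forall>F\<in>S. \<exists>n. F \<in> forms n) \<and> W = zero_locus S)"

definition irreducible_closed :: "point set \<Rightarrow> bool" where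
  "irreducible_closed W \<longleftrightarrow> zariski_closed W \<and> W \<noteq> {} \<and>
     (\<forall>A B. zariski_closed A \<and> zariski_closed B \<and> W = A \<union> B \<longrightarrow> W = A \<or> W = B)"

text \<open>
  Krull dimension: the maximal length n of a chain of irreducible closed subsets
  \<open>Y 0 \<subset> \<dots> \<subset> Y n\<close> of W.
\<close>

definition has_chain :: "point set \<Rightarrow> nat \<Rightarrow> bool" where
  "has_chain W n \<longleftrightarrow>
     (\<exists>Y. (\<forall>i\<le>n. irreducible_closed (Y i) \<and> Y i \<subseteq> W) \<and> (\<forall>i<n. Y i \<subset> Y (Suc i)))"

definition has_dim :: "point set \<Rightarrow> nat \<Rightarrow> bool" where
  "has_dim W n \<longleftrightarrow> has_chain W n \<and> (\<forall>m>n. \<not> has_chain W m)"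

definition irreducible_curve :: "point set \<Rightarrow> bool" where
  "irreducible_curve C \<longleftrightarrow> irreducible_closed C \<and> has_dim C 1"

text \<open>Support of a plane curve of degree k; the curve may be reducible or non-reduced.\<close>

definition plane_curve :: "nat \<Rightarrow> point set \<Rightarrow> bool" where
  "plane_curve k C \<longleftrightarrow> (\<exists>h \<in> forms k. h \<noteq> 0 \<and> C = zero_locus {h})"

abbreviation proj_line :: "point set \<Rightarrow> bool" where
  "proj_line \<equiv> plane_curve 1"

section \<open>Closed subschemes of the plane\<close>

text \<open>
  A closed subscheme of the plane is given by a homogeneous ideal I of \<open>S = \<complex>[x\<^sub>0, x\<^sub>1, x\<^sub>2]\<close>,
  as \<open>Proj (S / I)\<close>. The affine chart where \<open>x\<^sub>i\<close> does not vanish is the spectrum of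
  \<open>S / (I + (x\<^sub>i - 1))\<close>; the scheme is reduced iff these three rings have no nilpotents.
\<close>

definition radical_ideal :: "'v cpoly set \<Rightarrow> bool" where
  "radical_ideal J \<longleftrightarrow> (\<forall>F n. F ^ n \<in> J \<longrightarrow> F \<in> J)"

definition reduced_scheme :: "3 cpoly set \<Rightarrow> bool" where
  "reduced_scheme I \<longleftrightarrow> (\<forall>i. radical_ideal (ideal_gen (I \<union> {Var i - 1})))"

text \<open>
  A zero-dimensional subscheme has degree \<open>\<delta>\<close> iff its Hilbert polynomial is the constant \<open>\<delta>\<close>,
  that is, \<open>dim (S / I)\<^sub>n = \<delta>\<close> for all large n.
\<close>

definition zero_dim_scheme_of_degree :: "3 cpoly set \<Rightarrow> nat \<Rightarrow> bool" where
  "zero_dim_scheme_of_degree I \<delta> \<longleftrightarrow> has_dim (zero_locus I) 0 \<and>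
     (\<forall>\<^sub>F n in sequentially. cdim (forms n :: 3 cpoly set) = cdim (I \<inter> forms n) + \<delta>)"

definition saturation :: "3 cpoly set \<Rightarrow> 3 cpoly set" where
  "saturation I = {F. \<exists>n. \<forall>G \<in> forms n. G * F \<in> I}"

definition subscheme_of :: "3 cpoly set \<Rightarrow> 3 cpoly set \<Rightarrow> bool" where
  "subscheme_of I J \<longleftrightarrow> J \<subseteq> saturation I"

definition scheme_contained_in_line :: "3 cpoly set \<Rightarrow> bool" where
  "scheme_contained_in_line I \<longleftrightarrow> (\<exists>l \<in> forms 1. l \<noteq> 0 \<and> subscheme_of I (ideal_gen {l}))"

section \<open>Rational maps of the plane given by three forms of equal degree\<close>

text \<open>
  The graph of \<open>P \<mapsto> (f\<^sub>0(P) : f\<^sub>1(P) : f\<^sub>2(P))\<close> on the complement of the common zeros of the \<open>f\<^sub>i\<close>.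
\<close>

definition map_graph :: "(3 \<Rightarrow> 3 cpoly) \<Rightarrow> (point \<times> point) set" where
  "map_graph f = {(proj_pt v, proj_pt (\<chi> i. cpoly_eval (($) v) (f i))) | v.
      v \<noteq> 0 \<and> (\<chi> i. cpoly_eval (($) v) (f i)) \<noteq> 0}"

text \<open>
  The bihomogeneous polynomials vanishing on the graph. They define its closure in the product
  of two planes as an integral scheme; when the common zero scheme Z of the \<open>f\<^sub>i\<close> is
  zero-dimensional, this is the blow-up of the plane along Z.
\<close>

definition graph_closure_forms :: "(3 \<Rightarrow> 3 cpoly) \<Rightarrow> (3 + 3) cpoly set" where
  "graph_closure_forms f = {F. (\<exists>a b. F \<in> biforms a b) \<and>
      (\<forall>(P, Q) \<in> map_graph f. \<forall>u\<in>P. \<forall>v\<in>Q. cpoly_eval (case_sum (($) u) (($) v)) F = 0)}"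

text \<open>
  The homogeneous ideal of the scheme-theoretic fibre over Q of the second projection from the
  closure of the graph, as a subscheme of the first factor: generated by the \<open>F (x, v)\<close>
  with F as above and v a coordinate vector of Q.
\<close>

definition fiber_ideal :: "(3 \<Rightarrow> 3 cpoly) \<Rightarrow> point \<Rightarrow> 3 cpoly set" where
  "fiber_ideal f Q =
     ideal_gen {cpoly_subst (case_sum Var (\<lambda>i. Const (v $ i))) F | F v. F \<in> graph_closure_forms f \<and> v \<in> Q}"

definition finite_fiber :: "(3 \<Rightarrow> 3 cpoly) \<Rightarrow> point \<Rightarrow> bool" where
  "finite_fiber f Q \<longleftrightarrow> finite (zero_locus (fiber_ideal f Q))"

definition contracted_curve :: "(3 \<Rightarrow> 3 cpoly) \<Rightarrow> point set \<Rightarrow> bool" where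
  "contracted_curve f C \<longleftrightarrow> irreducible_curve C \<and> (\<exists>Q. map_graph f `` C = {Q})"

text \<open>
  \<open>function_field\<close> is the field \<open>\<complex>(P\<^sup>2)\<close> of quotients of forms of equal degree, inside
  \<open>\<complex>(x\<^sub>0, x\<^sub>1, x\<^sub>2)\<close>; \<open>pullback_field f\<close> is the image of \<open>\<complex>(P\<^sup>2)\<close> under pullback along a dominant f.
\<close>

definition function_field :: "3 cpoly fract set" where
  "function_field = {Fract F G | F G. \<exists>n. F \<in> forms n \<and> G \<in> forms n \<and> G \<noteq> 0}"

definition pullback_field :: "(3 \<Rightarrow> 3 cpoly) \<Rightarrow> 3 cpoly fract set" where
  "pullback_field f = {Fract (cpoly_subst f F) (cpoly_subst f G) | F G.
      \<exists>n. F \<in> forms n \<and> G \<in> forms n \<and> cpoly_subst f G \<noteq> 0}"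

definition dominant_map :: "(3 \<Rightarrow> 3 cpoly) \<Rightarrow> bool" where
  "dominant_map f \<longleftrightarrow> (\<forall>W. zariski_closed W \<and> snd ` map_graph f \<subseteq> W \<longrightarrow> W = P2)"

text \<open>
  A dominant rational map is generically finite if the fibres over a nonempty Zariski open set
  are finite; its degree is the degree of the extension of function fields.
\<close>

definition generically_finite_of_degree :: "(3 \<Rightarrow> 3 cpoly) \<Rightarrow> nat \<Rightarrow> bool" where
  "generically_finite_of_degree f \<delta> \<longleftrightarrow> dominant_map f \<and>
     (\<exists>W. zariski_closed W \<and> W \<noteq> P2 \<and> (\<forall>Q \<in> P2 - W. finite_fiber f Q)) \<and>
     ring.dimension ring_of_type_algebra \<delta> (pullback_field f) function_field"

section \<open>Eigenschemes of ternary tensors\<close>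

text \<open>
  The tensor with entries \<open>T\<^bsub>i\<^sub>1\<dots>i\<^sub>d\<^esub>\<close> is given by the function \<open>[i\<^sub>1, \<dots>, i\<^sub>d] \<mapsto> T\<^bsub>i\<^sub>1\<dots>i\<^sub>d\<^esub>\<close>;
  only its values on lists of length d are ever used.
\<close>

type_synonym tensor = "3 list \<Rightarrow> complex"

definition tensor_form :: "nat \<Rightarrow> tensor \<Rightarrow> 3 \<Rightarrow> 3 cpoly" where
  "tensor_form d T i = (\<Sum>js | length js = d - 1. Const (T (i # js)) * (\<Prod>j\<leftarrow>js. Var j))"

text \<open>
  Addition on the index type is modulo 3, so these are \<open>x\<^sub>1 g\<^sub>2 - x\<^sub>2 g\<^sub>1\<close>, \<open>x\<^sub>2 g\<^sub>0 - x\<^sub>0 g\<^sub>2\<close>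
  and \<open>x\<^sub>0 g\<^sub>1 - x\<^sub>1 g\<^sub>0\<close>.
\<close>

definition laguerre :: "nat \<Rightarrow> tensor \<Rightarrow> 3 \<Rightarrow> 3 cpoly" where
  "laguerre d T i =
     Var (i + 1) * tensor_form d T (i + 2) - Var (i + 2) * tensor_form d T (i + 1)"

definition eigenscheme :: "nat \<Rightarrow> tensor \<Rightarrow> 3 cpoly set" where
  "eigenscheme d T = ideal_gen (range (laguerre d T))"

lemma laguerre_components:
  "laguerre d T 0 = Var 1 * tensor_form d T 2 - Var 2 * tensor_form d T 1"
  "laguerre d T 1 = Var 2 * tensor_form d T 0 - Var 0 * tensor_form d T 2"
  "laguerre d T 2 = Var 0 * tensor_form d T 1 - Var 1 * tensor_form d T 0"
proof -
  have mod3: "(1 :: 3) + 1 = 2" "(1 :: 3) + 2 = 0" "(2 :: 3) + 1 = 0" "(2 :: 3) + 2 = 1"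
    by simp_all
  show
    "laguerre d T 0 = Var 1 * tensor_form d T 2 - Var 2 * tensor_form d T 1"
    "laguerre d T 1 = Var 2 * tensor_form d T 0 - Var 0 * tensor_form d T 2"
    "laguerre d T 2 = Var 0 * tensor_form d T 1 - Var 1 * tensor_form d T 0"
    unfolding laguerre_def mod3 add_0 by (rule refl)+
qed

end

theory Submission
  imports Defs
begin

text \<open>
  Put \<open>n = d - 1\<close>, so that \<open>f = x \<times> g\<close> and \<open>x \<cdot> f = g \<cdot> f = 0\<close>. Hence the fibre of \<open>\<lambda>\<^sub>Z\<close> over \<open>q\<close> is contained in
  the scheme \<open>q \<cdot> x = q \<cdot> g = 0\<close>; in fact the two are equal, because the \<open>f\<^sub>i\<close> have no common factor.
  This is n points on the line \<open>q \<cdot> x = 0\<close> unless \<open>q \<cdot> g\<close> vanishes on that line, and then the line is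
  the fibre; so contracted curves are lines. Each contracted line lies on the curve
  \<open>f \<cdot> (Dg g) = 0\<close> of degree \<open>3n\<close>.

  For the degree, let K be the pulled back function field and \<open>t = x\<^sub>0 / x\<^sub>1\<close>. The equation
  \<open>f \<cdot> x = 0\<close> expresses \<open>x\<^sub>2 / x\<^sub>1\<close> linearly in t over K, and then \<open>f \<cdot> g = 0\<close> is an equation of degree n for t.
  A shorter equation would give a form of degree less than n in x that vanishes on the graph, and
  therefore on every line \<open>q \<cdot> x = 0\<close>.

  A curve C of degree k through base points is treated by induction on k. If C is irreducible, Bezout with the
  \<open>f\<^sub>i\<close> gives at most \<open>kd\<close> base points, and equality forces each point of C to be a base point or to lie in the
  same fibre as a chosen point of C, so that C is a line and \<open>k = 1\<close>.
\<close>

text \<open>Arguments about a fibre take place after elimination of one variable on the line q . x =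
  0. The ideal of q . x and q . g then becomes principal, generated by a form in two variables that
  is 0 or has degree n, so membership turns into divisibility; this is why an equation of the graph
  of degree below n in x has no room to be nonzero on such a line. The same fact shows that the
  curve of degree 3n is not the whole plane: otherwise the derivatives of y . g along the line y . x
  = 0, of degree n - 1 in x, would be equations of the graph. Degrees of schemes and the Bezout
  inequality come from dimensions of spaces of forms, with no intersection multiplicities. In the
  induction on base points the critical case is a pair of lines that both attain their bound: their
  common point is either one base point too many for one of them, or it forces both to be the line
  attached to its image.\<close>

section \<open>Ring homomorphisms, evaluation and substitution\<close>

locale comm_ring_hom =
  fixes h :: "'a::comm_ring_1 \<Rightarrow> 'b::comm_ring_1"
  assumes hom_one [simp]: "h 1 = 1"
    and hom_add: "h (a + b) = h a + h b"
    and hom_mult: "h (a * b) = h a * h b"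
begin

lemma hom_zero [simp]: "h 0 = 0"
  using hom_add[of 0 0] by simp

lemma hom_uminus: "h (- a) = - h a"
  using hom_add[of a "- a"] by (simp add: minus_unique)

lemma hom_diff: "h (a - b) = h a - h b"
  using hom_add[of a "- b"] by (simp add: hom_uminus)

lemma hom_power: "h (a ^ n) = h a ^ n"
  by (induction n) (simp_all add: hom_mult)

lemma hom_sum: "h (sum g A) = (\<Sum>x\<in>A. h (g x))"
  by (induction A rule: infinite_finite_induct) (simp_all add: hom_add)

lemma hom_prod: "h (prod g A) = (\<Prod>x\<in>A. h (g x))"
  by (induction A rule: infinite_finite_induct) (simp_all add: hom_mult)

lemma hom_dvd: "a dvd b \<Longrightarrow> h a dvd h b"
  by (auto simp: dvd_def hom_mult)

lemmas hom_simps = hom_add hom_mult hom_uminus hom_diff hom_power hom_sum hom_prod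

end

lemma comm_ring_hom_comp: "comm_ring_hom g \<Longrightarrow> comm_ring_hom h \<Longrightarrow> comm_ring_hom (\<lambda>x. g (h x))"
  by (simp add: comm_ring_hom_def)

lemma comm_ring_hom_id: "comm_ring_hom (\<lambda>x. x)"
  by (simp add: comm_ring_hom_def)

lemma comm_ring_hom_Const: "comm_ring_hom (Const :: complex \<Rightarrow> 'v cpoly)"
  by unfold_locales (simp_all add: Const_def single_add mult_single)

interpretation Const: comm_ring_hom "Const :: complex \<Rightarrow> 'v cpoly"
  by (rule comm_ring_hom_Const)

lemma comm_ring_hom_const_poly: "comm_ring_hom (\<lambda>a::'a::comm_ring_1. [:a:])"
  by unfold_locales (simp_all add: one_pCons)

lemma comm_ring_hom_poly: "comm_ring_hom (\<lambda>p::'a::comm_ring_1 poly. poly p x)"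
  by unfold_locales simp_all

lemma poly_mapping_decompose:
  fixes F :: "'a \<Rightarrow>\<^sub>0 'b::comm_monoid_add"
  shows "(\<Sum>m\<in>Poly_Mapping.keys F. Poly_Mapping.single m (Poly_Mapping.lookup F m)) = F"
proof (rule poly_mapping_eqI)
  fix k
  have "(\<Sum>m\<in>Poly_Mapping.keys F. Poly_Mapping.lookup (Poly_Mapping.single m (Poly_Mapping.lookup F m)) k)
    = (\<Sum>m\<in>Poly_Mapping.keys F. if m = k then Poly_Mapping.lookup F m else 0)"
    by (rule sum.cong) (auto simp: lookup_single when_def)
  also have "\<dots> = Poly_Mapping.lookup F k"
    by (simp add: sum.delta in_keys_iff)
  finally show "Poly_Mapping.lookup (\<Sum>m\<in>Poly_Mapping.keys F. Poly_Mapping.single m (Poly_Mapping.lookup F m)) k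
    = Poly_Mapping.lookup F k"
    by (simp add: lookup_sum)
qed

lemma Var_power: "Var i ^ n = Poly_Mapping.single (Poly_Mapping.single i n) 1"
  by (induction n) (simp_all add: Var_def mult_single single_add[symmetric])

lemma prod_single_one:
  "finite A \<Longrightarrow> (\<Prod>i\<in>A. Poly_Mapping.single (g i) (1::complex)) = Poly_Mapping.single (\<Sum>i\<in>A. g i) 1"
  by (induction A rule: finite_induct) (simp_all add: mult_single)

lemma sum_single_lookup:
  fixes m :: "'v::finite \<Rightarrow>\<^sub>0 nat"
  shows "(\<Sum>i\<in>UNIV. Poly_Mapping.single i (Poly_Mapping.lookup m i)) = m"
  by (rule poly_mapping_eqI) (simp add: lookup_sum lookup_single when_def)

lemma single_eq_Const_Var:
  fixes m :: "'v::finite \<Rightarrow>\<^sub>0 nat"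
  shows "Poly_Mapping.single m c = Const c * (\<Prod>i\<in>UNIV. Var i ^ Poly_Mapping.lookup m i)"
  by (simp add: Var_power prod_single_one sum_single_lookup Const_def mult_single)

text \<open>Constants and variables generate the polynomial ring, so a property stable under sums
  and products need only be checked on them.\<close>

lemma cpoly_induct [case_names Const Var add mult]:
  fixes F :: "'v::finite cpoly"
  assumes C: "\<And>c. P (Const c)" and V: "\<And>i. P (Var i)"
    and A: "\<And>F G. P F \<Longrightarrow> P G \<Longrightarrow> P (F + G)" and M: "\<And>F G. P F \<Longrightarrow> P G \<Longrightarrow> P (F * G)"
  shows "P F"
proof -
  have P1: "P 1" using C[of 1] by simp
  have P0: "P 0" using C[of 0] by simp
  have pw: "P (Var i ^ n)" for i n by (induction n) (auto intro: P1 M V)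
  have pr: "finite A \<Longrightarrow> P (\<Prod>i\<in>A. Var i ^ g i)" for A g
    by (induction A rule: finite_induct) (auto intro: P1 M pw)
  have s: "P (Poly_Mapping.single m c)" for m c
    by (subst single_eq_Const_Var) (intro M C pr finite)
  have sm: "finite A \<Longrightarrow> P (\<Sum>m\<in>A. Poly_Mapping.single m (g m))" for A g
    by (induction A rule: finite_induct) (auto intro: P0 A s)
  show ?thesis
    using sm[of "Poly_Mapping.keys F" "Poly_Mapping.lookup F"] by (simp add: poly_mapping_decompose)
qed

text \<open>Common generalization of \<open>cpoly_eval\<close> and \<open>cpoly_subst\<close>: the
  coefficients are sent by \<phi> to an arbitrary commutative ring. Univariate polynomials over that
  ring and fractions occur as targets too, and all of them share one proof of the homomorphism
  property.\<close>

definition pm_eval :: "(complex \<Rightarrow> 'r::comm_ring_1) \<Rightarrow> ('v::finite \<Rightarrow> 'r) \<Rightarrow> 'v cpoly \<Rightarrow> 'r" where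
  "pm_eval \<phi> v F =
     (\<Sum>m\<in>Poly_Mapping.keys F. \<phi> (Poly_Mapping.lookup F m) * (\<Prod>i\<in>UNIV. v i ^ Poly_Mapping.lookup m i))"

lemma cpoly_eval_eq_pm_eval: "cpoly_eval = pm_eval (\<lambda>c. c)"
  by (intro ext) (simp add: cpoly_eval_def pm_eval_def)

lemma cpoly_subst_eq_pm_eval: "cpoly_subst = pm_eval Const"
  by (intro ext) (simp add: cpoly_subst_def pm_eval_def)

context
  fixes \<phi> :: "complex \<Rightarrow> 'r::comm_ring_1"
  assumes hom: "comm_ring_hom \<phi>"
begin

interpretation comm_ring_hom \<phi> by (rule hom)

lemma pm_eval_superset:
  assumes "finite A" "Poly_Mapping.keys F \<subseteq> A"
  shows "pm_eval \<phi> v F =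
    (\<Sum>m\<in>A. \<phi> (Poly_Mapping.lookup F m) * (\<Prod>i\<in>UNIV. v i ^ Poly_Mapping.lookup m i))"
  unfolding pm_eval_def by (rule sum.mono_neutral_left) (use assms in \<open>auto simp: in_keys_iff\<close>)

lemma pm_eval_add: "pm_eval \<phi> v (F + G) = pm_eval \<phi> v F + pm_eval \<phi> v G"
proof -
  let ?A = "Poly_Mapping.keys F \<union> Poly_Mapping.keys G"
  have "Poly_Mapping.keys (F + G) \<subseteq> ?A" by (rule keys_add)
  then show ?thesis
    by (simp add: pm_eval_superset[of ?A] lookup_add hom_add distrib_right sum.distrib)
qed

lemma pm_eval_single:
  "pm_eval \<phi> v (Poly_Mapping.single m c) = \<phi> c * (\<Prod>i\<in>UNIV. v i ^ Poly_Mapping.lookup m i)"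
  by (subst pm_eval_superset[of "{m}"]) auto

lemma pm_eval_sum: "pm_eval \<phi> v (sum g A) = (\<Sum>x\<in>A. pm_eval \<phi> v (g x))"
  by (induction A rule: infinite_finite_induct) (simp_all add: pm_eval_add, simp_all add: pm_eval_def)

lemma comm_ring_hom_pm_eval: "comm_ring_hom (pm_eval \<phi> v)"
proof
  show "pm_eval \<phi> v 1 = 1" 
    by (simp flip: single_one add: pm_eval_single)
  show "pm_eval \<phi> v (F + G) = pm_eval \<phi> v F + pm_eval \<phi> v G" for F G by (rule pm_eval_add)
  fix F G :: "'a cpoly"
  have S: "pm_eval \<phi> v (Poly_Mapping.single m c * Poly_Mapping.single m' c')
     = pm_eval \<phi> v (Poly_Mapping.single m c) * pm_eval \<phi> v (Poly_Mapping.single m' c')" for m m' c c'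
    by (simp add: mult_single pm_eval_single hom_mult lookup_add power_add prod.distrib ac_simps)
  have "pm_eval \<phi> v ((\<Sum>m\<in>Poly_Mapping.keys F. Poly_Mapping.single m (Poly_Mapping.lookup F m)) *
      (\<Sum>m\<in>Poly_Mapping.keys G. Poly_Mapping.single m (Poly_Mapping.lookup G m))) =
    pm_eval \<phi> v (\<Sum>m\<in>Poly_Mapping.keys F. Poly_Mapping.single m (Poly_Mapping.lookup F m)) *
    pm_eval \<phi> v (\<Sum>m\<in>Poly_Mapping.keys G. Poly_Mapping.single m (Poly_Mapping.lookup G m))"
    by (simp only: sum_product pm_eval_sum S)
  then show "pm_eval \<phi> v (F * G) = pm_eval \<phi> v F * pm_eval \<phi> v G"
    by (simp only: poly_mapping_decompose)
qed

lemma pm_eval_Const [simp]: "pm_eval \<phi> v (Const c) = \<phi> c"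
  by (simp add: Const_def pm_eval_single)

lemma pm_eval_Var [simp]: "pm_eval \<phi> v (Var j) = v j"
proof -
  have "(\<Prod>i\<in>UNIV. v i ^ Poly_Mapping.lookup (Poly_Mapping.single j (1::nat)) i) = (\<Prod>i\<in>UNIV. if i = j then v i else 1)"
    by (rule prod.cong) (auto simp: lookup_single when_def)
  then show ?thesis by (simp add: Var_def pm_eval_single)
qed

end

text \<open>Universal property of the polynomial ring. Compatibilities between evaluations,
  substitutions and their composites are obtained from it by comparing values on constants and
  variables.\<close>

lemma comm_ring_hom_unique:
  fixes h h' :: "'v::finite cpoly \<Rightarrow> 'r::comm_ring_1"
  assumes "comm_ring_hom h" "comm_ring_hom h'"
    and "\<And>c. h (Const c) = h' (Const c)" and "\<And>i. h (Var i) = h' (Var i)"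
  shows "h F = h' F"
  by (induction F rule: cpoly_induct)
    (use assms in \<open>auto simp: comm_ring_hom.hom_add comm_ring_hom.hom_mult\<close>)

lemma comm_ring_hom_cpoly_eval: "comm_ring_hom (cpoly_eval v)"
  unfolding cpoly_eval_eq_pm_eval by (rule comm_ring_hom_pm_eval[OF comm_ring_hom_id])

lemma comm_ring_hom_cpoly_subst: "comm_ring_hom (cpoly_subst \<sigma>)"
  unfolding cpoly_subst_eq_pm_eval by (rule comm_ring_hom_pm_eval[OF comm_ring_hom_Const])

interpretation ev: comm_ring_hom "cpoly_eval v" for v by (rule comm_ring_hom_cpoly_eval)
interpretation sb: comm_ring_hom "cpoly_subst \<sigma>" for \<sigma> by (rule comm_ring_hom_cpoly_subst)

lemma cpoly_eval_Const [simp]: "cpoly_eval v (Const c) = c"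
  and cpoly_eval_Var [simp]: "cpoly_eval v (Var i) = v i"
  unfolding cpoly_eval_eq_pm_eval by (simp_all add: comm_ring_hom_id)

lemma cpoly_subst_Const [simp]: "cpoly_subst \<sigma> (Const c) = Const c"
  and cpoly_subst_Var [simp]: "cpoly_subst \<sigma> (Var i) = \<sigma> i"
  unfolding cpoly_subst_eq_pm_eval by (simp_all add: comm_ring_hom_Const)

lemma cpoly_eval_subst: "cpoly_eval w (cpoly_subst \<sigma> F) = cpoly_eval (\<lambda>i. cpoly_eval w (\<sigma> i)) F"
  by (rule comm_ring_hom_unique[OF comm_ring_hom_comp[OF comm_ring_hom_cpoly_eval comm_ring_hom_cpoly_subst]
        comm_ring_hom_cpoly_eval]) simp_all

lemma cpoly_subst_subst: "cpoly_subst \<tau> (cpoly_subst \<sigma> F) = cpoly_subst (\<lambda>i. cpoly_subst \<tau> (\<sigma> i)) F"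
  by (rule comm_ring_hom_unique[OF comm_ring_hom_comp[OF comm_ring_hom_cpoly_subst comm_ring_hom_cpoly_subst]
        comm_ring_hom_cpoly_subst]) simp_all

lemma cpoly_subst_Var_id: "cpoly_subst Var F = F"
  by (rule comm_ring_hom_unique[OF comm_ring_hom_cpoly_subst comm_ring_hom_id]) simp_all

text \<open>Substitution respects congruence modulo D. It serves with D a linear form, to eliminate
  a variable, and with D a two by two minor, to pass from the graph to a fibre.\<close>

lemma cpoly_subst_cong_dvd:
  assumes "\<And>i. D dvd \<sigma> i - \<tau> i"
  shows "D dvd cpoly_subst \<sigma> F - cpoly_subst \<tau> F"
proof (induction F rule: cpoly_induct)
  case (add F G)
  have "cpoly_subst \<sigma> (F + G) - cpoly_subst \<tau> (F + G) =
    (cpoly_subst \<sigma> F - cpoly_subst \<tau> F) + (cpoly_subst \<sigma> G - cpoly_subst \<tau> G)"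
    by (simp add: sb.hom_add)
  then show ?case using add by simp
next
  case (mult F G)
  have "cpoly_subst \<sigma> (F * G) - cpoly_subst \<tau> (F * G) =
    cpoly_subst \<sigma> F * (cpoly_subst \<sigma> G - cpoly_subst \<tau> G) + (cpoly_subst \<sigma> F - cpoly_subst \<tau> F) * cpoly_subst \<tau> G"
    by (simp add: sb.hom_mult algebra_simps)
  then show ?case using mult by simp
qed (use assms in auto)

section \<open>Homogeneous polynomials\<close>

text \<open>The weight takes values in any commutative monoid, so that total degree, bidegree and
  degree in a single variable are instances of one notion.\<close>

definition homog :: "(('v \<Rightarrow>\<^sub>0 nat) \<Rightarrow> 'g::comm_monoid_add) \<Rightarrow> 'g \<Rightarrow> 'v cpoly set" where
  "homog w g = {F. \<forall>m\<in>Poly_Mapping.keys F. w m = g}"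

lemma homog_zero [simp]: "0 \<in> homog w g"
  by (simp add: homog_def)

lemma homog_add: "F \<in> homog w g \<Longrightarrow> G \<in> homog w g \<Longrightarrow> F + G \<in> homog w g"
  using keys_add[of F G] by (auto simp: homog_def)

lemma homog_uminus: "F \<in> homog w g \<Longrightarrow> - F \<in> homog w g"
  by (simp add: homog_def in_keys_iff)

lemma homog_diff: "F \<in> homog w g \<Longrightarrow> G \<in> homog w g \<Longrightarrow> F - G \<in> homog w g"
  using homog_add[of F w g "- G"] homog_uminus[of G w g] by simp

lemma homog_sum: "(\<And>x. x \<in> A \<Longrightarrow> u x \<in> homog w g) \<Longrightarrow> sum u A \<in> homog w g"
  by (induction A rule: infinite_finite_induct) (auto intro: homog_add)

lemma homog_mult:
  assumes "\<And>m m'. w (m + m') = w m + w m'" "F \<in> homog w g" "G \<in> homog w g'"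
  shows "F * G \<in> homog w (g + g')"
  using keys_mult[of F G] assms by (fastforce simp: homog_def)

definition wdeg :: "('v::finite \<Rightarrow>\<^sub>0 nat) \<Rightarrow> nat" where
  "wdeg m = (\<Sum>i\<in>UNIV. Poly_Mapping.lookup m i)"

definition wbideg :: "((3 + 3) \<Rightarrow>\<^sub>0 nat) \<Rightarrow> nat \<times> nat" where
  "wbideg m = (\<Sum>i\<in>UNIV. Poly_Mapping.lookup m (Inl i), \<Sum>i\<in>UNIV. Poly_Mapping.lookup m (Inr i))"

lemma forms_eq_homog: "forms n = homog wdeg n"
  by (simp add: forms_def homog_def wdeg_def)

lemma biforms_eq_homog: "biforms a b = homog wbideg (a, b)"
  by (simp add: biforms_def homog_def wbideg_def)

lemma wdeg_add: "wdeg (m + m') = wdeg m + wdeg m'"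
  by (simp add: wdeg_def lookup_add sum.distrib)

lemma wbideg_add: "wbideg (m + m') = wbideg m + wbideg m'"
  by (simp add: wbideg_def lookup_add sum.distrib)

lemma forms_zero [simp]: "0 \<in> forms n"
  and forms_add: "F \<in> forms n \<Longrightarrow> G \<in> forms n \<Longrightarrow> F + G \<in> forms n"
  and forms_diff: "F \<in> forms n \<Longrightarrow> G \<in> forms n \<Longrightarrow> F - G \<in> forms n"
  and forms_uminus: "F \<in> forms n \<Longrightarrow> - F \<in> forms n"
  and forms_sum: "(\<And>x. x \<in> A \<Longrightarrow> u x \<in> forms n) \<Longrightarrow> sum u A \<in> forms n"
  and forms_mult: "F \<in> forms n \<Longrightarrow> G \<in> forms n' \<Longrightarrow> F * G \<in> forms (n + n')"
  unfolding forms_eq_homog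
  by (simp_all add: homog_add homog_diff homog_uminus homog_sum homog_mult wdeg_add)

lemma biforms_zero [simp]: "0 \<in> biforms a b"
  and biforms_add: "F \<in> biforms a b \<Longrightarrow> G \<in> biforms a b \<Longrightarrow> F + G \<in> biforms a b"
  and biforms_diff: "F \<in> biforms a b \<Longrightarrow> G \<in> biforms a b \<Longrightarrow> F - G \<in> biforms a b"
  and biforms_sum: "(\<And>x. x \<in> A \<Longrightarrow> u x \<in> biforms a b) \<Longrightarrow> sum u A \<in> biforms a b"
  and biforms_mult: "F \<in> biforms a b \<Longrightarrow> G \<in> biforms a' b' \<Longrightarrow> F * G \<in> biforms (a + a') (b + b')"
  unfolding biforms_eq_homog
  using homog_mult[of wbideg F "(a, b)" G "(a', b')"]
  by (simp_all add: homog_add homog_diff homog_sum wbideg_add)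

lemma forms_Const [simp]: "Const c \<in> forms 0"
  by (auto simp: forms_def Const_def)

lemma forms_one [simp]: "1 \<in> forms 0"
  using forms_Const[of 1] by (simp del: forms_Const)

lemma forms_Var [simp]: "Var i \<in> forms 1"
  by (auto simp: forms_def Var_def lookup_single when_def)

lemma forms_power: "F \<in> forms n \<Longrightarrow> F ^ k \<in> forms (n * k)"
  by (induction k) (auto dest: forms_mult)

lemma forms_Const_mult: "F \<in> forms n \<Longrightarrow> Const c * F \<in> forms n"
  using forms_mult[OF forms_Const] by fastforce

lemma forms_prod: "(\<And>x. x \<in> A \<Longrightarrow> u x \<in> forms (e x)) \<Longrightarrow> prod u A \<in> forms (sum e A)"
  by (induction A rule: infinite_finite_induct) (auto intro: forms_mult)

lemma biforms_Const [simp]: "Const c \<in> biforms 0 0"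
  by (auto simp: biforms_def Const_def)

lemma biforms_one [simp]: "1 \<in> biforms 0 0"
  using biforms_Const[of 1] by (simp del: biforms_Const)

lemma biforms_VarL [simp]: "Var (Inl i) \<in> biforms 1 0"
  by (auto simp: biforms_def Var_def lookup_single when_def)

lemma biforms_VarR [simp]: "Var (Inr i) \<in> biforms 0 1"
  by (auto simp: biforms_def Var_def lookup_single when_def)

lemma biforms_power: "F \<in> biforms a b \<Longrightarrow> F ^ k \<in> biforms (a * k) (b * k)"
  by (induction k) (auto dest: biforms_mult)

lemma biforms_prod: "(\<And>x. x \<in> A \<Longrightarrow> u x \<in> biforms (e x) (e' x)) \<Longrightarrow> prod u A \<in> biforms (sum e A) (sum e' A)"
  by (induction A rule: infinite_finite_induct) (auto intro: biforms_mult)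

lemma cpoly_subst_forms:
  assumes F: "F \<in> forms n" and s: "\<And>i. \<sigma> i \<in> forms a"
  shows "cpoly_subst \<sigma> F \<in> forms (a * n)"
  unfolding cpoly_subst_def
proof (rule forms_sum)
  fix m assume m: "m \<in> Poly_Mapping.keys F"
  have "(\<Prod>i\<in>UNIV. \<sigma> i ^ Poly_Mapping.lookup m i) \<in> forms (\<Sum>i\<in>UNIV. a * Poly_Mapping.lookup m i)"
    by (intro forms_prod forms_power s)
  moreover have "(\<Sum>i\<in>UNIV. a * Poly_Mapping.lookup m i) = a * n"
    using F m by (simp add: forms_def sum_distrib_left[symmetric])
  ultimately show "Const (Poly_Mapping.lookup F m) * (\<Prod>i\<in>UNIV. \<sigma> i ^ Poly_Mapping.lookup m i) \<in> forms (a * n)"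
    by (simp add: forms_Const_mult)
qed

lemma cpoly_subst_biforms:
  assumes F: "F \<in> forms n" and s: "\<And>i. \<sigma> i \<in> biforms a b"
  shows "cpoly_subst \<sigma> F \<in> biforms (a * n) (b * n)"
  unfolding cpoly_subst_def
proof (rule biforms_sum)
  fix m assume m: "m \<in> Poly_Mapping.keys F"
  have "(\<Prod>i\<in>UNIV. \<sigma> i ^ Poly_Mapping.lookup m i) \<in> 
     biforms (\<Sum>i\<in>UNIV. a * Poly_Mapping.lookup m i) (\<Sum>i\<in>UNIV. b * Poly_Mapping.lookup m i)"
    by (intro biforms_prod biforms_power s)
  moreover have "(\<Sum>i\<in>UNIV. a * Poly_Mapping.lookup m i) = a * n" "(\<Sum>i\<in>UNIV. b * Poly_Mapping.lookup m i) = b * n"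
    using F m by (simp_all add: forms_def sum_distrib_left[symmetric])
  ultimately show "Const (Poly_Mapping.lookup F m) * (\<Prod>i\<in>UNIV. \<sigma> i ^ Poly_Mapping.lookup m i) \<in> biforms (a * n) (b * n)"
    using biforms_mult[OF biforms_Const] by fastforce
qed

lemma prod_sum_UNIV: "(\<Prod>i\<in>(UNIV :: ('a::finite + 'b::finite) set). u i) = (\<Prod>i\<in>UNIV. u (Inl i)) * (\<Prod>i\<in>UNIV. u (Inr i))"
  by (subst UNIV_sum, subst prod.union_disjoint) (auto simp: prod.reindex inj_on_def)

text \<open>The scalar c lies in the target ring. It may be a new variable, which yields a grading,
  or the fraction \<open>1 / to_fract (Var 1)\<close>, which dehomogenizes.\<close>

lemma pm_eval_scale:
  assumes "F \<in> forms n"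
  shows "pm_eval \<phi> (\<lambda>i. c * v i) F = c ^ n * pm_eval \<phi> v F"
proof -
  have "(\<Prod>i\<in>UNIV. (c * v i) ^ Poly_Mapping.lookup m i) = c ^ n * (\<Prod>i\<in>UNIV. v i ^ Poly_Mapping.lookup m i)"
    if "m \<in> Poly_Mapping.keys F" for m
    using assms that by (simp add: power_mult_distrib prod.distrib forms_def flip: power_sum)
  then show ?thesis
    by (simp add: pm_eval_def sum_distrib_left mult_ac)
qed

lemma cpoly_eval_scale: "F \<in> forms n \<Longrightarrow> cpoly_eval (\<lambda>i. c * v i) F = c ^ n * cpoly_eval v F"
  by (simp add: cpoly_eval_eq_pm_eval pm_eval_scale)

lemma cpoly_subst_biscale:
  assumes "F \<in> biforms a b"
  shows "cpoly_subst (case_sum \<sigma> (\<lambda>i. c * v i)) F = c ^ b * cpoly_subst (case_sum \<sigma> v) F"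
proof -
  have "(\<Prod>i\<in>UNIV. (case_sum \<sigma> (\<lambda>i. c * v i) i) ^ Poly_Mapping.lookup m i) = c ^ b * (\<Prod>i\<in>UNIV. (case_sum \<sigma> v i) ^ Poly_Mapping.lookup m i)"
    if "m \<in> Poly_Mapping.keys F" for m
    using assms that by (simp add: prod_sum_UNIV power_mult_distrib prod.distrib biforms_def mult_ac flip: power_sum)
  then show ?thesis
    by (simp add: cpoly_subst_def sum_distrib_left mult_ac)
qed

section \<open>Index arithmetic modulo 3\<close>

lemma cases_3: "(i::3) = 0 \<or> i = 1 \<or> i = 2"
proof (induct i)
  case (of_int z)
  then have "z = 0 \<or> z = 1 \<or> z = 2" by simp arith
  then show ?case by auto
qed

lemma UNIV_3: "UNIV = {0, 1, 2 :: 3}"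
proof (rule Set.set_eqI)
  show "x \<in> UNIV \<longleftrightarrow> x \<in> {0, 1, 2}" for x :: 3 using cases_3[of x] by simp
qed

lemma UNIV_3_shift: "UNIV = {i, i + 1, i + 2 :: 3}"
proof -
  have "i = 0 \<or> i = 1 \<or> i = 2" by (rule cases_3)
  moreover have "(1 :: 3) + 1 = 2" "(1 :: 3) + 2 = 0" "(2 :: 3) + 1 = 0" "(2 :: 3) + 2 = 1" by simp_all
  ultimately have "{0, 1, 2} = {i, i + 1, i + 2}" by (elim disjE) (simp_all only: add_0 insert_commute)
  then show ?thesis by (simp only: UNIV_3)
qed

lemma shift_3_neq: "(i::3) \<noteq> i + 1" "(i::3) \<noteq> i + 2" "(i::3) + 1 \<noteq> i + 2"
  by simp_all

lemma sum_3: "(\<Sum>j\<in>UNIV. u j) = u 0 + u 1 + u (2::3)"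
  unfolding UNIV_3 by (simp add: add.assoc)

lemma prod_3: "(\<Prod>j\<in>UNIV. u j) = u 0 * u 1 * u (2::3)"
  unfolding UNIV_3 by (simp add: mult.assoc)

lemma sum_3_shift: "(\<Sum>j\<in>UNIV. u j) = u i + u (i + 1) + u (i + 2 :: 3)"
  by (subst UNIV_3_shift[of i]) (simp add: add.assoc)

section \<open>Unique factorization\<close>

locale comm_ring_iso = comm_ring_hom h for h :: "'a::idom \<Rightarrow> 'b::idom" +
  assumes bij: "bij h"
begin

lemma iso_eq_iff: "h a = h b \<longleftrightarrow> a = b"
  using bij by (simp add: bij_is_inj inj_eq)

lemma iso_zero_iff: "h a = 0 \<longleftrightarrow> a = 0"
  using iso_eq_iff[of a 0] by simp

lemma iso_surj: "\<exists>a. b = h a"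
  using bij by (simp add: bij_is_surj surjD)

lemma iso_dvd_iff: "h a dvd h b \<longleftrightarrow> a dvd b"
proof
  assume "h a dvd h b"
  then obtain c where c: "h b = h a * c" by (auto simp: dvd_def)
  obtain c' where "c = h c'" using iso_surj by blast
  with c have "h b = h (a * c')" by (simp add: hom_mult)
  then show "a dvd b" by (simp add: iso_eq_iff)
qed (rule hom_dvd)

lemma iso_unit_iff: "h a dvd 1 \<longleftrightarrow> a dvd 1"
  using iso_dvd_iff[of a 1] by simp

lemma iso_irreducible:
  assumes "irreducible a"
  shows "irreducible (h a)"
proof (rule irreducibleI)
  show "h a \<noteq> 0" "\<not> h a dvd 1" using assms by (auto simp: iso_zero_iff iso_unit_iff irreducible_def)
  fix x y assume xy: "h a = x * y"
  obtain x' y' where x': "x = h x'" "y = h y'" using iso_surj by blast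
  then have "a = x' * y'" using xy by (simp add: iso_eq_iff flip: hom_mult)
  then show "x dvd 1 \<or> y dvd 1" using assms irreducibleD x' by (auto simp: iso_unit_iff)
qed

lemma iso_prime_elem:
  assumes "prime_elem (h a)"
  shows "prime_elem a"
proof (rule prime_elemI)
  show "a \<noteq> 0" "\<not> a dvd 1" using assms by (auto simp: iso_zero_iff iso_unit_iff prime_elem_def)
  fix x y assume "a dvd x * y"
  then have "h a dvd h x * h y" by (metis hom_dvd hom_mult)
  then show "a dvd x \<or> a dvd y" using prime_elem_dvd_multD[OF assms, of "h x" "h y"] by (simp add: iso_dvd_iff)
qed

end

text \<open>Iterated univariate polynomials, with x_2 outermost and x_0 innermost. That ring is
  factorial, and the isomorphism carries gcds and the primality of irreducible elements over to
  ternary polynomials.\<close>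

definition to_poly3 :: "3 cpoly \<Rightarrow> complex poly poly poly" where
  "to_poly3 = pm_eval (\<lambda>c. [:[:[:c:]:]:])
     (\<lambda>i. if i = 0 then [:[:[:0, 1:]:]:] else if i = 1 then [:[:0, 1:]:] else [:0, 1:])"

lemma comm_ring_hom_const_poly3: "comm_ring_hom (\<lambda>c::complex. [:[:[:c:]:]:])"
  by unfold_locales (simp_all add: one_pCons)

lemma comm_ring_hom_to_poly3: "comm_ring_hom to_poly3"
  unfolding to_poly3_def by (rule comm_ring_hom_pm_eval[OF comm_ring_hom_const_poly3])

interpretation to_poly3: comm_ring_hom to_poly3
  by (rule comm_ring_hom_to_poly3)

lemma const_poly_power: "[:p:] ^ n = [:p ^ n:]"
  by (induction n) (simp_all add: one_pCons mult.commute)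

lemma X_power_monom: "[:0, 1:] ^ n = Polynomial.monom 1 n"
  by (simp add: monom_altdef)

lemma to_poly3_single:
  "to_poly3 (Poly_Mapping.single m c) =
    Polynomial.monom (Polynomial.monom (Polynomial.monom c (Poly_Mapping.lookup m 0)) (Poly_Mapping.lookup m 1)) (Poly_Mapping.lookup m 2)"
  unfolding to_poly3_def
  by (simp add: pm_eval_single[OF comm_ring_hom_const_poly3] prod_3 const_poly_power X_power_monom smult_monom)

lemma monom_index_3_eq:
  fixes m m' :: "3 \<Rightarrow>\<^sub>0 nat"
  shows "m = m' \<longleftrightarrow> Poly_Mapping.lookup m 0 = Poly_Mapping.lookup m' 0 \<and>
     Poly_Mapping.lookup m 1 = Poly_Mapping.lookup m' 1 \<and> Poly_Mapping.lookup m 2 = Poly_Mapping.lookup m' 2"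
proof
  assume *: "Poly_Mapping.lookup m 0 = Poly_Mapping.lookup m' 0 \<and>
     Poly_Mapping.lookup m 1 = Poly_Mapping.lookup m' 1 \<and> Poly_Mapping.lookup m 2 = Poly_Mapping.lookup m' 2"
  show "m = m'"
  proof (rule poly_mapping_eqI)
    show "Poly_Mapping.lookup m i = Poly_Mapping.lookup m' i" for i
      using * cases_3[of i] by auto
  qed
qed simp

lemma coeff_to_poly3:
  "Polynomial.coeff (Polynomial.coeff (Polynomial.coeff (to_poly3 F) (Poly_Mapping.lookup m 2)) (Poly_Mapping.lookup m 1))
     (Poly_Mapping.lookup m 0) = Poly_Mapping.lookup F m"
proof -
  have "to_poly3 F = (\<Sum>m\<in>Poly_Mapping.keys F. to_poly3 (Poly_Mapping.single m (Poly_Mapping.lookup F m)))"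
    by (subst poly_mapping_decompose[of F, symmetric]) (simp only: to_poly3.hom_sum)
  then have "Polynomial.coeff (Polynomial.coeff (Polynomial.coeff (to_poly3 F) (Poly_Mapping.lookup m 2)) (Poly_Mapping.lookup m 1))
     (Poly_Mapping.lookup m 0) = (\<Sum>m'\<in>Poly_Mapping.keys F. if m' = m then Poly_Mapping.lookup F m' else 0)"
    by (auto simp: to_poly3_single coeff_sum Polynomial.coeff_monom monom_index_3_eq[of _ m] intro!: sum.cong)
  then show ?thesis by (simp add: sum.delta in_keys_iff)
qed

lemma inj_to_poly3: "inj to_poly3"
proof (rule injI)
  fix F G assume "to_poly3 F = to_poly3 G"
  then show "F = G" by (intro poly_mapping_eqI) (metis coeff_to_poly3)
qed

lemma surj_to_poly3: "surj to_poly3"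
proof -
  let ?R = "range to_poly3"
  have add: "p + q \<in> ?R" and mult: "p * q \<in> ?R" if "p \<in> ?R" "q \<in> ?R" for p q
    using that by (metis (no_types, opaque_lifting) imageE rangeI to_poly3.hom_add to_poly3.hom_mult)+
  have V: "[:0, 1:] \<in> ?R" "[:[:0, 1:]:] \<in> ?R" "[:[:[:0, 1:]:]:] \<in> ?R"
    using rangeI[of to_poly3 "Var 2"] rangeI[of to_poly3 "Var 1"] rangeI[of to_poly3 "Var 0"]
    by (simp_all add: to_poly3_def comm_ring_hom_const_poly3)
  have C0: "[:[:[:c:]:]:] \<in> ?R" for c
    using rangeI[of to_poly3 "Const c"] by (simp add: to_poly3_def comm_ring_hom_const_poly3)
  have C1: "[:[:p:]:] \<in> ?R" for p
  proof (induction p)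
    case 0 show ?case using C0[of 0] by simp
  next
    case (pCons a p)
    have "[:[:pCons a p:]:] = [:[:[:a:]:]:] + [:[:[:0, 1:]:]:] * [:[:p:]:]" by simp
    then show ?case using add[OF C0 mult[OF V(3) pCons(2)]] by simp
  qed
  have C2: "[:p:] \<in> ?R" for p
  proof (induction p)
    case 0 show ?case using C0[of 0] by simp
  next
    case (pCons a p)
    have "[:pCons a p:] = [:[:a:]:] + [:[:0, 1:]:] * [:p:]" by simp
    then show ?case using add[OF C1 mult[OF V(2) pCons(2)]] by simp
  qed
  have "p \<in> ?R" for p
  proof (induction p)
    case 0 show ?case using C0[of 0] by simp
  next
    case (pCons a p)
    have "pCons a p = [:a:] + [:0, 1:] * p" by simp
    then show ?case using add[OF C2 mult[OF V(1) pCons(2)]] by simp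
  qed
  then show ?thesis by blast
qed

interpretation to_poly3: comm_ring_iso to_poly3
  by unfold_locales (simp add: bij_def inj_to_poly3 surj_to_poly3)

lemma irreducible_imp_prime_elem_cpoly: "irreducible F \<Longrightarrow> prime_elem (F :: 3 cpoly)"
  by (simp add: to_poly3.iso_irreducible to_poly3.iso_prime_elem irreducible_imp_prime_elem)

text \<open>The gcd of a and b is coprime to g and divides w * g, hence divides w. Since D divides
  the gcd of the two given products, which is the e-th power of that gcd times P, it divides
  \<open>w ^ e * P\<close>.\<close>

lemma dvd_power_mult_gcd:
  fixes a b D P w g :: "'a::{factorial_ring_gcd, semiring_gcd_mult_normalize}"
  assumes D: "D dvd a ^ e * P" "D dvd b ^ e * P"
    and cop: "\<And>c. c dvd a \<Longrightarrow> c dvd b \<Longrightarrow> c dvd g \<Longrightarrow> c dvd 1"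
    and w: "\<And>c. c dvd a \<Longrightarrow> c dvd b \<Longrightarrow> c dvd w * g"
  shows "D dvd w ^ e * P"
proof -
  have "coprime (gcd a b) g"
    by (rule coprimeI) (use cop in auto)
  moreover have "gcd a b dvd w * g" by (intro w) auto
  ultimately have "gcd a b dvd w"
    by (simp add: coprime_dvd_mult_left_iff)
  then have "gcd (a ^ e) (b ^ e) dvd w ^ e"
    by (simp add: gcd_exp dvd_power_same)
  moreover have "D dvd gcd (a ^ e) (b ^ e) * P"
  proof -
    have "D dvd gcd (a ^ e * P) (b ^ e * P)" using D by simp
    then show ?thesis by (simp add: gcd_mult_right gcd.commute[of b])
  qed
  ultimately show ?thesis by (meson dvd_refl dvd_trans mult_dvd_mono)
qed

lemma cpoly_dvd_power_mult:
  fixes a b D P w g :: "3 cpoly"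
  assumes D: "D dvd a ^ e * P" "D dvd b ^ e * P"
    and cop: "\<And>c. c dvd a \<Longrightarrow> c dvd b \<Longrightarrow> c dvd g \<Longrightarrow> c dvd 1"
    and w: "\<And>c. c dvd a \<Longrightarrow> c dvd b \<Longrightarrow> c dvd w * g"
  shows "D dvd w ^ e * P"
proof -
  have "to_poly3 D dvd to_poly3 w ^ e * to_poly3 P"
  proof (rule dvd_power_mult_gcd[of _ "to_poly3 a" _ _ "to_poly3 b" "to_poly3 g"])
    show "to_poly3 D dvd to_poly3 a ^ e * to_poly3 P" "to_poly3 D dvd to_poly3 b ^ e * to_poly3 P"
      using D[THEN to_poly3.hom_dvd] by (simp_all add: to_poly3.hom_simps)
  next
    fix c assume c: "c dvd to_poly3 a" "c dvd to_poly3 b" "c dvd to_poly3 g"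
    obtain c' where c': "c = to_poly3 c'" using to_poly3.iso_surj by blast
    show "c dvd 1" using c cop unfolding c' by (simp add: to_poly3.iso_dvd_iff to_poly3.iso_unit_iff)
  next
    fix c assume c: "c dvd to_poly3 a" "c dvd to_poly3 b"
    obtain c' where c': "c = to_poly3 c'" using to_poly3.iso_surj by blast
    show "c dvd to_poly3 w * to_poly3 g"
      using c w unfolding c' by (simp add: to_poly3.iso_dvd_iff flip: to_poly3.hom_mult)
  qed
  then show ?thesis by (simp add: to_poly3.iso_dvd_iff flip: to_poly3.hom_mult to_poly3.hom_power)
qed

lemma cpoly_eval_to_poly3:
  "cpoly_eval v F = poly (poly (poly (to_poly3 F) [:[:v 2:]:]) [:v 1:]) (v 0)"
proof (rule comm_ring_hom_unique[OF comm_ring_hom_cpoly_eval])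
  show "comm_ring_hom (\<lambda>F. poly (poly (poly (to_poly3 F) [:[:v 2:]:]) [:v 1:]) (v 0))"
    by unfold_locales (simp_all add: to_poly3.hom_simps)
  show "cpoly_eval v (Const c) = poly (poly (poly (to_poly3 (Const c)) [:[:v 2:]:]) [:v 1:]) (v 0)" for c
    by (simp add: to_poly3_def comm_ring_hom_const_poly3)
  show "cpoly_eval v (Var i) = poly (poly (poly (to_poly3 (Var i)) [:[:v 2:]:]) [:v 1:]) (v 0)" for i
    using cases_3[of i] by (auto simp: to_poly3_def comm_ring_hom_const_poly3)
qed

lemma poly_zero_on_range:
  fixes p :: "'a::idom poly"
  assumes "\<And>c. poly p (g c) = 0" "inj (g :: complex \<Rightarrow> 'a)"
  shows "p = 0"
proof (rule ccontr)
  assume "p \<noteq> 0"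
  then have "finite {x. poly p x = 0}" by (rule poly_roots_finite)
  moreover have "range g \<subseteq> {x. poly p x = 0}" using assms(1) by auto
  ultimately have "finite (range g)" by (rule rev_finite_subset)
  then have "finite (UNIV :: complex set)" using assms(2) by (simp add: finite_image_iff)
  then show False by (simp add: infinite_UNIV_char_0)
qed

text \<open>The variables are peeled off one at a time: a univariate polynomial over an integral
  domain with all complex constants as roots is zero.\<close>

lemma cpoly_eval_zero_imp_zero:
  fixes F :: "3 cpoly"
  assumes "\<And>v. cpoly_eval v F = 0"
  shows "F = 0"
proof -
  have e: "poly (poly (poly (to_poly3 F) [:[:c:]:]) [:b:]) a = 0" for a b c
    using assms[of "\<lambda>i. if i = 0 then a else if i = 1 then b else c"] by (simp add: cpoly_eval_to_poly3)
  have "poly (poly (to_poly3 F) [:[:c:]:]) [:b:] = 0" for b c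
    by (rule poly_zero_on_range[where g = "\<lambda>x. x"]) (use e in auto)
  then have "poly (to_poly3 F) [:[:c:]:] = 0" for c
    by (intro poly_zero_on_range[where g = "\<lambda>x. [:x:]"]) (auto simp: inj_def)
  then have "to_poly3 F = 0"
    by (intro poly_zero_on_range[where g = "\<lambda>x. [:[:x:]:]"]) (auto simp: inj_def)
  then show ?thesis by (simp add: to_poly3.iso_zero_iff)
qed

lemma cpoly_eqI: "(\<And>v. cpoly_eval v F = cpoly_eval v G) \<Longrightarrow> F = (G :: 3 cpoly)"
  using cpoly_eval_zero_imp_zero[of "F - G"] by (simp add: ev.hom_diff)

section \<open>Factors of forms are forms\<close>

text \<open>This is F(s x_0, s x_1, s x_2) as a polynomial in a new variable s. Its k-th coefficient
  is the homogeneous component of degree k, so F is a form exactly when it is a monomial in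
  s.\<close>

definition grading_poly :: "3 cpoly \<Rightarrow> 3 cpoly poly" where
  "grading_poly = pm_eval (\<lambda>c. [:Const c:]) (\<lambda>i. [:0, Var i:])"

lemma comm_ring_hom_const_Const: "comm_ring_hom (\<lambda>c. [:Const c:] :: 'v cpoly poly)"
  by unfold_locales (simp_all add: one_pCons Const.hom_simps)

interpretation grading_poly: comm_ring_hom grading_poly
  unfolding grading_poly_def by (rule comm_ring_hom_pm_eval[OF comm_ring_hom_const_Const])

lemma grading_poly_Const [simp]: "grading_poly (Const c) = [:Const c:]"
  and grading_poly_Var [simp]: "grading_poly (Var i) = [:0, Var i:]"
  by (simp_all add: grading_poly_def comm_ring_hom_const_Const)

lemma coeff_grading_poly: "Polynomial.coeff (grading_poly F) k \<in> forms k"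
proof (induction F arbitrary: k rule: cpoly_induct)
  case (Const c)
  then show ?case by (cases k) (simp_all)
next
  case (Var i)
  show ?case
  proof (cases k)
    case (Suc l) then show ?thesis by (cases l) (use forms_Var[of i] in simp_all)
  qed simp
next
  case (add F G)
  then show ?case by (simp add: grading_poly.hom_add forms_add)
next
  case (mult F G)
  have "Polynomial.coeff (grading_poly F) i * Polynomial.coeff (grading_poly G) (k - i) \<in> forms k" if "i \<le> k" for i
    using forms_mult[OF mult(1)[of i] mult(2)[of "k - i"]] that by simp
  then show ?case
    unfolding grading_poly.hom_mult coeff_mult by (intro forms_sum) auto
qed

lemma poly_grading_poly: "poly (grading_poly F) 1 = F"
proof (rule comm_ring_hom_unique[OF _ comm_ring_hom_id])
  show "comm_ring_hom (\<lambda>F. poly (grading_poly F) 1)"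
    by unfold_locales (simp_all add: grading_poly.hom_simps)
qed simp_all

lemma grading_poly_form: "F \<in> forms n \<Longrightarrow> grading_poly F = Polynomial.monom F n"
proof -
  assume F: "F \<in> forms n"
  have "grading_poly F = pm_eval (\<lambda>c. [:Const c:]) (\<lambda>i. [:0, 1:] * [:Var i:]) F"
    by (simp add: grading_poly_def)
  also have "\<dots> = [:0, 1:] ^ n * pm_eval (\<lambda>c. [:Const c:]) (\<lambda>i. [:Var i:]) F"
    by (rule pm_eval_scale[OF F])
  also have "pm_eval (\<lambda>c. [:Const c:]) (\<lambda>i. [:Var i:]) F = [:F:]"
    by (rule comm_ring_hom_unique[OF comm_ring_hom_pm_eval[OF comm_ring_hom_const_Const] comm_ring_hom_const_poly])
      (simp_all add: comm_ring_hom_const_Const)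
  finally show ?thesis by (simp add: X_power_monom smult_monom)
qed

lemma forms_if_grading_poly_monom: "grading_poly F = Polynomial.monom G n \<Longrightarrow> F \<in> forms n"
  using poly_grading_poly[of F] coeff_grading_poly[of F n] by (simp add: poly_monom)

text \<open>Degree and order at 0 are both additive and agree for a monomial. As the order never
  exceeds the degree, they agree for each factor.\<close>

lemma monom_factor:
  fixes p q :: "'a::idom poly"
  assumes pq: "p * q = Polynomial.monom c n" and "c \<noteq> 0"
  shows "\<exists>a k. p = Polynomial.monom a k"
proof -
  have nz: "p \<noteq> 0" "q \<noteq> 0" "p * q \<noteq> 0" using assms by auto
  have deg: "Polynomial.degree p + Polynomial.degree q = n"
    using nz assms by (metis degree_monom_eq degree_mult_eq)
  have "p * q = [:- 0, 1:] ^ n * [:c:]"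
    by (simp add: pq X_power_monom smult_monom)
  then have "[:- 0, 1:] ^ n dvd p * q" by (metis dvd_triv_left)
  then have "n \<le> Polynomial.order 0 p + Polynomial.order 0 q"
    using order_divides[of 0 n "p * q"] nz order_mult[of p q 0] by simp
  then have ord: "Polynomial.order 0 p = Polynomial.degree p"
    using order_degree[OF nz(1), of 0] order_degree[OF nz(2), of 0] deg by linarith
  obtain r where r: "p = [:- 0, 1:] ^ Polynomial.order 0 p * r"
    using order_decomp[OF nz(1), of 0] by blast
  have "r \<noteq> 0" using r nz by auto
  then have "Polynomial.degree p = Polynomial.order 0 p + Polynomial.degree r"
    by (subst r) (simp add: degree_mult_eq X_power_monom degree_monom_eq)
  then obtain a where a: "r = [:a:]" using ord by (metis add_left_cancel add_0_right degree_eq_zeroE)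
  have "p = Polynomial.monom a (Polynomial.order 0 p)"
    by (subst r, subst a) (simp add: X_power_monom smult_monom)
  then show ?thesis by blast
qed

lemma forms_degree_unique: "F \<in> forms a \<Longrightarrow> F \<in> forms b \<Longrightarrow> F \<noteq> 0 \<Longrightarrow> a = b"
  unfolding forms_def by (metis (mono_tags, lifting) all_not_in_conv keys_eq_empty mem_Collect_eq)

text \<open>Grading turns the product into a monomial in the grading variable, and over an integral
  domain the factors of a monomial are monomials.\<close>

lemma forms_factor:
  fixes A B :: "3 cpoly"
  assumes "A * B \<in> forms n" "A * B \<noteq> 0"
  obtains a b where "A \<in> forms a" "B \<in> forms b" "a + b = n"
proof -
  have m: "grading_poly A * grading_poly B = Polynomial.monom (A * B) n"
    using grading_poly_form[OF assms(1)] by (simp add: grading_poly.hom_mult)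
  obtain a where A: "A \<in> forms a"
    using monom_factor[OF m assms(2)] forms_if_grading_poly_monom by blast
  obtain b where B: "B \<in> forms b"
    using monom_factor[of "grading_poly B" "grading_poly A", OF _ assms(2)] m forms_if_grading_poly_monom
    by (metis mult.commute)
  have "a + b = n" using forms_degree_unique[OF forms_mult[OF A B] assms(1) assms(2)] .
  with A B show ?thesis by (rule that)
qed

lemma forms_cofactor:
  fixes A B :: "3 cpoly"
  assumes "A * B \<in> forms n" "A \<in> forms a" "A \<noteq> 0" "a \<le> n"
  shows "B \<in> forms (n - a)"
proof (cases "B = 0")
  case False
  then have "A * B \<noteq> 0" using assms by simp
  from forms_factor[OF assms(1) this] obtain a' b where "A \<in> forms a'" "B \<in> forms b" "a' + b = n" .
  then show ?thesis using forms_degree_unique[OF assms(2) _ assms(3), of a'] by auto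
qed simp

lemma forms_0_Const: "F \<in> forms 0 \<Longrightarrow> \<exists>c. F = Const c"
proof -
  assume F: "F \<in> forms 0"
  have "F = Const (Poly_Mapping.lookup F 0)"
  proof (rule poly_mapping_eqI)
    fix m
    have "m = 0" if "m \<in> Poly_Mapping.keys F"
      using F that by (intro poly_mapping_eqI) (auto simp: forms_def)
    then show "Poly_Mapping.lookup F m = Poly_Mapping.lookup (Const (Poly_Mapping.lookup F 0)) m"
      by (auto simp: Const_def lookup_single when_def in_keys_iff)
  qed
  then show ?thesis by blast
qed

lemma unit_form: "F dvd 1 \<Longrightarrow> (F :: 3 cpoly) \<in> forms 0"
proof -
  assume "F dvd 1"
  then obtain G where G: "1 = F * G" by (auto simp: dvd_def)
  then have "F * G \<in> forms 0" "F * G \<noteq> 0" by (simp_all flip: G)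
  from forms_factor[OF this] show ?thesis by fastforce
qed

lemma unit_forms_0: "F \<in> forms 0 \<Longrightarrow> F \<noteq> 0 \<Longrightarrow> (F :: 3 cpoly) dvd 1"
proof -
  assume "F \<in> forms 0" "F \<noteq> 0"
  then obtain c where c: "F = Const c" "c \<noteq> 0" using forms_0_Const by fastforce
  then have "F * Const (1 / c) = 1" by (simp flip: Const.hom_mult)
  then show ?thesis by (metis dvd_triv_left)
qed

no_notation fps_nth (infixl \<open>$\<close> 75)

lemma forms_Var_Suc [simp]: "Var i \<in> forms (Suc 0)"
  using forms_Var[of i] by simp

section \<open>Dimensions of spaces of forms\<close>

locale fd_vector_space = vector_space scale
  for scale :: "'k::field \<Rightarrow> 'b::ab_group_add \<Rightarrow> 'b"
begin

text \<open>The polynomial ring has infinite dimension over the complex numbers; a finite spanning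
  set is what makes \<open>dim\<close> monotone and additive on the subspaces considered.\<close>

definition fd_subspace :: "'b set \<Rightarrow> bool" where
  "fd_subspace V \<longleftrightarrow> subspace V \<and> (\<exists>B. finite B \<and> V \<subseteq> span B)"

lemma fd_subspace_basis:
  assumes "fd_subspace V"
  obtains B where "finite B" "independent B" "span B = V" "card B = dim V"
proof -
  obtain B where B: "B \<subseteq> V" "independent B" "V \<subseteq> span B" "card B = dim V"
    by (rule basis_exists)
  obtain C where "finite C" "V \<subseteq> span C" using assms by (auto simp: fd_subspace_def)
  then have "finite B" using independent_span_bound[of C B] B by auto
  moreover have "span B = V" using assms B by (intro span_subspace) (auto simp: fd_subspace_def)
  ultimately show ?thesis using B that by blast
qed

lemma fd_subspace_span: "finite B \<Longrightarrow> fd_subspace (span B)"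
  by (auto simp: fd_subspace_def)

lemma dim_mono_fd:
  assumes "A \<subseteq> V" "fd_subspace V"
  shows "dim A \<le> dim V"
proof -
  obtain B where B: "finite B" "span B = V" "card B = dim V" using fd_subspace_basis[OF assms(2)] .
  then show ?thesis using dim_le_card[of A B] assms(1) by simp
qed

lemma fd_subspace_sums:
  assumes "fd_subspace A" "fd_subspace B"
  shows "fd_subspace {x + y | x y. x \<in> A \<and> y \<in> B}"
proof -
  obtain C where C: "finite C" "span C = A" using fd_subspace_basis[OF assms(1)] .
  obtain D where D: "finite D" "span D = B" using fd_subspace_basis[OF assms(2)] .
  show ?thesis using fd_subspace_span[of "C \<union> D"] C D by (simp add: span_Un)
qed

lemma dim_direct_sum:
  assumes A: "fd_subspace A" and B: "fd_subspace B" and AB: "A \<inter> B \<subseteq> {0}"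
  shows "dim {x + y | x y. x \<in> A \<and> y \<in> B} = dim A + dim B"
proof -
  obtain C where C: "finite C" "independent C" "span C = A" "card C = dim A" using fd_subspace_basis[OF A] .
  obtain D where D: "finite D" "independent D" "span D = B" "card D = dim B" using fd_subspace_basis[OF B] .
  have CD: "C \<inter> D = {}"
  proof (rule ccontr)
    assume "C \<inter> D \<noteq> {}"
    then obtain x where "x \<in> C" "x \<in> D" by blast
    then have "x \<in> A \<inter> B" using C(3) D(3) span_superset by blast
    then have "x = 0" using AB by blast
    then show False using \<open>x \<in> C\<close> C(2) dependent_zero by blast
  qed
  have "independent (C \<union> D)"
  proof (rule independent_if_scalars_zero)
    show "finite (C \<union> D)" using C D by simp
    fix f x assume 0: "(\<Sum>x\<in>C \<union> D. scale (f x) x) = 0" and x: "x \<in> C \<union> D"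
    have s: "(\<Sum>x\<in>C. scale (f x) x) + (\<Sum>x\<in>D. scale (f x) x) = 0"
      using 0 CD C(1) D(1) by (simp add: sum.union_disjoint)
    have a: "(\<Sum>x\<in>C. scale (f x) x) \<in> A"
      unfolding C(3)[symmetric] by (intro span_sum span_scale span_base)
    have b: "(\<Sum>x\<in>D. scale (f x) x) \<in> B"
      unfolding D(3)[symmetric] by (intro span_sum span_scale span_base)
    have "(\<Sum>x\<in>C. scale (f x) x) = - (\<Sum>x\<in>D. scale (f x) x)"
      using s by (simp add: eq_neg_iff_add_eq_0)
    then have "(\<Sum>x\<in>C. scale (f x) x) \<in> B"
      using b B by (simp add: fd_subspace_def subspace_neg)
    then have z: "(\<Sum>x\<in>C. scale (f x) x) = 0" using a AB by blast
    with s have z': "(\<Sum>x\<in>D. scale (f x) x) = 0" by simp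
    show "f x = 0"
      using x independentD[OF C(2) C(1) order_refl z] independentD[OF D(2) D(1) order_refl z'] by blast
  qed
  then have "dim (span (C \<union> D)) = card (C \<union> D)" by (rule dim_span_eq_card_independent)
  also have "card (C \<union> D) = dim A + dim B" using C D CD by (simp add: card_Un_disjoint)
  finally show ?thesis using C D by (simp add: span_Un)
qed

text \<open>A basis of U is extended to a basis D of V, and the added vectors span the complement.
  An element common to both spans has no nonzero coordinate with respect to D.\<close>

lemma fd_subspace_complement:
  assumes U: "fd_subspace U" and V: "fd_subspace V" and UV: "U \<subseteq> V"
  obtains C where "fd_subspace C" "C \<subseteq> V" "U \<inter> C \<subseteq> {0}" "dim U + dim C = dim V"
proof -
  obtain B where B: "finite B" "independent B" "span B = U" "card B = dim U" using fd_subspace_basis[OF U] .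
  have "B \<subseteq> V" using B(3) UV span_superset by blast
  obtain D where D: "B \<subseteq> D" "D \<subseteq> V" "independent D" "V \<subseteq> span D"
    by (rule maximal_independent_subset_extend[OF \<open>B \<subseteq> V\<close> B(2)])
  obtain E where "finite E" "V \<subseteq> span E" using V by (auto simp: fd_subspace_def)
  then have fD: "finite D" using independent_span_bound[of E D] D by auto
  have iD: "independent (D - B)" using D(3) by (rule independent_mono) auto
  have VD: "dim V = card D" using basis_card_eq_dim[OF D(2) D(4) D(3)] by simp
  show ?thesis
  proof (rule that)
    show "fd_subspace (span (D - B))" using fD by (intro fd_subspace_span) auto
    show "span (D - B) \<subseteq> V" using D V by (intro span_minimal) (auto simp: fd_subspace_def)
    show "dim U + dim (span (D - B)) = dim V"
      using VD B(1,4) D(1) fD card_mono[OF fD D(1)] by (simp add: dim_eq_card_independent[OF iD] card_Diff_subset)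
    show "U \<inter> span (D - B) \<subseteq> {0}"
    proof
      fix x assume "x \<in> U \<inter> span (D - B)"
      then have x: "x \<in> span B" "x \<in> span (D - B)" "x \<in> span D"
        using B(3) span_mono[of "D - B" D] by auto
      have "representation D x b = 0" for b
      proof (rule ccontr)
        assume "representation D x b \<noteq> 0"
        then have "representation B x b \<noteq> 0" "representation (D - B) x b \<noteq> 0"
          using representation_extend[OF D(3) x(1) D(1)] representation_extend[OF D(3) x(2)] by auto
        then have "b \<in> B" "b \<in> D - B" by (auto dest: representation_ne_zero)
        then show False by blast
      qed
      then show "x \<in> {0}" using sum_nonzero_representation_eq[OF D(3) x(3)] by simp
    qed
  qed
qed

end

interpretation cs: fd_vector_space "cscale :: complex \<Rightarrow> 3 cpoly \<Rightarrow> 3 cpoly"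
  by (rule fd_vector_space.intro[OF vector_space_cscale])

lemma cdim_eq: "cdim = cs.dim"
  by (simp add: cdim_def)

lemma subspace_forms: "cs.subspace (forms n)"
  by (auto simp: cs.subspace_def cscale_def forms_add forms_Const_mult)

lemma fd_mult_image:
  assumes "cs.fd_subspace A" "h \<noteq> 0"
  shows "cs.fd_subspace ((*) h ` A)" and "cs.dim ((*) h ` A) = cs.dim A"
proof -
  interpret L: module_hom cscale cscale "(*) h"
    by (intro module_hom.intro module_hom_axioms.intro cs.module_axioms)
      (simp_all add: cscale_def algebra_simps)
  obtain B where B: "finite B" "cs.independent B" "cs.span B = A" "card B = cs.dim A"
    using cs.fd_subspace_basis[OF assms(1)] .
  have s: "(*) h ` A = cs.span ((*) h ` B)" using L.span_image[of B] B by simp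
  show "cs.fd_subspace ((*) h ` A)" unfolding s using B by (intro cs.fd_subspace_span) auto
  have inj: "inj_on ((*) h) S" for S using assms(2) by (auto simp: inj_on_def)
  have "cs.independent ((*) h ` B)" using L.independent_injective_image[OF B(2) inj] .
  then show "cs.dim ((*) h ` A) = cs.dim A"
    unfolding s using B by (simp add: cs.dim_eq_card_independent card_image[OF inj])
qed

section \<open>Linear forms and elimination of a variable on a line\<close>

definition lin :: "complex ^ 3 \<Rightarrow> 3 cpoly" where
  "lin q = (\<Sum>i\<in>UNIV. Const (q $ i) * Var i)"

lemma lin_form: "lin q \<in> forms 1"
  unfolding lin_def by (intro forms_sum forms_Const_mult forms_Var)

lemma lin_form_Suc [simp]: "lin q \<in> forms (Suc 0)"
  using lin_form[of q] by simp

definition dotp :: "complex ^ 3 \<Rightarrow> complex ^ 3 \<Rightarrow> complex" where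
  "dotp q v = (\<Sum>i\<in>UNIV. q $ i * v $ i)"

lemma eval_lin: "cpoly_eval v (lin q) = (\<Sum>i\<in>UNIV. q $ i * v i)"
  by (simp add: lin_def ev.hom_simps)

lemma eval_lin_vec [simp]: "cpoly_eval (($) v) (lin q) = dotp q v"
  by (simp add: eval_lin dotp_def)

lemma dotp_commute: "dotp v w = dotp w v"
  by (simp add: dotp_def mult.commute)

lemma dotp_scale [simp]: "dotp (c *s v) w = c * dotp v w" "dotp v (c *s w) = c * dotp v w"
  by (simp_all add: dotp_def sum_distrib_left mult_ac)

lemma dotp_add: "dotp v (w + u) = dotp v w + dotp v u" "dotp (w + u) v = dotp w v + dotp u v"
  by (simp_all add: dotp_def sum.distrib algebra_simps)

lemma dotp_axis [simp]: "dotp q (axis i c) = q $ i * c"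
  by (simp add: dotp_def axis_def if_distrib cong: if_cong)

lemma vec_nonzero_component: "v \<noteq> 0 \<Longrightarrow> \<exists>i. v $ i \<noteq> (0::complex)"
  by (auto simp: vec_eq_iff)

lemma lin_nonzero: "q \<noteq> 0 \<Longrightarrow> lin q \<noteq> 0"
proof
  assume "q \<noteq> 0" "lin q = 0"
  then obtain i where "q $ i \<noteq> 0" using vec_nonzero_component by blast
  then show False using eval_lin_vec[of "axis i 1" q] \<open>lin q = 0\<close> by simp
qed

lemma linear_form_eq_lin:
  assumes "F \<in> forms 1"
  obtains q where "F = lin q"
proof
  let ?q = "\<chi> i. cpoly_eval (($) (axis i 1)) F"
  have "cpoly_subst Var F = (\<Sum>m\<in>Poly_Mapping.keys F. Const (Poly_Mapping.lookup F m) * lin (\<chi> i. of_nat (Poly_Mapping.lookup m i)))"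
    unfolding cpoly_subst_def
  proof (rule sum.cong[OF refl])
    fix m assume m: "m \<in> Poly_Mapping.keys F"
    then have s: "Poly_Mapping.lookup m 0 + Poly_Mapping.lookup m 1 + Poly_Mapping.lookup m 2 = 1"
      using assms by (simp add: forms_def sum_3)
    then consider "Poly_Mapping.lookup m 0 = 1 \<and> Poly_Mapping.lookup m 1 = 0 \<and> Poly_Mapping.lookup m 2 = 0"
      | "Poly_Mapping.lookup m 0 = 0 \<and> Poly_Mapping.lookup m 1 = 1 \<and> Poly_Mapping.lookup m 2 = 0"
      | "Poly_Mapping.lookup m 0 = 0 \<and> Poly_Mapping.lookup m 1 = 0 \<and> Poly_Mapping.lookup m 2 = 1"
      by linarith
    then show "Const (Poly_Mapping.lookup F m) * (\<Prod>i\<in>UNIV. Var i ^ Poly_Mapping.lookup m i) =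
       Const (Poly_Mapping.lookup F m) * lin (\<chi> i. of_nat (Poly_Mapping.lookup m i))"
      by cases (simp_all add: lin_def sum_3 prod_3)
  qed
  also have "\<dots> = lin (\<chi> i. \<Sum>m\<in>Poly_Mapping.keys F. Poly_Mapping.lookup F m * of_nat (Poly_Mapping.lookup m i))"
    by (rule cpoly_eqI) (simp add: ev.hom_simps eval_lin sum_distrib_left sum_distrib_right sum.swap[of _ UNIV] mult_ac)
  finally show "F = lin (\<chi> i. \<Sum>m\<in>Poly_Mapping.keys F. Poly_Mapping.lookup F m * of_nat (Poly_Mapping.lookup m i))"
    by (simp add: cpoly_subst_Var_id)
qed

definition elim_var :: "complex ^ 3 \<Rightarrow> 3 \<Rightarrow> 3 \<Rightarrow> 3 cpoly" where
  "elim_var q k j = (if j = k then - (Const (1 / q $ k) * (Const (q $ (k + 1)) * Var (k + 1) + Const (q $ (k + 2)) * Var (k + 2))) else Var j)"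

text \<open>For \<open>q $ k\<close> nonzero this is restriction to the line q . x = 0, with the
  coordinates other than x_k as coordinates on it: a retraction onto the polynomials free of x_k
  whose kernel is the ideal of \<open>lin q\<close>.\<close>

definition reduce :: "complex ^ 3 \<Rightarrow> 3 \<Rightarrow> 3 cpoly \<Rightarrow> 3 cpoly" where
  "reduce q k = cpoly_subst (elim_var q k)"

interpretation reduce: comm_ring_hom "reduce q k" for q k
  unfolding reduce_def by (rule comm_ring_hom_cpoly_subst)

lemma reduce_Const [simp]: "reduce q k (Const c) = Const c"
  by (simp add: reduce_def)

lemma reduce_Var: "reduce q k (Var j) = elim_var q k j"
  by (simp add: reduce_def)

lemma lin_shift: "lin q = Const (q $ k) * Var k + Const (q $ (k + 1)) * Var (k + 1) + Const (q $ (k + 2)) * Var (k + 2)"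
  unfolding lin_def by (rule sum_3_shift)

lemma elim_var_simps [simp]: "elim_var q k (k + 1) = Var (k + 1)" "elim_var q k (k + 2) = Var (k + 2)"
  using shift_3_neq[of k] by (simp_all add: elim_var_def)

lemma Const_inverse_mult: "c \<noteq> 0 \<Longrightarrow> Const c * (Const (1 / c) * F) = F"
  by (simp add: mult.assoc[symmetric] flip: Const.hom_mult)

lemma reduce_lin:
  assumes "q $ k \<noteq> 0"
  shows "reduce q k (lin q) = 0"
proof -
  have "reduce q k (lin q) = Const (q $ k) * elim_var q k k + Const (q $ (k + 1)) * Var (k + 1) + Const (q $ (k + 2)) * Var (k + 2)"
    by (simp only: lin_shift[of q k] reduce.hom_simps reduce_Const reduce_Var elim_var_simps)
  also have "Const (q $ k) * elim_var q k k = - (Const (q $ (k + 1)) * Var (k + 1) + Const (q $ (k + 2)) * Var (k + 2))"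
    using assms by (simp only: elim_var_def simp_thms if_True mult_minus_right Const_inverse_mult not_False_eq_True)
  finally show ?thesis by (simp add: algebra_simps)
qed

lemma lin_dvd_diff_reduce:
  assumes "q $ k \<noteq> 0"
  shows "lin q dvd F - reduce q k F"
proof -
  have e: "Const (1 / q $ k) * lin q = Var k - elim_var q k k"
    using assms by (subst lin_shift[of q k]) (simp add: elim_var_def distrib_left mult.assoc[symmetric] flip: Const.hom_mult)
  have "lin q dvd Var j - elim_var q k j" for j
  proof (cases "j = k")
    case True
    then show ?thesis unfolding True e[symmetric] by simp
  qed (simp add: elim_var_def)
  then have "lin q dvd cpoly_subst Var F - cpoly_subst (elim_var q k) F"
    by (intro cpoly_subst_cong_dvd)
  then show ?thesis by (simp add: cpoly_subst_Var_id reduce_def)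
qed

lemma reduce_eq_0_iff: "q $ k \<noteq> 0 \<Longrightarrow> reduce q k F = 0 \<longleftrightarrow> lin q dvd F"
  using lin_dvd_diff_reduce[of q k F] by (auto simp: reduce.hom_mult reduce_lin dvd_def)

lemma elim_var_form: "elim_var q k j \<in> forms 1"
  unfolding elim_var_def by (auto intro!: forms_uminus forms_Const_mult forms_add forms_Var)

lemma reduce_form: "F \<in> forms m \<Longrightarrow> reduce q k F \<in> forms m"
  unfolding reduce_def using cpoly_subst_forms[of F m "elim_var q k" 1] elim_var_form by simp

abbreviation free_of :: "3 \<Rightarrow> 3 cpoly set" where
  "free_of k \<equiv> homog (\<lambda>m. Poly_Mapping.lookup m k) 0"

lemma free_of_Const [simp]: "Const c \<in> free_of k"
  by (auto simp: homog_def Const_def)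

lemma free_of_Var: "j \<noteq> k \<Longrightarrow> Var j \<in> free_of k"
  by (auto simp: homog_def Var_def lookup_single when_def)

lemma free_of_mult: "F \<in> free_of k \<Longrightarrow> G \<in> free_of k \<Longrightarrow> F * G \<in> free_of k"
  using homog_mult[of "\<lambda>m. Poly_Mapping.lookup m k" F 0 G 0] by (simp add: lookup_add)

lemma elim_var_free: "elim_var q k j \<in> free_of k"
  using shift_3_neq[of k] unfolding elim_var_def
  by (auto intro!: homog_uminus free_of_mult homog_add free_of_Var)

lemma reduce_free: "reduce q k F \<in> free_of k"
  by (induction F rule: cpoly_induct)
    (auto simp: reduce.hom_add reduce.hom_mult reduce_Var elim_var_free intro: homog_add free_of_mult)

lemma reduce_id: "F \<in> free_of k \<Longrightarrow> reduce q k F = F"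
proof -
  assume F: "F \<in> free_of k"
  have "cpoly_subst (elim_var q k) F = cpoly_subst Var F"
    unfolding cpoly_subst_def
  proof (intro sum.cong refl arg_cong2[where f = times] prod.cong)
    fix m i assume "m \<in> Poly_Mapping.keys F"
    then have "Poly_Mapping.lookup m k = 0" using F by (auto simp: homog_def)
    then show "elim_var q k i ^ Poly_Mapping.lookup m i = Var i ^ Poly_Mapping.lookup m i"
      by (cases "i = k") (auto simp: elim_var_def)
  qed
  then show ?thesis by (simp add: reduce_def cpoly_subst_Var_id)
qed

text \<open>A constant equals its own reduction. The last conjunct records this for m = 0, where
  natural subtraction would allow any constant as cofactor.\<close>

lemma forms_decomp_lin:
  assumes "q $ k \<noteq> 0" "F \<in> forms m"
  shows "\<exists>A. F - reduce q k F = lin q * A \<and> A \<in> forms (m - 1) \<and> (m = 0 \<longrightarrow> A = 0)"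
proof (cases "m = 0")
  case True
  then obtain c where "F = Const c" using assms forms_0_Const by blast
  then show ?thesis by (intro exI[of _ 0]) simp
next
  case False
  obtain A where A: "F - reduce q k F = lin q * A" using lin_dvd_diff_reduce[OF assms(1), of F] by (auto simp: dvd_def)
  have "lin q * A \<in> forms m" unfolding A[symmetric] by (intro forms_diff assms reduce_form)
  moreover have "q \<noteq> 0" using assms(1) by auto
  ultimately have "A \<in> forms (m - 1)" using forms_cofactor[OF _ lin_form] lin_nonzero False by simp
  then show ?thesis using A False by blast
qed

section \<open>Forms in two variables and the dimension of the space of forms\<close>

definition binary_forms :: "3 \<Rightarrow> nat \<Rightarrow> 3 cpoly set" where
  "binary_forms k m = forms m \<inter> free_of k"

lemma subspace_free_of: "cs.subspace (free_of k)"
  by (auto simp: cs.subspace_def cscale_def homog_add free_of_mult)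

lemma binary_forms_basis:
  fixes k :: 3 and m :: nat
  defines "e r \<equiv> Poly_Mapping.single (k + 1) r + Poly_Mapping.single (k + 2) (m - r)"
  shows "binary_forms k m = cs.span ((\<lambda>r. Poly_Mapping.single (e r) (1::complex)) ` {..m})"
    and "cs.independent ((\<lambda>r. Poly_Mapping.single (e r) (1::complex)) ` {..m})"
    and "inj_on (\<lambda>r. Poly_Mapping.single (e r) (1::complex)) {..m}"
proof -
  note neq = shift_3_neq[of k]
  have lk: "Poly_Mapping.lookup (e r) k = 0" "Poly_Mapping.lookup (e r) (k + 1) = r" "Poly_Mapping.lookup (e r) (k + 2) = m - r" for r
    using neq neq[symmetric] by (simp_all add: e_def lookup_add lookup_single when_def)
  have inj: "e r = e s \<longleftrightarrow> r = s" for r s using lk(2) by metis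
  show inj': "inj_on (\<lambda>r. Poly_Mapping.single (e r) (1::complex)) {..m}"
  proof (rule inj_onI)
    fix r s assume "Poly_Mapping.single (e r) (1::complex) = Poly_Mapping.single (e s) 1"
    then have "Poly_Mapping.keys (Poly_Mapping.single (e r) (1::complex)) = Poly_Mapping.keys (Poly_Mapping.single (e s) (1::complex))" by simp
    then show "r = s" by (simp add: inj)
  qed
  have deg: "wdeg (e r) = m" if "r \<le> m" for r
    using that by (simp add: wdeg_def sum_3_shift[of _ k] lk)
  show "cs.independent ((\<lambda>r. Poly_Mapping.single (e r) (1::complex)) ` {..m})"
  proof (rule cs.independent_if_scalars_zero)
    fix f x assume 0: "(\<Sum>x\<in>(\<lambda>r. Poly_Mapping.single (e r) (1::complex)) ` {..m}. cscale (f x) x) = 0"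
      and "x \<in> (\<lambda>r. Poly_Mapping.single (e r) (1::complex)) ` {..m}"
    then obtain r where r: "r \<le> m" "x = Poly_Mapping.single (e r) 1" by auto
    have "0 = (\<Sum>s\<le>m. cscale (f (Poly_Mapping.single (e s) 1)) (Poly_Mapping.single (e s) 1))"
      using 0 by (simp add: sum.reindex[OF inj'])
    also have "\<dots> = (\<Sum>s\<le>m. Poly_Mapping.single (e s) (f (Poly_Mapping.single (e s) 1)))"
      by (simp add: cscale_def Const_def mult_single)
    finally have "0 = Poly_Mapping.lookup (\<Sum>s\<le>m. Poly_Mapping.single (e s) (f (Poly_Mapping.single (e s) 1))) (e r)"
      by (metis lookup_zero)
    also have "\<dots> = (\<Sum>s\<le>m. if s = r then f (Poly_Mapping.single (e s) 1) else 0)"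
      by (simp add: lookup_sum lookup_single when_def inj)
    also have "\<dots> = f x" using r by simp
    finally show "f x = 0" by simp
  qed simp
  show "binary_forms k m = cs.span ((\<lambda>r. Poly_Mapping.single (e r) (1::complex)) ` {..m})"
  proof (rule equalityI[rotated])
    have "Poly_Mapping.single (e r) 1 \<in> binary_forms k m" if "r \<le> m" for r
      using that deg lk by (auto simp: binary_forms_def forms_eq_homog homog_def)
    moreover have "cs.subspace (binary_forms k m)"
      unfolding binary_forms_def using subspace_forms subspace_free_of by (rule cs.subspace_inter)
    ultimately show "cs.span ((\<lambda>r. Poly_Mapping.single (e r) (1::complex)) ` {..m}) \<subseteq> binary_forms k m"
      by (intro cs.span_minimal) auto
    show "binary_forms k m \<subseteq> cs.span ((\<lambda>r. Poly_Mapping.single (e r) (1::complex)) ` {..m})"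
    proof
      fix F assume F: "F \<in> binary_forms k m"
      have "Poly_Mapping.single x (Poly_Mapping.lookup F x) \<in> cs.span ((\<lambda>r. Poly_Mapping.single (e r) (1::complex)) ` {..m})"
        if x: "x \<in> Poly_Mapping.keys F" for x
      proof -
        have x0: "Poly_Mapping.lookup x k = 0" "wdeg x = m"
          using F x by (auto simp: binary_forms_def forms_eq_homog homog_def)
        then have s: "Poly_Mapping.lookup x (k + 1) + Poly_Mapping.lookup x (k + 2) = m"
          by (simp add: wdeg_def sum_3_shift[of _ k])
        have "x = e (Poly_Mapping.lookup x (k + 1))"
        proof (rule poly_mapping_eqI)
          fix i
          have "i \<in> {k, k + 1, k + 2}" using UNIV_3_shift[of k] by blast
          then show "Poly_Mapping.lookup x i = Poly_Mapping.lookup (e (Poly_Mapping.lookup x (k + 1))) i"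
            using s x0 by (elim insertE) (simp_all only: lk, auto)
        qed
        then have eq: "Poly_Mapping.single x (Poly_Mapping.lookup F x) =
          cscale (Poly_Mapping.lookup F x) (Poly_Mapping.single (e (Poly_Mapping.lookup x (k + 1))) 1)"
          by (simp add: cscale_def Const_def mult_single)
        show ?thesis
          unfolding eq by (intro cs.span_scale cs.span_base imageI) (use s in simp)
      qed
      then have "(\<Sum>x\<in>Poly_Mapping.keys F. Poly_Mapping.single x (Poly_Mapping.lookup F x)) \<in> cs.span ((\<lambda>r. Poly_Mapping.single (e r) (1::complex)) ` {..m})"
        by (rule cs.span_sum)
      then show "F \<in> cs.span ((\<lambda>r. Poly_Mapping.single (e r) (1::complex)) ` {..m})"
        by (simp only: poly_mapping_decompose)
    qed
  qed
qed

lemma fd_binary_forms: "cs.fd_subspace (binary_forms k m)"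
  unfolding binary_forms_basis(1) by (rule cs.fd_subspace_span) simp

lemma dim_binary_forms: "cs.dim (binary_forms k m) = m + 1"
  unfolding binary_forms_basis(1)
  by (subst cs.dim_span_eq_card_independent[OF binary_forms_basis(2)])
    (simp add: card_image[OF binary_forms_basis(3)])

lemma reduce_binary: "F \<in> forms m \<Longrightarrow> reduce q k F \<in> binary_forms k m"
  by (simp add: binary_forms_def reduce_form reduce_free)

text \<open>\<open>reduce\<close> kills the multiples of \<open>lin q\<close> and fixes the
  polynomials free of x_k.\<close>

lemma lin_mult_inter_binary:
  "q $ k \<noteq> 0 \<Longrightarrow> (*) (lin q) ` A \<inter> binary_forms k m \<subseteq> {0}"
proof
  fix F assume q: "q $ k \<noteq> 0" and F: "F \<in> (*) (lin q) ` A \<inter> binary_forms k m"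
  then have "reduce q k F = 0" by (auto simp: reduce.hom_mult reduce_lin)
  moreover have "reduce q k F = F" using F by (intro reduce_id) (simp add: binary_forms_def)
  ultimately show "F \<in> {0}" by simp
qed

lemma forms_Suc_decomp:
  assumes "q $ k \<noteq> 0"
  shows "forms (Suc m) = {x + y | x y. x \<in> (*) (lin q) ` forms m \<and> y \<in> binary_forms k (Suc m)}"
proof (intro equalityI subsetI)
  fix F :: "3 cpoly" assume F: "F \<in> forms (Suc m)"
  obtain A where A: "F - reduce q k F = lin q * A" "A \<in> forms m"
    using forms_decomp_lin[OF assms F] by auto
  then have "F = lin q * A + reduce q k F" by (simp add: algebra_simps)
  then show "F \<in> {x + y | x y. x \<in> (*) (lin q) ` forms m \<and> y \<in> binary_forms k (Suc m)}"
    using A(2) reduce_binary[OF F] by blast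
next
  fix F assume "F \<in> {x + y | x y. x \<in> (*) (lin q) ` forms m \<and> y \<in> binary_forms k (Suc m)}"
  then show "F \<in> forms (Suc m)"
    using forms_mult[OF lin_form, of _ m] by (auto simp: binary_forms_def intro!: forms_add)
qed

lemma forms_0_eq_binary: "forms 0 = binary_forms k 0"
  by (auto simp: binary_forms_def dest!: forms_0_Const)

lemma fd_forms: "cs.fd_subspace (forms m)"
proof (induction m)
  case 0
  show ?case by (simp add: forms_0_eq_binary[of 0] fd_binary_forms)
next
  case (Suc m)
  have "(axis 0 1 :: complex ^ 3) $ 0 \<noteq> 0" by (simp add: axis_def)
  from forms_Suc_decomp[OF this, of m] show ?case
    using cs.fd_subspace_sums[OF fd_mult_image(1)[OF Suc lin_nonzero] fd_binary_forms, of "axis 0 1" 0 "Suc m"]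
    by (simp add: axis_eq_0_iff)
qed

text \<open>Splitting the forms of degree m + 1 into multiples of x_0 and forms in x_1, x_2 adds m +
  2 to the dimension. The factor 2 avoids the division in the binomial coefficient.\<close>

lemma dim_forms: "2 * cs.dim (forms m) = (m + 1) * (m + 2)"
proof (induction m)
  case 0
  show ?case by (simp add: forms_0_eq_binary[of 0] dim_binary_forms)
next
  case (Suc m)
  have a: "(axis 0 1 :: complex ^ 3) $ 0 \<noteq> 0" by (simp add: axis_def)
  then have nz: "axis 0 1 \<noteq> (0 :: complex ^ 3)" by auto
  have "cs.dim (forms (Suc m)) = cs.dim (forms m) + (m + 2)"
    unfolding forms_Suc_decomp[OF a, of m]
    using cs.dim_direct_sum[OF fd_mult_image(1)[OF fd_forms[of m] lin_nonzero[OF nz]] fd_binary_forms[of 0 "Suc m"] lin_mult_inter_binary[OF a]]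
    by (simp add: fd_mult_image(2)[OF fd_forms lin_nonzero[OF nz]] dim_binary_forms)
  then show ?case using Suc by simp
qed

section \<open>Points and lines\<close>

abbreviation evv :: "complex ^ 3 \<Rightarrow> 3 cpoly \<Rightarrow> complex" where
  "evv v \<equiv> cpoly_eval (($) v)"

lemma evv_scale: "F \<in> forms n \<Longrightarrow> evv (c *s v) F = c ^ n * evv v F"
proof -
  assume "F \<in> forms n"
  moreover have "($) (c *s v) = (\<lambda>i. c * v $ i)" by (rule ext) simp
  ultimately show ?thesis by (simp add: cpoly_eval_scale)
qed

lemma evv_zero_imp_zero:
  assumes "\<And>v. evv v F = 0"
  shows "F = 0"
proof (rule cpoly_eval_zero_imp_zero)
  fix v :: "3 \<Rightarrow> complex"
  have "($) (\<chi> i. v i) = v" by (rule ext) simp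
  then show "cpoly_eval v F = 0" using assms[of "\<chi> i. v i"] by simp
qed

lemma evv_nonzero: "F \<noteq> 0 \<Longrightarrow> \<exists>v. evv v F \<noteq> 0"
  using evv_zero_imp_zero by blast

text \<open>The product F * G vanishes everywhere and the ring has no zero divisors. In this form,
  identities checked at generic points become identities of polynomials.\<close>

lemma evv_zero_generic:
  assumes "G \<noteq> 0" "\<And>v. evv v G \<noteq> 0 \<Longrightarrow> evv v F = 0"
  shows "F = 0"
proof -
  have "F * G = 0" by (rule evv_zero_imp_zero) (use assms(2) in \<open>auto simp: ev.hom_mult\<close>)
  then show ?thesis using assms(1) by simp
qed

lemma evv_form_zero_vec: "F \<in> forms n \<Longrightarrow> n > 0 \<Longrightarrow> evv 0 F = 0"
  using evv_scale[of F n 0 0] by (simp add: power_0_left)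

lemma proj_pt_self [simp]: "v \<in> proj_pt v"
  unfolding proj_pt_def by (rule CollectI, rule exI[of _ 1]) simp

lemma proj_pt_eq_iff: "proj_pt v = proj_pt w \<longleftrightarrow> (\<exists>c. c \<noteq> 0 \<and> w = c *s v)"
proof
  assume "proj_pt v = proj_pt w"
  then have "w \<in> proj_pt v" by simp
  then show "\<exists>c. c \<noteq> 0 \<and> w = c *s v" by (auto simp: proj_pt_def)
next
  assume "\<exists>c. c \<noteq> 0 \<and> w = c *s v"
  then obtain c where c: "c \<noteq> 0" "w = c *s v" by blast
  have "(\<exists>d. u = d *s w \<and> d \<noteq> 0) \<longleftrightarrow> (\<exists>d. u = d *s v \<and> d \<noteq> 0)" for u
  proof
    assume "\<exists>d. u = d *s w \<and> d \<noteq> 0"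
    then obtain d where "u = d *s w" "d \<noteq> 0" by blast
    then show "\<exists>d. u = d *s v \<and> d \<noteq> 0" using c by (intro exI[of _ "d * c"]) (simp add: vector_smult_assoc)
  next
    assume "\<exists>d. u = d *s v \<and> d \<noteq> 0"
    then obtain d where "u = d *s v" "d \<noteq> 0" by blast
    then show "\<exists>d. u = d *s w \<and> d \<noteq> 0" using c by (intro exI[of _ "d / c"]) (simp add: vector_smult_assoc)
  qed
  then show "proj_pt v = proj_pt w" by (auto simp: proj_pt_def)
qed

lemma proj_pt_mem: "w \<in> proj_pt v \<Longrightarrow> proj_pt w = proj_pt v"
proof -
  assume "w \<in> proj_pt v"
  then have "\<exists>c. c \<noteq> 0 \<and> w = c *s v" by (auto simp: proj_pt_def)
  then show ?thesis using proj_pt_eq_iff[of v w] by simp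
qed

lemma proj_pt_P2 [simp]: "v \<noteq> 0 \<Longrightarrow> proj_pt v \<in> P2"
  by (simp add: P2_def)

lemma P2_cases:
  assumes "P \<in> P2"
  obtains v where "v \<noteq> 0" "P = proj_pt v"
  using assms by (auto simp: P2_def)

lemma P2_mem: "P \<in> P2 \<Longrightarrow> v \<in> P \<Longrightarrow> v \<noteq> 0 \<and> P = proj_pt v"
proof -
  assume "P \<in> P2" "v \<in> P"
  then obtain w where w: "w \<noteq> 0" "P = proj_pt w" by (rule_tac P2_cases)
  then have "proj_pt v = P" using \<open>v \<in> P\<close> proj_pt_mem by simp
  moreover have "v \<noteq> 0" using \<open>v \<in> P\<close> w by (auto simp: proj_pt_def)
  ultimately show ?thesis by simp
qed

definition rep :: "point \<Rightarrow> complex ^ 3" where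
  "rep P = (SOME v. v \<in> P)"

lemma rep_mem: "P \<in> P2 \<Longrightarrow> rep P \<in> P"
  unfolding rep_def by (rule someI_ex) (auto elim: P2_cases intro: exI[of _ "_ :: complex ^ 3"] proj_pt_self)

lemma rep_nonzero: "P \<in> P2 \<Longrightarrow> rep P \<noteq> 0" and proj_pt_rep: "P \<in> P2 \<Longrightarrow> proj_pt (rep P) = P"
  using P2_mem rep_mem by blast+

lemma evv_proj_pt: "F \<in> forms n \<Longrightarrow> w \<in> proj_pt v \<Longrightarrow> evv w F = 0 \<longleftrightarrow> evv v F = 0"
  by (auto simp: proj_pt_def evv_scale)

lemma zero_locus_P2: "zero_locus S \<subseteq> P2"
  by (auto simp: zero_locus_def)

lemma proj_pt_zero_locus:
  assumes "v \<noteq> 0" "\<And>F. F \<in> S \<Longrightarrow> \<exists>n. F \<in> forms n"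
  shows "proj_pt v \<in> zero_locus S \<longleftrightarrow> (\<forall>F\<in>S. evv v F = 0)"
proof -
  have "(\<forall>w\<in>proj_pt v. evv w F = 0) \<longleftrightarrow> evv v F = 0" if "F \<in> S" for F
    using assms(2)[OF that] evv_proj_pt proj_pt_self by blast
  then show ?thesis using assms(1) by (auto simp: zero_locus_def)
qed

lemma proj_pt_zero_locus_single:
  assumes "v \<noteq> 0" "F \<in> forms n"
  shows "proj_pt v \<in> zero_locus {F} \<longleftrightarrow> evv v F = 0"
  using assms(2) by (subst proj_pt_zero_locus[OF assms(1)]) auto

lemma proj_pt_mem_line [simp]: "v \<noteq> 0 \<Longrightarrow> proj_pt v \<in> zero_locus {lin q} \<longleftrightarrow> dotp q v = 0"
  by (simp add: proj_pt_zero_locus_single[OF _ lin_form])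

lemma zero_locus_insert: "zero_locus (insert F S) = zero_locus {F} \<inter> zero_locus S"
  by (auto simp: zero_locus_def)

lemma zero_locus_dvd: "F dvd G \<Longrightarrow> zero_locus {F} \<subseteq> zero_locus {G}"
  by (auto simp: zero_locus_def dvd_def ev.hom_mult)

lemma zero_locus_mult:
  assumes "F \<in> forms m" "G \<in> forms n"
  shows "zero_locus {F * G} = zero_locus {F} \<union> zero_locus {G}"
proof (intro Set.set_eqI)
  fix P
  show "P \<in> zero_locus {F * G} \<longleftrightarrow> P \<in> zero_locus {F} \<union> zero_locus {G}"
  proof (cases "P \<in> P2")
    case True
    then obtain v where v: "v \<noteq> 0" "P = proj_pt v" by (rule P2_cases)
    have "\<exists>n. F * G \<in> forms n" using forms_mult assms by blast
    then have "P \<in> zero_locus {F * G} \<longleftrightarrow> evv v F = 0 \<or> evv v G = 0"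
      unfolding v(2) by (subst proj_pt_zero_locus[OF v(1)]) (auto simp: ev.hom_mult)
    moreover have "P \<in> zero_locus {F} \<longleftrightarrow> evv v F = 0" "P \<in> zero_locus {G} \<longleftrightarrow> evv v G = 0"
      unfolding v(2) using assms by (subst proj_pt_zero_locus[OF v(1)]; auto)+
    ultimately show ?thesis by blast
  qed (auto simp: zero_locus_def)
qed

lemma zero_locus_ideal_gen: "zero_locus (ideal_gen S) = zero_locus S"
proof -
  interpret I: Modules.module "(*) :: 3 cpoly \<Rightarrow> 3 cpoly \<Rightarrow> 3 cpoly" by (rule module_cpoly_times)
  have "cpoly_eval v F = 0" if "F \<in> I.span S" "\<forall>F\<in>S. cpoly_eval v F = 0" for v F
    using that by (induction rule: I.span_induct_alt) (auto simp: ev.hom_simps)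
  then show ?thesis
    using I.span_superset[of S] unfolding zero_locus_def ideal_gen_def by blast
qed

lemma separating_vec:
  assumes "v \<noteq> 0" "w \<noteq> 0" "proj_pt v \<noteq> proj_pt w"
  obtains q where "dotp q w = 0" "dotp q v \<noteq> 0"
proof -
  have "\<exists>i j. v $ i * w $ j \<noteq> v $ j * w $ i"
  proof (rule ccontr)
    assume "\<not> ?thesis"
    then have *: "v $ i * w $ j = v $ j * w $ i" for i j by blast
    obtain j where j: "v $ j \<noteq> 0" using assms(1) vec_nonzero_component by blast
    have "w = (w $ j / v $ j) *s v" using j *[of j] by (simp add: vec_eq_iff field_simps)
    moreover from this have "w $ j \<noteq> 0" using assms(2) by auto
    ultimately show False using assms(3) j proj_pt_eq_iff by (metis divide_eq_0_iff)
  qed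
  then obtain i j where ij: "v $ i * w $ j \<noteq> v $ j * w $ i" by blast
  \<comment> \<open>The linear form w_j x_i - w_i x_j vanishes at w, and its value at v is the
    nonzero minor.\<close>
  show ?thesis
  proof (rule that[of "axis i (w $ j) + axis j (- w $ i)"])
    show "dotp (axis i (w $ j) + axis j (- w $ i)) w = 0"
      unfolding dotp_add dotp_commute[of "axis _ _" w] by simp
    show "dotp (axis i (w $ j) + axis j (- w $ i)) v \<noteq> 0"
      unfolding dotp_add dotp_commute[of "axis _ _" v] using ij by simp
  qed
qed

text \<open>A product of lines, one through each point of T and all missing P; hence the degree
  \<open>card T\<close>.\<close>

lemma separating_form:
  assumes "finite T" "T \<subseteq> P2" "P \<in> P2" "P \<notin> T"
  shows "\<exists>E\<in>forms (card T). evv (rep P) E \<noteq> 0 \<and> (\<forall>Q\<in>T. evv (rep Q) E = 0)"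
  using assms
proof (induction T rule: finite_induct)
  case empty
  then show ?case by (intro bexI[of _ 1]) simp_all
next
  case (insert R T)
  then obtain E where E: "E \<in> forms (card T)" "evv (rep P) E \<noteq> 0" "\<forall>Q\<in>T. evv (rep Q) E = 0" by auto
  have "proj_pt (rep P) \<noteq> proj_pt (rep R)" using insert.prems by (auto simp: proj_pt_rep)
  then obtain q where q: "dotp q (rep R) = 0" "dotp q (rep P) \<noteq> 0"
    using separating_vec insert.prems rep_nonzero by (metis insert_subset)
  show ?case
  proof (intro bexI[of _ "lin q * E"] conjI ballI)
    show "lin q * E \<in> forms (card (insert R T))" using forms_mult[OF lin_form E(1)] insert by simp
    show "evv (rep P) (lin q * E) \<noteq> 0" using E q by (simp add: ev.hom_mult)
    show "evv (rep Q) (lin q * E) = 0" if "Q \<in> insert R T" for Q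
      using that E q by (auto simp: ev.hom_mult)
  qed
qed

text \<open>The degree is raised to m by a power of a coordinate that is nonzero at P.\<close>

lemma separating_form_degree:
  assumes "finite S" "S \<subseteq> P2" "P \<in> S" "card S \<le> m"
  shows "\<exists>E\<in>forms m. evv (rep P) E \<noteq> 0 \<and> (\<forall>Q\<in>S - {P}. evv (rep Q) E = 0)"
proof -
  have "rep P \<noteq> 0" using assms rep_nonzero by blast
  then obtain i where i: "rep P $ i \<noteq> 0" using vec_nonzero_component by blast
  obtain E where E: "E \<in> forms (card (S - {P}))" "evv (rep P) E \<noteq> 0" "\<forall>Q\<in>S - {P}. evv (rep Q) E = 0"
    using separating_form[of "S - {P}" P] assms by auto
  have c: "card (S - {P}) \<le> m" using assms by (simp add: card_Diff_singleton)
  show ?thesis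
  proof (intro bexI[of _ "Var i ^ (m - card (S - {P})) * E"] conjI ballI)
    show "Var i ^ (m - card (S - {P})) * E \<in> forms m"
      using forms_mult[OF forms_power[OF forms_Var, of i "m - card (S - {P})"] E(1)] c by simp
  qed (use E i in \<open>auto simp: ev.hom_simps\<close>)
qed

section \<open>The Bezout inequality\<close>

text \<open>Dimension count in one large degree m. The forms that separate the N points of S span a
  space W of dimension N. It meets the space V of degree m combinations of h and F only in 0,
  because V vanishes on S. As V has dimension dim \<open>forms (N + e)\<close> + dim
  \<open>forms (N + k)\<close> - dim \<open>forms N\<close>, the inequality N + dim V \<le> dim
  \<open>forms m\<close> bounds N by a second difference of a quadratic function, which equals k *
  e.\<close>

lemma bezout_inequality:
  assumes h: "h \<in> forms k" "prime_elem h" and F: "F \<in> forms e" "\<not> h dvd F"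
    and S: "finite S" "S \<subseteq> zero_locus {h, F}"
  shows "card S \<le> k * e"
proof -
  define N where "N = card S"
  \<comment> \<open>Degree at least N separates the points; with this m the cofactors of h and F
    have degrees N + e and N + k, and those of the product of h and F have degree N.\<close>
  define m where "m = N + k + e"
  have h0: "h \<noteq> 0" using h(2) by auto
  have F0: "F \<noteq> 0" using F(2) by auto
  have SP: "S \<subseteq> P2" using S zero_locus_P2 by blast
  obtain E where E: "\<And>P. P \<in> S \<Longrightarrow> E P \<in> forms m" "\<And>P. P \<in> S \<Longrightarrow> evv (rep P) (E P) \<noteq> 0"
    "\<And>P Q. P \<in> S \<Longrightarrow> Q \<in> S \<Longrightarrow> P \<noteq> Q \<Longrightarrow> evv (rep Q) (E P) = 0"
  proof -
    have "\<forall>P\<in>S. \<exists>E. E \<in> forms m \<and> evv (rep P) E \<noteq> 0 \<and> (\<forall>Q\<in>S - {P}. evv (rep Q) E = 0)"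
      using separating_form_degree[OF S(1) SP, of _ m] unfolding Bex_def by (simp add: m_def N_def)
    from bchoice[OF this] obtain E where "\<forall>P\<in>S. E P \<in> forms m \<and> evv (rep P) (E P) \<noteq> 0 \<and> (\<forall>Q\<in>S - {P}. evv (rep Q) (E P) = 0)"
      by blast
    then show ?thesis by (intro that[of E]) auto
  qed
  have evE: "evv (rep Q) (\<Sum>P\<in>S. Const (c P) * E P) = c Q * evv (rep Q) (E Q)" if "Q \<in> S" for c Q
  proof -
    have "evv (rep Q) (\<Sum>P\<in>S. Const (c P) * E P) = (\<Sum>P\<in>S. if P = Q then c P * evv (rep Q) (E P) else 0)"
      unfolding ev.hom_sum ev.hom_mult by (rule sum.cong) (use E(3) that in auto)
    then show ?thesis using S(1) that by simp
  qed
  have injE: "inj_on E S"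
  proof (rule inj_onI)
    fix P Q assume "P \<in> S" "Q \<in> S" "E P = E Q"
    then show "P = Q" using E(2,3) by metis
  qed
  have indE: "cs.independent (E ` S)"
  proof (rule cs.independent_if_scalars_zero)
    fix f x assume 0: "(\<Sum>x\<in>E ` S. cscale (f x) x) = 0" and "x \<in> E ` S"
    then obtain Q where Q: "Q \<in> S" "x = E Q" by blast
    have "(\<Sum>P\<in>S. Const (f (E P)) * E P) = 0" using 0 by (simp add: sum.reindex[OF injE] cscale_def)
    then have "f (E Q) * evv (rep Q) (E Q) = 0" using evE[OF Q(1), of "\<lambda>P. f (E P)"] by simp
    then show "f x = 0" using E(2) Q by auto
  qed (use S in simp)
  define W where "W = cs.span (E ` S)"
  have fW: "cs.fd_subspace W" unfolding W_def using S by (intro cs.fd_subspace_span) simp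
  have dW: "cs.dim W = N" unfolding W_def N_def using indE by (simp add: cs.dim_eq_card_independent card_image[OF injE])
  define U where "U = (*) h ` (forms N :: 3 cpoly set)"
  have fU: "cs.fd_subspace U" "cs.dim U = cs.dim (forms N :: 3 cpoly set)"
    unfolding U_def by (rule fd_mult_image[OF fd_forms h0])+
  have UF: "U \<subseteq> forms (N + k)" using forms_mult[OF h(1)] by (auto simp: U_def add.commute)
  \<comment> \<open>Multiples of both h and F would be counted twice, so F is multiplied only by a
    complement of the multiples of h. Primality of h then makes the two summands
    independent.\<close>
  obtain C where C: "cs.fd_subspace C" "C \<subseteq> forms (N + k)" "U \<inter> C \<subseteq> {0}"
      "cs.dim U + cs.dim C = cs.dim (forms (N + k) :: 3 cpoly set)"
    by (rule cs.fd_subspace_complement[OF fU(1) fd_forms UF])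
  define V1 where "V1 = (*) h ` (forms (N + e) :: 3 cpoly set)"
  have fV1: "cs.fd_subspace V1" "cs.dim V1 = cs.dim (forms (N + e) :: 3 cpoly set)"
    unfolding V1_def by (rule fd_mult_image[OF fd_forms h0])+
  define V2 where "V2 = (*) F ` C"
  have fV2: "cs.fd_subspace V2" "cs.dim V2 = cs.dim C"
    unfolding V2_def by (rule fd_mult_image[OF C(1) F0])+
  have V12: "V1 \<inter> V2 \<subseteq> {0}"
  proof
    fix x assume "x \<in> V1 \<inter> V2"
    then obtain A c where A: "x = h * A" and c: "x = F * c" "c \<in> C"
      unfolding V1_def V2_def by blast
    then have "h dvd F * c" by (metis dvd_triv_left)
    then have "h dvd c" using h(2) F(2) by (simp add: prime_elem_dvd_mult_iff)
    then obtain c' where c': "c = h * c'" by (auto simp: dvd_def)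
    have "c' \<in> forms (N + k - k)" using c(2) C(2) c' h h0 by (intro forms_cofactor[of h]) auto
    then have "c \<in> U" using c' by (auto simp: U_def)
    then show "x \<in> {0}" using C(3) c by auto
  qed
  define V where "V = {x + y | x y. x \<in> V1 \<and> y \<in> V2}"
  have fV: "cs.fd_subspace V" "cs.dim V = cs.dim V1 + cs.dim V2"
    unfolding V_def by (rule cs.fd_subspace_sums[OF fV1(1) fV2(1)], rule cs.dim_direct_sum[OF fV1(1) fV2(1) V12])
  have van: "evv (rep P) x = 0" if "x \<in> V" "P \<in> S" for x P
  proof -
    have "P \<in> zero_locus {h, F}" using S that by blast
    then have "evv (rep P) h = 0" "evv (rep P) F = 0" using rep_mem by (auto simp: zero_locus_def)
    then show ?thesis using that by (auto simp: V_def V1_def V2_def ev.hom_simps)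
  qed
  have WV: "W \<inter> V \<subseteq> {0}"
  proof
    fix x assume x: "x \<in> W \<inter> V"
    then obtain f where "x = (\<Sum>y\<in>E ` S. cscale (f y) y)"
      unfolding W_def using cs.span_finite[of "E ` S"] S by auto
    then have f: "x = (\<Sum>P\<in>S. Const (f (E P)) * E P)" by (simp add: sum.reindex[OF injE] cscale_def)
    have "f (E Q) = 0" if "Q \<in> S" for Q
      using evE[OF that, of "\<lambda>P. f (E P)"] van[of x Q] x that E(2) by (auto simp: f)
    then show "x \<in> {0}" unfolding f by simp
  qed
  have dWV: "cs.dim {x + y | x y. x \<in> W \<and> y \<in> V} = N + cs.dim V"
    using cs.dim_direct_sum[OF fW fV(1) WV] dW by simp
  have "{x + y | x y. x \<in> W \<and> y \<in> V} \<subseteq> forms m"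
  proof -
    have "W \<subseteq> forms m" unfolding W_def by (intro cs.span_minimal subspace_forms) (use E in auto)
    moreover have "V1 \<subseteq> forms m" using forms_mult[OF h(1)] by (fastforce simp: V1_def m_def ac_simps)
    moreover have "V2 \<subseteq> forms m" using forms_mult[OF F(1), of _ "N + k"] C(2) by (fastforce simp: V2_def m_def ac_simps)
    ultimately show ?thesis by (auto simp: V_def intro!: forms_add)
  qed
  from cs.dim_mono_fd[OF this fd_forms] have "N + cs.dim V \<le> cs.dim (forms m :: 3 cpoly set)"
    unfolding dWV .
  moreover have "cs.dim V + cs.dim (forms N :: 3 cpoly set) = cs.dim (forms (N + e) :: 3 cpoly set) + cs.dim (forms (N + k) :: 3 cpoly set)"
    using fV(2) fV1(2) fV2(2) fU(2) C(4) by simp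
  ultimately have "N + cs.dim (forms (N + e) :: 3 cpoly set) + cs.dim (forms (N + k) :: 3 cpoly set)
     \<le> cs.dim (forms m :: 3 cpoly set) + cs.dim (forms N :: 3 cpoly set)" by linarith
  then have "2 * N + 2 * cs.dim (forms (N + e) :: 3 cpoly set) + 2 * cs.dim (forms (N + k) :: 3 cpoly set)
     \<le> 2 * cs.dim (forms m :: 3 cpoly set) + 2 * cs.dim (forms N :: 3 cpoly set)" by linarith
  then have "2 * N + (N + e + 1) * (N + e + 2) + (N + k + 1) * (N + k + 2) \<le> (m + 1) * (m + 2) + (N + 1) * (N + 2)"
    by (simp only: dim_forms)
  then have "N \<le> k * e"
    by (simp add: m_def algebra_simps)
  then show ?thesis by (simp add: N_def)
qed

section \<open>Restriction to lines\<close>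

text \<open>F along the affine part a + t b of the line through a and b. The point b itself is at
  infinity, so statements about the whole line also use the opposite parametrization b + s
  a.\<close>

definition line_poly :: "complex ^ 3 \<Rightarrow> complex ^ 3 \<Rightarrow> 3 cpoly \<Rightarrow> complex poly" where
  "line_poly a b = pm_eval (\<lambda>c. [:c:]) (\<lambda>i. [:a $ i, b $ i:])"

lemma poly_line_poly: "poly (line_poly a b F) t = evv (a + t *s b) F"
  unfolding line_poly_def
  by (rule comm_ring_hom_unique[OF comm_ring_hom_comp[OF comm_ring_hom_poly
      comm_ring_hom_pm_eval[OF comm_ring_hom_const_poly]] comm_ring_hom_cpoly_eval])
    (simp_all add: comm_ring_hom_const_poly)

lemma evv_combination_scale:
  assumes "F \<in> forms m" "s \<noteq> 0"
  shows "evv (s *s a + t *s b) F = s ^ m * evv (a + (t / s) *s b) F"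
proof -
  have "s *s a + t *s b = s *s (a + (t / s) *s b)" using assms(2) by (simp add: vec_eq_iff distrib_left)
  then show ?thesis using evv_scale[OF assms(1)] by simp
qed

text \<open>If F has no zero at any a + t b, then it is constant there by the fundamental theorem of
  algebra. Homogeneity gives F(b + s a) = s^m F(a), and s = 0 shows that F vanishes at b.\<close>

lemma line_zero:
  assumes F: "F \<in> forms m" "m > 0"
  shows "\<exists>s t. (s \<noteq> 0 \<or> t \<noteq> 0) \<and> evv (s *s a + t *s b) F = 0"
proof (cases "\<exists>t. evv (a + t *s b) F = 0")
  case True
  then obtain t where "evv (a + t *s b) F = 0" by blast
  then show ?thesis by (intro exI[of _ 1] exI[of _ t]) simp
next
  case False
  then have "constant (poly (line_poly a b F))"
    using fundamental_theorem_of_algebra[of "line_poly a b F"] by (auto simp: poly_line_poly)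
  then have c: "evv (a + t *s b) F = evv a F" for t
  proof -
    have "poly (line_poly a b F) t = poly (line_poly a b F) 0"
      using \<open>constant (poly (line_poly a b F))\<close> unfolding constant_def by blast
    then show ?thesis by (simp add: poly_line_poly)
  qed
  define r where "r = line_poly b a F - Polynomial.monom (evv a F) m"
  have "poly r s = 0" if "s \<noteq> 0" for s
    using evv_combination_scale[OF F(1) that, of a 1 b] c[of "1 / s"]
    by (simp add: r_def poly_line_poly poly_monom add.commute)
  then have "UNIV - {0} \<subseteq> {s. poly r s = 0}" by auto
  moreover have "infinite (UNIV - {0 :: complex})" by (simp add: infinite_UNIV_char_0)
  ultimately have "r = 0" using poly_roots_finite finite_subset by blast
  then have "poly (line_poly b a F) 0 = poly (Polynomial.monom (evv a F) m) 0" by (simp add: r_def)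
  then have "evv b F = 0" using F(2) by (simp add: poly_line_poly poly_monom)
  then show ?thesis by (intro exI[of _ 0] exI[of _ 1]) simp
qed

text \<open>Infinitely many roots make the restriction to the affine part zero; the multiples of b,
  where s = 0, are reached through b + u a.\<close>

lemma line_vanish:
  assumes F: "F \<in> forms m" and inf: "infinite {t. evv (a + t *s b) F = 0}"
  shows "evv (s *s a + t *s b) F = 0"
proof -
  have "line_poly a b F = 0" using inf poly_roots_finite by (auto simp flip: poly_line_poly)
  then have 0: "evv (a + t *s b) F = 0" for t using poly_line_poly[of a b F t] by simp
  show ?thesis
  proof (cases "s = 0")
    case False
    then show ?thesis using evv_combination_scale[OF F False] 0 by simp
  next
    case True
    have "poly (line_poly b a F) u = 0" if "u \<noteq> 0" for u
      using evv_combination_scale[OF F that, of a 1 b] 0 by (simp add: poly_line_poly add.commute)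
    then have "UNIV - {0} \<subseteq> {s. poly (line_poly b a F) s = 0}" by auto
    moreover have "infinite (UNIV - {0 :: complex})" by (simp add: infinite_UNIV_char_0)
    ultimately have "line_poly b a F = 0" using poly_roots_finite finite_subset by blast
    then have "evv b F = 0" using poly_line_poly[of b a F 0] by simp
    moreover have "m = 0 \<Longrightarrow> F = Const (evv b F)" using F forms_0_Const by fastforce
    ultimately show ?thesis using True evv_scale[OF F, of t b] by simp
  qed
qed

lemma line_param:
  assumes "q \<noteq> 0"
  obtains a b where "\<forall>v. dotp q v = 0 \<longleftrightarrow> (\<exists>s t. v = s *s a + t *s b)"
    "\<forall>s t. s *s a + t *s b = 0 \<longrightarrow> s = 0 \<and> t = 0"
proof -
  obtain k where k: "q $ k \<noteq> 0" using assms vec_nonzero_component by blast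
  note neq = shift_3_neq[of k] shift_3_neq[of k, symmetric]
  \<comment> \<open>The points a and b of the line have (x_(k+1), x_(k+2)) equal to (1, 0) and (0,
    1), so these two coordinates are the parameters s and t.\<close>
  define a where "a = axis (k + 1) 1 + axis k (- q $ (k + 1) / q $ k)"
  define b where "b = axis (k + 2) 1 + axis k (- q $ (k + 2) / q $ k)"
  have comp: "a $ k = - q $ (k + 1) / q $ k" "a $ (k + 1) = 1" "a $ (k + 2) = 0"
     "b $ k = - q $ (k + 2) / q $ k" "b $ (k + 1) = 0" "b $ (k + 2) = 1"
    using neq by (simp_all add: a_def b_def axis_def)
  have all: "(\<forall>i. R i) \<longleftrightarrow> R k \<and> R (k + 1) \<and> R (k + 2)" for R
    using UNIV_3_shift[of k] by (metis UNIV_I empty_iff insertE)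
  show ?thesis
  proof (rule that[of a b]; intro allI impI)
    fix v
    show "dotp q v = 0 \<longleftrightarrow> (\<exists>s t. v = s *s a + t *s b)"
    proof
      assume "dotp q v = 0"
      then have "q $ k * v $ k + q $ (k + 1) * v $ (k + 1) + q $ (k + 2) * v $ (k + 2) = 0"
        by (simp add: dotp_def sum_3_shift[of _ k])
      then have "q $ k * v $ k = - (q $ (k + 1) * v $ (k + 1) + q $ (k + 2) * v $ (k + 2))"
        unfolding eq_neg_iff_add_eq_0 add.assoc[symmetric] .
      then have "v $ k = - (q $ (k + 1) * v $ (k + 1) + q $ (k + 2) * v $ (k + 2)) / q $ k"
        using k by (simp add: nonzero_eq_divide_eq mult.commute)
      then have "v = v $ (k + 1) *s a + v $ (k + 2) *s b"
        unfolding vec_eq_iff all using k by (simp add: comp) (simp add: field_simps)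
      then show "\<exists>s t. v = s *s a + t *s b" by blast
    next
      assume "\<exists>s t. v = s *s a + t *s b"
      then show "dotp q v = 0" using k by (auto simp: dotp_def sum_3_shift[of _ k] comp) (simp add: field_simps)
    qed
    fix s t assume "s *s a + t *s b = 0"
    then have "(s *s a + t *s b) $ (k + 1) = 0" "(s *s a + t *s b) $ (k + 2) = 0" by simp_all
    then show "s = 0 \<and> t = 0" by (simp add: comp)
  qed
qed

lemma line_meets:
  assumes "F \<in> forms m" "m > 0" "q \<noteq> 0"
  obtains v where "v \<noteq> 0" "dotp q v = 0" "evv v F = 0"
proof -
  obtain a b where ab: "\<forall>v. dotp q v = 0 \<longleftrightarrow> (\<exists>s t. v = s *s a + t *s b)"
    "\<forall>s t. s *s a + t *s b = 0 \<longrightarrow> s = 0 \<and> t = 0" by (rule line_param[OF assms(3)])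
  obtain s t where "s \<noteq> 0 \<or> t \<noteq> 0" "evv (s *s a + t *s b) F = 0" using line_zero[OF assms(1,2)] by blast
  then show ?thesis using ab by (intro that[of "s *s a + t *s b"]) auto
qed

text \<open>Apart from the single point b, each point of Y comes from a parameter t, so infinitely
  many parameters are roots.\<close>

lemma line_infinite_vanish:
  fixes q v :: "complex ^ 3"
  assumes q: "q \<noteq> 0" and F: "F \<in> forms m" and Y: "infinite Y" "Y \<subseteq> zero_locus {lin q, F}"
    and v: "dotp q v = 0"
  shows "evv v F = 0"
proof -
  obtain a b where ab: "\<forall>v. dotp q v = 0 \<longleftrightarrow> (\<exists>s t. v = s *s a + t *s b)"
    "\<forall>s t. s *s a + t *s b = 0 \<longrightarrow> s = 0 \<and> t = 0" by (rule line_param[OF q])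
  have "Y - {proj_pt b} \<subseteq> (\<lambda>t. proj_pt (a + t *s b)) ` {t. evv (a + t *s b) F = 0}"
  proof
    fix P assume P: "P \<in> Y - {proj_pt b}"
    then have P2: "P \<in> P2" using Y zero_locus_P2 by blast
    have r: "dotp q (rep P) = 0" "evv (rep P) F = 0"
      using P Y rep_mem[OF P2] by (auto simp: zero_locus_def)
    then obtain s t where st: "rep P = s *s a + t *s b" using ab by blast
    have "s \<noteq> 0"
    proof
      assume "s = 0"
      then have "rep P = t *s b" using st by simp
      moreover have "t \<noteq> 0" using rep_nonzero[OF P2] calculation by auto
      ultimately have "proj_pt b = P" using proj_pt_rep[OF P2] proj_pt_eq_iff by metis
      then show False using P by blast
    qed
    then have e: "rep P = s *s (a + (t / s) *s b)" using st by (simp add: vec_eq_iff distrib_left)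
    then have "proj_pt (a + (t / s) *s b) = P" using \<open>s \<noteq> 0\<close> proj_pt_rep[OF P2] proj_pt_eq_iff by metis
    moreover have "evv (a + (t / s) *s b) F = 0" using r(2) e evv_scale[OF F] \<open>s \<noteq> 0\<close> by simp
    ultimately show "P \<in> (\<lambda>t. proj_pt (a + t *s b)) ` {t. evv (a + t *s b) F = 0}" by blast
  qed
  then have "infinite {t. evv (a + t *s b) F = 0}" using Y(1) by (meson finite_imageI finite_subset infinite_remove)
  moreover obtain s t where "v = s *s a + t *s b" using v ab by blast
  ultimately show ?thesis using line_vanish[OF F] by simp
qed

lemma infinite_line:
  assumes "q \<noteq> 0"
  shows "infinite (zero_locus {lin q})"
proof -
  obtain a b where ab: "\<forall>v. dotp q v = 0 \<longleftrightarrow> (\<exists>s t. v = s *s a + t *s b)"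
    "\<forall>s t. s *s a + t *s b = 0 \<longrightarrow> s = 0 \<and> t = 0" by (rule line_param[OF assms])
  have nz: "a + t *s b \<noteq> 0" for t using ab(2)[rule_format, of 1 t] by auto
  have "inj (\<lambda>t. proj_pt (a + t *s b))"
  proof (rule injI)
    fix t u assume "proj_pt (a + t *s b) = proj_pt (a + u *s b)"
    then obtain c where "a + u *s b = c *s (a + t *s b)" using proj_pt_eq_iff by blast
    then have c: "(a + u *s b) $ i = (c *s (a + t *s b)) $ i" for i by simp
    have "((1 - c) *s a + (u - c * t) *s b) $ i = (a + u *s b) $ i - (c *s (a + t *s b)) $ i" for i
      by (simp add: algebra_simps)
    then have "((1 - c) *s a + (u - c * t) *s b) $ i = 0 $ i" for i unfolding c by simp
    then have "(1 - c) *s a + (u - c * t) *s b = 0" unfolding vec_eq_iff by blast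
    from ab(2)[rule_format, OF this] show "t = u" by auto
  qed
  moreover have "range (\<lambda>t. proj_pt (a + t *s b)) \<subseteq> zero_locus {lin q}"
  proof
    fix P assume "P \<in> range (\<lambda>t. proj_pt (a + t *s b))"
    then obtain t where t: "P = proj_pt (a + t *s b)" by blast
    have "dotp q (a + t *s b) = 0" unfolding ab(1)[rule_format] by (intro exI[of _ 1] exI[of _ t]) simp
    then show "P \<in> zero_locus {lin q}"
      unfolding t using nz by simp
  qed
  ultimately show ?thesis by (meson finite_imageD finite_subset infinite_UNIV_char_0)
qed

text \<open>In the dual plane the lines through a point P form the line \<open>lin (rep P)\<close>.
  The vector q is chosen off the product of these finitely many linear forms with G.\<close>

lemma avoid_points:
  assumes "finite Y" "Y \<subseteq> P2" "G \<noteq> 0"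
  obtains q where "evv q G \<noteq> 0" "\<And>P v. P \<in> Y \<Longrightarrow> v \<in> P \<Longrightarrow> dotp q v \<noteq> 0"
proof -
  have "G * (\<Prod>P\<in>Y. lin (rep P)) \<noteq> 0"
    using assms lin_nonzero[OF rep_nonzero] by (auto simp: prod_zero_iff)
  then obtain q where q: "evv q (G * (\<Prod>P\<in>Y. lin (rep P))) \<noteq> 0" using evv_nonzero by blast
  have nz: "dotp (rep P) q \<noteq> 0" if "P \<in> Y" for P
    using q assms(1) that by (auto simp: ev.hom_simps prod_zero_iff)
  show ?thesis
  proof (rule that[of q])
    show "evv q G \<noteq> 0" using q by (auto simp: ev.hom_mult)
    fix P v assume P: "P \<in> Y" "v \<in> P"
    then have "v \<in> proj_pt (rep P)" using assms(2) proj_pt_rep by blast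
    then show "dotp q v \<noteq> 0" using nz[OF P(1)] dotp_commute[of q] by (auto simp: proj_pt_def)
  qed
qed

text \<open>Some line misses any given finite set of points, whereas every line meets every curve of
  positive degree.\<close>

lemma infinite_zero_locus:
  assumes "D \<in> forms m" "m > 0"
  shows "infinite (zero_locus {D})"
proof
  assume "finite (zero_locus {D})"
  then obtain q where q: "evv q (lin (axis 0 1)) \<noteq> 0" "\<And>P v. P \<in> zero_locus {D} \<Longrightarrow> v \<in> P \<Longrightarrow> dotp q v \<noteq> 0"
    using avoid_points[OF _ zero_locus_P2 lin_nonzero, of "{D}" "axis 0 1"] by (auto simp: axis_eq_0_iff)
  have "q \<noteq> 0" using q(1) by (auto simp: dotp_def)
  then obtain v where v: "v \<noteq> 0" "dotp q v = 0" "evv v D = 0" using line_meets[OF assms] by blast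
  have "proj_pt v \<in> zero_locus {D}" using v assms by (subst proj_pt_zero_locus) auto
  then show False using q(2)[of "proj_pt v" v] v by simp
qed

section \<open>Closed sets of dimension zero and one\<close>

lemma zariski_closed_P2: "zariski_closed W \<Longrightarrow> W \<subseteq> P2"
  using zero_locus_P2 by (auto simp: zariski_closed_def)

lemma zariski_closedI: "(\<And>F. F \<in> S \<Longrightarrow> \<exists>n. F \<in> forms n) \<Longrightarrow> zariski_closed (zero_locus S)"
  by (auto simp: zariski_closed_def)

lemma zariski_closed_zero_locus_single: "F \<in> forms n \<Longrightarrow> zariski_closed (zero_locus {F})"
  by (rule zariski_closedI) auto

lemma zariski_closed_Int:
  assumes "zariski_closed A" "zariski_closed B"
  shows "zariski_closed (A \<inter> B)"
proof -
  obtain S T where S: "\<forall>F\<in>S. \<exists>n. F \<in> forms n" "A = zero_locus S"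
    and T: "\<forall>F\<in>T. \<exists>n. F \<in> forms n" "B = zero_locus T"
    using assms unfolding zariski_closed_def by blast
  have "A \<inter> B = zero_locus (S \<union> T)" unfolding S T by (auto simp: zero_locus_def)
  moreover have "zariski_closed (zero_locus (S \<union> T))" by (rule zariski_closedI) (use S T in blast)
  ultimately show ?thesis by simp
qed

lemma zariski_closed_Un:
  assumes "zariski_closed A" "zariski_closed B"
  shows "zariski_closed (A \<union> B)"
proof -
  obtain S T where S: "\<forall>F\<in>S. \<exists>n. F \<in> forms n" "A = zero_locus S"
    and T: "\<forall>F\<in>T. \<exists>n. F \<in> forms n" "B = zero_locus T"
    using assms unfolding zariski_closed_def by blast
  define U where "U = {F * G | F G. F \<in> S \<and> G \<in> T}"
  have U: "\<exists>n. F \<in> forms n" if "F \<in> U" for F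
    using that S(1) T(1) forms_mult unfolding U_def by blast
  have "P \<in> A \<union> B \<longleftrightarrow> P \<in> zero_locus U" for P
  proof (cases "P \<in> P2")
    case True
    then obtain v where v: "v \<noteq> 0" "P = proj_pt v" by (rule P2_cases)
    have "P \<in> zero_locus U \<longleftrightarrow> (\<forall>F\<in>U. evv v F = 0)"
      unfolding v(2) by (rule proj_pt_zero_locus[OF v(1) U])
    also have "\<dots> \<longleftrightarrow> (\<forall>F\<in>S. \<forall>G\<in>T. evv v F = 0 \<or> evv v G = 0)"
      unfolding U_def by (auto simp: ev.hom_mult) (metis ev.hom_mult mult_eq_0_iff)
    also have "\<dots> \<longleftrightarrow> (\<forall>F\<in>S. evv v F = 0) \<or> (\<forall>G\<in>T. evv v G = 0)" by blast
    also have "\<dots> \<longleftrightarrow> P \<in> A \<union> B"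
      unfolding S(2) T(2) v(2) using proj_pt_zero_locus[OF v(1), of S] proj_pt_zero_locus[OF v(1), of T] S(1) T(1) by simp
    finally show ?thesis by simp
  next
    case False
    then show ?thesis using zero_locus_P2 unfolding S(2) T(2) by blast
  qed
  then have "A \<union> B = zero_locus U" by blast
  then show ?thesis using zariski_closedI[OF U] by simp
qed

lemma zero_locus_one [simp]: "zero_locus {1} = {}"
proof -
  have False if "P \<in> zero_locus {1}" for P
    using that rep_mem[of P] by (auto simp: zero_locus_def)
  then show ?thesis by blast
qed

lemma zariski_closed_empty: "zariski_closed {}"
  using zariski_closed_zero_locus_single[OF forms_one] by simp

lemma zariski_closed_point:
  assumes "P \<in> P2"
  shows "zariski_closed {P}"
proof -
  obtain v where v: "v \<noteq> 0" "P = proj_pt v" using assms by (rule P2_cases)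
  define S where "S = {lin q | q. dotp q v = 0}"
  have S: "\<exists>n. F \<in> forms n" if "F \<in> S" for F using that lin_form unfolding S_def by blast
  have mem: "proj_pt w \<in> zero_locus S \<longleftrightarrow> (\<forall>q. dotp q v = 0 \<longrightarrow> dotp q w = 0)" if "w \<noteq> 0" for w
  proof -
    have "proj_pt w \<in> zero_locus S \<longleftrightarrow> (\<forall>F\<in>S. evv w F = 0)" by (rule proj_pt_zero_locus[OF that S])
    then show ?thesis by (auto simp: S_def)
  qed
  have "Q = P" if Q: "Q \<in> zero_locus S" for Q
  proof (rule ccontr)
    assume "Q \<noteq> P"
    have "Q \<in> P2" using Q zero_locus_P2 by blast
    then obtain w where w: "w \<noteq> 0" "Q = proj_pt w" by (rule P2_cases)
    then obtain q where "dotp q v = 0" "dotp q w \<noteq> 0"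
      using separating_vec[OF w(1) v(1)] v(2) \<open>Q \<noteq> P\<close> by blast
    then show False using Q mem[OF w(1)] w(2) by blast
  qed
  moreover have "P \<in> zero_locus S" using mem[OF v(1)] v(2) by blast
  ultimately have "{P} = zero_locus S" by blast
  then show ?thesis using zariski_closedI[OF S] by simp
qed

lemma zariski_closed_finite: "finite A \<Longrightarrow> A \<subseteq> P2 \<Longrightarrow> zariski_closed A"
proof (induction A rule: finite_induct)
  case (insert P A)
  then have "zariski_closed ({P} \<union> A)" by (intro zariski_closed_Un zariski_closed_point) auto
  then show ?case by simp
qed (rule zariski_closed_empty)

lemma irreducible_closed_point: "P \<in> P2 \<Longrightarrow> irreducible_closed {P}"
  unfolding irreducible_closed_def using zariski_closed_point by blast

lemma finite_irreducible_closed: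
  assumes "finite W" "irreducible_closed W"
  shows "\<exists>P. W = {P}"
proof -
  have W: "zariski_closed W" "W \<noteq> {}" and irr: "\<And>A B. zariski_closed A \<Longrightarrow> zariski_closed B \<Longrightarrow> W = A \<union> B \<Longrightarrow> W = A \<or> W = B"
    using assms(2) unfolding irreducible_closed_def by blast+
  obtain P where P: "P \<in> W" using W(2) by blast
  have "W \<subseteq> P2" using zariski_closed_P2[OF W(1)] .
  then have "zariski_closed {P}" "zariski_closed (W - {P})"
    using P assms(1) by (auto intro!: zariski_closed_finite)
  from irr[OF this] P have "W = {P} \<or> W = W - {P}" by blast
  then show ?thesis using P by blast
qed

text \<open>A finite irreducible closed set is a single point, and a point has no nonempty proper
  subset to stand below it in a chain.\<close>

lemma has_chain_imp_infinite:
  assumes "has_chain W n" "n > 0"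
  shows "infinite W"
proof
  assume fin: "finite W"
  obtain Y where Y: "\<forall>i\<le>n. irreducible_closed (Y i) \<and> Y i \<subseteq> W" "\<forall>i<n. Y i \<subset> Y (Suc i)"
    using assms(1) unfolding has_chain_def by blast
  have Y1: "irreducible_closed (Y (Suc 0))" "Y (Suc 0) \<subseteq> W" and Y0: "irreducible_closed (Y 0)" "Y 0 \<subset> Y (Suc 0)"
    using Y assms(2) by auto
  have "finite (Y (Suc 0))" using fin Y1(2) by (rule rev_finite_subset)
  from finite_irreducible_closed[OF this Y1(1)] obtain P where "Y (Suc 0) = {P}" by blast
  then have "Y 0 \<subset> {P}" using Y0(2) by simp
  then have "Y 0 = {}" by auto
  then show False using Y0(1) unfolding irreducible_closed_def by blast
qed

lemma has_dim_0_if_finite: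
  assumes "finite W" "W \<noteq> {}" "W \<subseteq> P2"
  shows "has_dim W 0"
proof -
  obtain P where P: "P \<in> W" using assms(2) by blast
  then have "irreducible_closed {P}" using assms(3) irreducible_closed_point by blast
  then have "has_chain W 0" unfolding has_chain_def using P by (intro exI[of _ "\<lambda>_. {P}"]) simp
  then show ?thesis unfolding has_dim_def using has_chain_imp_infinite assms(1) by blast
qed

lemma irreducible_curve_infinite: "irreducible_curve C \<Longrightarrow> infinite C"
  unfolding irreducible_curve_def has_dim_def using has_chain_imp_infinite[of C 1] by simp

lemma nonunit_form_degree: "(F :: 3 cpoly) \<in> forms n \<Longrightarrow> F \<noteq> 0 \<Longrightarrow> \<not> F dvd 1 \<Longrightarrow> n > 0"
  using unit_forms_0 by (cases n) auto

lemma reducible_form: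
  fixes F :: "3 cpoly"
  assumes "F \<in> forms n" "F \<noteq> 0" "\<not> F dvd 1" "\<not> irreducible F"
  obtains A B a b where "F = A * B" "A \<in> forms a" "B \<in> forms b" "a + b = n" "a > 0" "b > 0"
proof -
  obtain A B where AB: "F = A * B" "\<not> A dvd 1" "\<not> B dvd 1"
    using assms unfolding irreducible_def by blast
  then have nz: "A * B \<noteq> 0" "A \<noteq> 0" "B \<noteq> 0" using assms(2) by auto
  have "A * B \<in> forms n" using assms(1) AB(1) by simp
  then obtain a b where ab: "A \<in> forms a" "B \<in> forms b" "a + b = n" using forms_factor[OF _ nz(1)] by blast
  show ?thesis
    by (rule that[OF AB(1) ab nonunit_form_degree[OF ab(1) nz(2) AB(2)] nonunit_form_degree[OF ab(2) nz(3) AB(3)]])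
qed

text \<open>An infinite closed set meets some curve \<open>V(F)\<close> in infinitely many points. If \<open>F\<close> has
  minimal degree, then \<open>F\<close> is irreducible, and by the Bezout inequality every infinite closed
  subset of the intersection contains the whole curve.\<close>

lemma has_dim_0_imp_finite:
  assumes S: "\<And>F. F \<in> S \<Longrightarrow> \<exists>n. F \<in> forms n" and dim: "has_dim (zero_locus S) 0"
  shows "finite (zero_locus S)"
proof (rule ccontr)
  define W where "W = zero_locus S"
  assume "infinite (zero_locus S)"
  then have inf: "infinite W" by (simp add: W_def)
  define R where "R n \<longleftrightarrow> (\<exists>F. F \<in> forms n \<and> F \<noteq> 0 \<and> infinite (W \<inter> zero_locus {F}))" for n
  have "\<exists>n. R n"
  proof (cases "S \<subseteq> {0}")
    case True
    then have "zero_locus {lin (axis 0 1)} \<subseteq> W"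
      unfolding W_def by (auto simp: zero_locus_def)
    moreover have nz: "axis 0 1 \<noteq> (0 :: complex ^ 3)" by (simp add: axis_eq_0_iff)
    ultimately have "infinite (W \<inter> zero_locus {lin (axis 0 1)})"
      using infinite_line[OF nz] by (simp add: Int_absorb1)
    then show ?thesis unfolding R_def using lin_form lin_nonzero[OF nz] by blast
  next
    case False
    then obtain F where F: "F \<in> S" "F \<noteq> 0" by blast
    then have "W \<inter> zero_locus {F} = W" unfolding W_def zero_locus_def by blast
    then show ?thesis unfolding R_def using F S[OF F(1)] inf by metis
  qed
  define n where "n = (LEAST n. R n)"
  have "R n" unfolding n_def using \<open>\<exists>n. R n\<close> by (rule LeastI_ex)
  have min: "\<not> R k" if "k < n" for k using that not_less_Least unfolding n_def by blast
  obtain F where F: "F \<in> forms n" "F \<noteq> 0" "infinite (W \<inter> zero_locus {F})"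
    using \<open>R n\<close> unfolding R_def by blast
  have nu: "\<not> F dvd 1"
  proof
    assume "F dvd 1"
    then have "zero_locus {F} \<subseteq> zero_locus {1}" by (rule zero_locus_dvd)
    then show False using F(3) by simp
  qed
  have "irreducible F"
  proof (rule ccontr)
    assume "\<not> irreducible F"
    from reducible_form[OF F(1,2) nu this] obtain A B a b where
      AB: "F = A * B" "A \<in> forms a" "B \<in> forms b" "a + b = n" "a > 0" "b > 0" .
    have "W \<inter> zero_locus {F} = (W \<inter> zero_locus {A}) \<union> (W \<inter> zero_locus {B})"
      unfolding AB(1) zero_locus_mult[OF AB(2,3)] by blast
    then have "infinite (W \<inter> zero_locus {A}) \<or> infinite (W \<inter> zero_locus {B})" using F(3) by simp
    then have "R a \<or> R b" unfolding R_def using AB F(2) by auto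
    then show False using min AB by auto
  qed
  then have prime: "prime_elem F" by (rule irreducible_imp_prime_elem_cpoly)
  define Y where "Y = W \<inter> zero_locus {F}"
  have cY: "zariski_closed Y" unfolding Y_def W_def
    by (intro zariski_closed_Int zariski_closedI S zariski_closed_zero_locus_single[OF F(1)])
  have big: "Y \<subseteq> A" if A: "zariski_closed A" "A \<subseteq> Y" "infinite A" for A
  proof -
    obtain T where T: "\<forall>H\<in>T. \<exists>n. H \<in> forms n" "A = zero_locus T" using A(1) unfolding zariski_closed_def by blast
    have "F dvd H" if H: "H \<in> T" for H
    proof (rule ccontr)
      assume nd: "\<not> F dvd H"
      obtain e where e: "H \<in> forms e" using T(1) H by blast
      have sub: "A \<subseteq> zero_locus {F, H}" using A(2) H unfolding T(2) Y_def zero_locus_def by blast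
      obtain B where B: "finite B" "card B = n * e + 1" "B \<subseteq> A"
        using A(3) infinite_arbitrarily_large by blast
      then have "card B \<le> n * e" using bezout_inequality[OF F(1) prime e nd B(1)] sub by blast
      then show False using B(2) by simp
    qed
    then have "zero_locus {F} \<subseteq> zero_locus {H}" if "H \<in> T" for H using that zero_locus_dvd by blast
    then have "zero_locus {F} \<subseteq> zero_locus T" using zero_locus_P2[of "{F}"] unfolding zero_locus_def by blast
    then show "Y \<subseteq> A" unfolding T(2) Y_def by blast
  qed
  have "irreducible_closed Y"
    unfolding irreducible_closed_def
  proof (intro conjI allI impI)
    show "Y \<noteq> {}" using F(3) unfolding Y_def by auto
    fix A B assume AB: "zariski_closed A \<and> zariski_closed B \<and> Y = A \<union> B"
    then have "infinite A \<or> infinite B" using F(3) unfolding Y_def by auto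
    then show "Y = A \<or> Y = B"
    proof
      assume "infinite A"
      then have "Y \<subseteq> A" using AB by (intro big) auto
      then show ?thesis using AB by auto
    next
      assume "infinite B"
      then have "Y \<subseteq> B" using AB by (intro big) auto
      then show ?thesis using AB by auto
    qed
  qed (rule cY)
  moreover from this obtain P where P: "P \<in> Y" unfolding irreducible_closed_def by blast
  moreover have "irreducible_closed {P}" using P zariski_closed_P2[OF cY] by (intro irreducible_closed_point) blast
  moreover have "{P} \<noteq> Y"
  proof
    assume "{P} = Y"
    then have "finite Y" using finite.insertI[OF finite.emptyI, of P] by simp
    then show False using F(3) by (simp add: Y_def)
  qed
  ultimately have "has_chain W 1"
    unfolding has_chain_def
    by (intro exI[of _ "\<lambda>i. if i = 0 then {P} else Y"]) (auto simp: Y_def)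
  then show False using dim unfolding has_dim_def W_def by auto
qed

section \<open>Two-generated ideals\<close>

lemma ideal_gen_pair: "F \<in> ideal_gen {P, Q} \<longleftrightarrow> (\<exists>A B. F = A * P + B * (Q :: 'v cpoly))"
proof -
  interpret I: Modules.module "(*) :: 'v cpoly \<Rightarrow> 'v cpoly \<Rightarrow> 'v cpoly" by (rule module_cpoly_times)
  show ?thesis
    unfolding ideal_gen_def I.span_insert I.span_singleton by (auto simp: algebra_simps)
qed

lemma ideal_gen_superset: "S \<subseteq> ideal_gen S"
proof -
  interpret I: Modules.module "(*) :: 'v cpoly \<Rightarrow> 'v cpoly \<Rightarrow> 'v cpoly" by (rule module_cpoly_times)
  show "S \<subseteq> ideal_gen S" for S :: "'v cpoly set" unfolding ideal_gen_def by (rule I.span_superset)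
qed

lemma ideal_gen_mono_span: "S \<subseteq> ideal_gen T \<Longrightarrow> ideal_gen S \<subseteq> ideal_gen T"
proof -
  interpret I: Modules.module "(*) :: 'v cpoly \<Rightarrow> 'v cpoly \<Rightarrow> 'v cpoly" by (rule module_cpoly_times)
  show "S \<subseteq> ideal_gen T \<Longrightarrow> ideal_gen S \<subseteq> ideal_gen T" for S T :: "'v cpoly set"
    unfolding ideal_gen_def by (rule I.span_minimal) (auto intro: I.subspace_span)
qed

section \<open>The net of forms\<close>

lemma shift_3 [simp]: "(i::3) + 1 + 1 = i + 2" "(i::3) + 1 + 2 = i" "(i::3) + 2 + 1 = i" "(i::3) + 2 + 2 = i + 1"
  by (simp_all add: add.assoc)

lemma Var_neq_0: "Var i \<noteq> (0 :: 3 cpoly)"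
proof
  assume "Var i = (0 :: 3 cpoly)"
  then have "cpoly_eval (\<lambda>_. 1) (Var i :: 3 cpoly) = 0" by simp
  then show False by simp
qed

text \<open>A common divisor that is not a unit would have infinitely many zeros, but x_(k+1) and
  x_(k+2) vanish together at one point only.\<close>

lemma common_divisor_Var:
  fixes c :: "3 cpoly"
  assumes c: "c dvd Var (k + 1)" "c dvd Var (k + 2)"
  shows "c dvd 1"
proof (rule ccontr)
  assume nu: "\<not> c dvd 1"
  obtain b where b: "Var (k + 1) = c * b" using c(1) by (auto simp: dvd_def)
  then have "c * b \<in> forms 1" "c * b \<noteq> 0" using forms_Var[of "k + 1"] Var_neq_0[of "k + 1"] by simp_all
  then obtain m where m: "c \<in> forms m" using forms_factor by blast
  have "c \<noteq> 0" using b Var_neq_0[of "k + 1"] by auto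
  then have "infinite (zero_locus {c})" using infinite_zero_locus[OF m nonunit_form_degree[OF m _ nu]] by simp
  moreover have "zero_locus {c} \<subseteq> {proj_pt (axis k 1)}"
  proof
    fix P assume P: "P \<in> zero_locus {c}"
    then have P2: "P \<in> P2" using zero_locus_P2 by blast
    have "P \<in> zero_locus {Var (k + 1)}" "P \<in> zero_locus {Var (k + 2)}"
      using P zero_locus_dvd c by blast+
    then have 0: "rep P $ (k + 1) = 0" "rep P $ (k + 2) = 0"
      using rep_mem[OF P2] by (auto simp: zero_locus_def)
    have "rep P $ i = (rep P $ k *s axis k 1) $ i" for i
    proof -
      have "i \<in> {k, k + 1, k + 2}" using UNIV_3_shift[of k] by blast
      then show ?thesis using 0 shift_3_neq[of k] by (auto simp: axis_def)
    qed
    then have e: "rep P = rep P $ k *s axis k 1" unfolding vec_eq_iff by blast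
    then have "rep P $ k \<noteq> 0" using rep_nonzero[OF P2] by (metis vector_smult_lzero)
    then have "proj_pt (axis k 1) = proj_pt (rep P)" unfolding proj_pt_eq_iff using e by blast
    then show "P \<in> {proj_pt (axis k 1)}" using proj_pt_rep[OF P2] by simp
  qed
  ultimately show False using finite_subset by blast
qed

definition cdot :: "complex ^ 3 \<Rightarrow> (3 \<Rightarrow> 3 cpoly) \<Rightarrow> 3 cpoly" where
  "cdot q G = (\<Sum>j\<in>UNIV. Const (q $ j) * G j)"

lemma cdot_shift: "cdot q G = Const (q $ k) * G k + Const (q $ (k + 1)) * G (k + 1) + Const (q $ (k + 2)) * G (k + 2)"
  unfolding cdot_def by (rule sum_3_shift)

lemma cdot_scale: "cdot (c *s q) G = Const c * cdot q G"
  by (simp add: cdot_def sum_distrib_left mult.assoc Const.hom_mult)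

lemma lin_eq_cdot: "lin q = cdot q Var"
  by (simp add: lin_def cdot_def)

definition evf :: "(3 \<Rightarrow> 3 cpoly) \<Rightarrow> complex ^ 3 \<Rightarrow> complex ^ 3" where
  "evf G v = (\<chi> i. evv v (G i))"

lemma evf_nth [simp]: "evf G v $ i = evv v (G i)"
  by (simp add: evf_def)

lemma evv_cdot [simp]: "evv v (cdot q G) = dotp q (evf G v)"
  by (simp add: cdot_def dotp_def ev.hom_simps)

lemma cdot_form: "(\<And>i. G i \<in> forms n) \<Longrightarrow> cdot q G \<in> forms n"
  unfolding cdot_def by (intro forms_sum forms_Const_mult)

lemma map_graph_alt: "map_graph f = {(proj_pt v, proj_pt (evf f v)) | v. v \<noteq> 0 \<and> evf f v \<noteq> 0}"
  by (simp add: map_graph_def evf_def)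

text \<open>Only the variables of the second plane are replaced. With Y = f this restricts an
  equation to the graph; with Y the constants q_j it gives an equation of the fibre over q.\<close>

definition sub_right :: "(3 \<Rightarrow> 3 cpoly) \<Rightarrow> (3 + 3) cpoly \<Rightarrow> 3 cpoly" where
  "sub_right Y = cpoly_subst (case_sum Var Y)"

lemma evv_sub_right: "evv v (sub_right Y F) = cpoly_eval (case_sum (($) v) (($) (evf Y v))) F"
proof -
  have "(\<lambda>i. cpoly_eval (($) v) (case_sum Var Y i)) = case_sum (($) v) (($) (evf Y v))"
    by (rule ext) (simp split: sum.split)
  then show ?thesis by (simp add: sub_right_def cpoly_eval_subst)
qed

lemma sub_right_form:
  assumes "F \<in> biforms a b"
  shows "sub_right (\<lambda>i. Const (q $ i)) F \<in> forms a"
  unfolding sub_right_def cpoly_subst_def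
proof (rule forms_sum)
  fix m assume m: "m \<in> Poly_Mapping.keys F"
  have "(\<Prod>i\<in>UNIV. Var i ^ Poly_Mapping.lookup m (Inl i)) * Const (\<Prod>i\<in>UNIV. (q $ i) ^ Poly_Mapping.lookup m (Inr i))
     \<in> forms ((\<Sum>i\<in>UNIV. 1 * Poly_Mapping.lookup m (Inl i)) + 0)"
    by (intro forms_mult forms_prod forms_power forms_Var forms_Const)
  then show "Const (Poly_Mapping.lookup F m) * (\<Prod>i\<in>UNIV. case_sum Var (\<lambda>i. Const (q $ i)) i ^ Poly_Mapping.lookup m i) \<in> forms a"
    using assms m by (intro forms_Const_mult) (simp add: biforms_def prod_sum_UNIV Const.hom_simps)
qed

text \<open>\<open>g\<close> are the forms attached to the tensor, of degree \<open>n = d - 1\<close>, and \<open>f = x \<times> g\<close>.\<close>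

locale laguerre_net =
  fixes n :: nat and g f :: "3 \<Rightarrow> 3 cpoly"
  assumes n_pos: "n > 0"
    and g_form: "\<And>i. g i \<in> forms n"
    and f_eq: "\<And>i. f i = Var (i + 1) * g (i + 2) - Var (i + 2) * g (i + 1)"
    and dim_base: "has_dim (zero_locus (range f)) 0"
begin

lemma f_form: "f i \<in> forms (n + 1)"
  unfolding f_eq using forms_mult[OF forms_Var g_form] by (intro forms_diff) (simp_all add: add.commute)

definition Z :: "point set" where "Z = zero_locus (range f)"

lemma mem_Z: "v \<noteq> 0 \<Longrightarrow> proj_pt v \<in> Z \<longleftrightarrow> evf f v = 0"
  unfolding Z_def using f_form by (subst proj_pt_zero_locus) (auto simp: vec_eq_iff)

lemma Z_P2: "Z \<subseteq> P2"
  unfolding Z_def by (rule zero_locus_P2)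

lemma finite_Z: "finite Z"
  unfolding Z_def by (rule has_dim_0_imp_finite[OF _ dim_base]) (use f_form in blast)

lemma f_nonzero: "\<exists>i. f i \<noteq> 0"
proof (rule ccontr)
  assume "\<not> ?thesis"
  then have "zero_locus {lin (axis 0 1)} \<subseteq> Z" by (auto simp: Z_def zero_locus_def)
  moreover have nz: "axis 0 1 \<noteq> (0 :: complex ^ 3)" by (simp add: axis_eq_0_iff)
  ultimately show False using infinite_line[OF nz] finite_Z finite_subset by blast
qed

text \<open>A nonconstant common factor would place a whole curve inside the finite set Z.\<close>

lemma common_divisor_f:
  assumes "\<And>i. c dvd f i"
  shows "c dvd 1"
proof (rule ccontr)
  assume nu: "\<not> c dvd 1"
  obtain i where i: "f i \<noteq> 0" using f_nonzero by blast
  obtain b where b: "f i = c * b" using assms by (auto simp: dvd_def)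
  then have "c * b \<in> forms (n + 1)" "c * b \<noteq> 0" using f_form[of i] i by simp_all
  then obtain m where m: "c \<in> forms m" using forms_factor by blast
  have "c \<noteq> 0" using b i by auto
  then have "infinite (zero_locus {c})" using infinite_zero_locus[OF m nonunit_form_degree[OF m _ nu]] by simp
  moreover have "zero_locus {c} \<subseteq> Z"
    using zero_locus_dvd[OF assms] zero_locus_P2[of "{c}"] unfolding Z_def zero_locus_def by blast
  ultimately show False using finite_Z finite_subset by blast
qed

lemma x_dot_f: "Var i * f i = - (Var (i + 1) * f (i + 1) + Var (i + 2) * f (i + 2))"
  unfolding f_eq shift_3 by (simp add: algebra_simps del: shift_3)

text \<open>Vanishing at the points of the graph over the dense set where some f_i is nonzero makes
  the pulled back polynomial zero.\<close>

lemma sub_right_f: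
  assumes "F \<in> graph_closure_forms f"
  shows "sub_right f F = 0"
proof -
  obtain i where i: "f i \<noteq> 0" using f_nonzero by blast
  show ?thesis
  proof (rule evv_zero_generic[OF i])
    fix v assume v: "evv v (f i) \<noteq> 0"
    then have v0: "v \<noteq> 0" using evv_form_zero_vec[OF f_form] by auto
    have "evf f v \<noteq> 0" using v by (auto simp: vec_eq_iff)
    then have "(proj_pt v, proj_pt (evf f v)) \<in> map_graph f" unfolding map_graph_alt using v0 by blast
    then show "evv v (sub_right f F) = 0"
      using assms unfolding graph_closure_forms_def evv_sub_right by (fastforce simp del: evf_nth)
  qed
qed

text \<open>The fibre of the graph over \<open>q\<close> lies in \<open>q \<cdot> x = q \<cdot> g = 0\<close> since \<open>x \<cdot> f = g \<cdot> f = 0\<close>.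
  Conversely, where \<open>x\<^sub>i\<close> is invertible, \<open>q \<cdot> x = 0\<close> eliminates \<open>q\<^sub>i\<close>, and what remains of
  \<open>q \<cdot> g\<close> is \<open>q\<^sub>i\<^sub>+\<^sub>1 f\<^sub>i\<^sub>+\<^sub>2 - q\<^sub>i\<^sub>+\<^sub>2 f\<^sub>i\<^sub>+\<^sub>1\<close>, where \<open>f\<^sub>i\<^sub>+\<^sub>1\<close> and \<open>f\<^sub>i\<^sub>+\<^sub>2\<close> are coprime up to a power of \<open>x\<^sub>i\<close>.\<close>

lemma Var_power_mult_fiber:
  assumes F: "F \<in> graph_closure_forms f" "F \<in> biforms a e"
  shows "\<exists>A B. Var i ^ (2 * e) * sub_right (\<lambda>j. Const (q $ j)) F = A * lin q + B * cdot q g"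
proof -
  let ?c = "\<lambda>j. Const (q $ j) :: 3 cpoly"
  \<comment> \<open>Y is the vector x_i q with its i-th entry rewritten by means of q . x = 0. It
    satisfies x . Y = 0 identically, as f does.\<close>
  define Y where "Y = (\<lambda>j. if j = i then - (?c (i + 1) * Var (i + 1) + ?c (i + 2) * Var (i + 2)) else Var i * ?c j)"
  define D where "D = ?c (i + 1) * f (i + 2) - ?c (i + 2) * f (i + 1)"
  note neq = shift_3_neq[of i] shift_3_neq[of i, symmetric]
  have Y: "Y i = - (?c (i + 1) * Var (i + 1) + ?c (i + 2) * Var (i + 2))"
    "Y (i + 1) = Var i * ?c (i + 1)" "Y (i + 2) = Var i * ?c (i + 2)"
    using neq by (simp_all add: Y_def)
  have all: "(\<forall>j. R j) \<longleftrightarrow> R i \<and> R (i + 1) \<and> R (i + 2)" for R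
    using UNIV_3_shift[of i] by (metis UNIV_I empty_iff insertE)
  have xf: "Var i * f i = - (Var (i + 1) * f (i + 1) + Var (i + 2) * f (i + 2))" by (rule x_dot_f)
  have scale: "sub_right (\<lambda>j. c * G j) F = c ^ e * sub_right G F" for c G
    unfolding sub_right_def by (rule cpoly_subst_biscale[OF F(2)])
  have cong: "D' dvd sub_right G F - sub_right H F" if "\<forall>j. D' dvd G j - H j" for D' G H
    unfolding sub_right_def by (rule cpoly_subst_cong_dvd) (use that in \<open>auto split: sum.split\<close>)
  have 1: "lin q dvd Var i ^ e * sub_right ?c F - sub_right Y F"
    unfolding scale[symmetric]
  proof (rule cong)
    have "Var i * ?c i - Y i = lin q" unfolding lin_shift[of q i] Y by (simp add: algebra_simps)
    then show "\<forall>j. lin q dvd Var i * ?c j - Y j" unfolding all Y by simp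
  qed
  have z: "sub_right (\<lambda>j. (?c k * Var i) * f j) F = 0" for k
    unfolding scale using sub_right_f[OF F(1)] by simp
  \<comment> \<open>Modulo the minor D, the vector f_(i+1) Y is congruent to q_(i+1) x_i f, and F
    vanishes on multiples of f.\<close>
  have 2: "D dvd f (i + 1) ^ e * sub_right Y F"
  proof -
    have "D dvd sub_right (\<lambda>j. f (i + 1) * Y j) F - sub_right (\<lambda>j. (?c (i + 1) * Var i) * f j) F"
    proof (rule cong)
      have e1: "f (i + 1) * Y i - (?c (i + 1) * Var i) * f i = Var (i + 2) * D"
        unfolding Y D_def mult.assoc xf by (simp add: algebra_simps)
      have e2: "f (i + 1) * Y (i + 1) - (?c (i + 1) * Var i) * f (i + 1) = 0"
        unfolding Y by (simp add: algebra_simps)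
      have e3: "f (i + 1) * Y (i + 2) - (?c (i + 1) * Var i) * f (i + 2) = - Var i * D"
        unfolding Y D_def by (simp add: algebra_simps)
      show "\<forall>j. D dvd f (i + 1) * Y j - (?c (i + 1) * Var i) * f j" unfolding all e1 e2 e3 by simp
    qed
    then show ?thesis unfolding z scale by simp
  qed
  have 3: "D dvd f (i + 2) ^ e * sub_right Y F"
  proof -
    have "D dvd sub_right (\<lambda>j. f (i + 2) * Y j) F - sub_right (\<lambda>j. (?c (i + 2) * Var i) * f j) F"
    proof (rule cong)
      have e1: "f (i + 2) * Y i - (?c (i + 2) * Var i) * f i = - Var (i + 1) * D"
        unfolding Y D_def mult.assoc xf by (simp add: algebra_simps)
      have e2: "f (i + 2) * Y (i + 2) - (?c (i + 2) * Var i) * f (i + 2) = 0"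
        unfolding Y by (simp add: algebra_simps)
      have e3: "f (i + 2) * Y (i + 1) - (?c (i + 2) * Var i) * f (i + 1) = Var i * D"
        unfolding Y D_def by (simp add: algebra_simps)
      show "\<forall>j. D dvd f (i + 2) * Y j - (?c (i + 2) * Var i) * f j" unfolding all e1 e2 e3 by simp
    qed
    then show ?thesis unfolding z scale by simp
  qed
  \<comment> \<open>A common divisor of f_(i+1) and f_(i+2) divides x_i f_i because x . f = 0. As
    the three f_j have no common factor, the gcd of the two divides x_i.\<close>
  have 4: "D dvd Var i ^ e * sub_right Y F"
  proof (rule cpoly_dvd_power_mult[OF 2 3, of "f i"])
    fix c assume "c dvd f (i + 1)" "c dvd f (i + 2)" "c dvd f i"
    then have "\<forall>j. c dvd f j" unfolding all by blast
    then show "c dvd 1" using common_divisor_f by blast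
  next
    fix c assume "c dvd f (i + 1)" "c dvd f (i + 2)"
    then show "c dvd Var i * f i" unfolding xf by simp
  qed
  \<comment> \<open>D is the i-th entry of the cross product of q with f = x \<times> g; this is its
    expansion as a vector triple product.\<close>
  have D: "D = Var i * cdot q g - g i * lin q"
    unfolding D_def f_eq shift_3 cdot_shift[of q g i] lin_shift[of q i] by (simp add: algebra_simps del: shift_3)
  obtain A where A: "Var i ^ e * sub_right ?c F - sub_right Y F = lin q * A" using 1 by (auto simp: dvd_def)
  obtain B where B: "Var i ^ e * sub_right Y F = D * B" using 4 by (auto simp: dvd_def)
  \<comment> \<open>One factor \<open>Var i ^ e\<close> pays for the passage from x_i q to Y, the
    other for the cancellation of the powers of f_(i+1) and f_(i+2).\<close>
  have "Var i ^ (2 * e) * sub_right ?c F = Var i ^ e * (Var i ^ e * sub_right ?c F - sub_right Y F) + Var i ^ e * sub_right Y F"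
    by (simp add: mult_2 power_add right_diff_distrib mult.assoc)
  also have "\<dots> = (Var i ^ e * A - g i * B) * lin q + (Var i * B) * cdot q g"
    unfolding A B D by (simp add: algebra_simps)
  finally show ?thesis by blast
qed

text \<open>On the line the generator \<open>lin q\<close> disappears, and divisibility holds up to
  a power of x_i for both indices i other than k. These two variables are coprime, so the powers
  cancel.\<close>

lemma reduce_fiber_dvd:
  assumes F: "F \<in> graph_closure_forms f" "F \<in> biforms a e" and k: "q $ k \<noteq> 0"
  shows "reduce q k (cdot q g) dvd reduce q k (sub_right (\<lambda>j. Const (q $ j)) F)"
proof -
  let ?P = "reduce q k (sub_right (\<lambda>j. Const (q $ j)) F)"
  have dvd: "reduce q k (cdot q g) dvd Var i ^ (2 * e) * ?P" if "i \<noteq> k" for i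
  proof -
    obtain A B where "Var i ^ (2 * e) * sub_right (\<lambda>j. Const (q $ j)) F = A * lin q + B * cdot q g"
      using Var_power_mult_fiber[OF F] by blast
    then have "reduce q k (Var i ^ (2 * e) * sub_right (\<lambda>j. Const (q $ j)) F) = reduce q k (A * lin q + B * cdot q g)"
      by simp
    then have "Var i ^ (2 * e) * ?P = reduce q k B * reduce q k (cdot q g)"
      using that by (simp add: reduce.hom_simps reduce_lin[OF k] reduce_Var elim_var_def)
    then show ?thesis by simp
  qed
  have "reduce q k (cdot q g) dvd 1 ^ (2 * e) * ?P"
    by (rule cpoly_dvd_power_mult[OF dvd[of "k + 1"] dvd[of "k + 2"], of 1])
      (use shift_3_neq[of k] common_divisor_Var in \<open>auto simp del: shift_3\<close>)
  then show ?thesis by simp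
qed

lemma fiber_form_mem:
  assumes F: "F \<in> graph_closure_forms f" and q: "q \<noteq> 0"
  shows "sub_right (\<lambda>j. Const (q $ j)) F \<in> ideal_gen {lin q, cdot q g}"
proof -
  let ?P = "sub_right (\<lambda>j. Const (q $ j)) F"
  obtain k where k: "q $ k \<noteq> 0" using vec_nonzero_component[OF q] by blast
  obtain a e where "F \<in> biforms a e" using F unfolding graph_closure_forms_def by blast
  from reduce_fiber_dvd[OF F this k] obtain C where C: "reduce q k ?P = reduce q k (cdot q g) * C" by (auto simp: dvd_def)
  obtain A where A: "?P - reduce q k ?P = lin q * A" using lin_dvd_diff_reduce[OF k, of ?P] by (auto simp: dvd_def)
  obtain B where B: "cdot q g - reduce q k (cdot q g) = lin q * B" using lin_dvd_diff_reduce[OF k, of "cdot q g"] by (auto simp: dvd_def)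
  have "?P = (?P - reduce q k ?P) + (cdot q g - (cdot q g - reduce q k (cdot q g))) * C" using C by simp
  also have "\<dots> = (A - B * C) * lin q + C * cdot q g" unfolding A B by (simp add: algebra_simps)
  finally show ?thesis unfolding ideal_gen_pair by blast
qed

text \<open>The restriction is a multiple of the restriction of q . g. A nonzero multiple would have
  degree at least n. It holds for every nonzero q, also over contracted lines, and is the source of
  both nonvanishing arguments below: that of \<open>ext\<close> and the independence of powers of
  \<open>tt\<close>.\<close>

lemma reduce_low_degree:
  assumes F: "F \<in> graph_closure_forms f" "F \<in> biforms a e" and k: "q $ k \<noteq> 0" and a: "a < n"
  shows "reduce q k (sub_right (\<lambda>j. Const (q $ j)) F) = 0"
proof (rule ccontr)
  let ?P = "reduce q k (sub_right (\<lambda>j. Const (q $ j)) F)"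
  assume nz: "?P \<noteq> 0"
  obtain C where C: "?P = reduce q k (cdot q g) * C" using reduce_fiber_dvd[OF F k] by (auto simp: dvd_def)
  have "?P \<in> forms a" by (rule reduce_form[OF sub_right_form[OF F(2)]])
  then have "reduce q k (cdot q g) * C \<in> forms a" "reduce q k (cdot q g) * C \<noteq> 0" using nz unfolding C by auto
  then obtain b c where b: "reduce q k (cdot q g) \<in> forms b" and bc: "b + c = a"
    using forms_factor by blast
  have "reduce q k (cdot q g) \<in> forms n" by (intro reduce_form cdot_form g_form)
  moreover have "reduce q k (cdot q g) \<noteq> 0" using nz C by auto
  ultimately have "b = n" using forms_degree_unique b by blast
  then show False using a bc by simp
qed

end

section \<open>Membership in the equations of the graph, restriction to a line at points, and cross
  products\<close>

lemma cpoly_eval_biscale: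
  assumes "F \<in> biforms a b"
  shows "cpoly_eval (case_sum (\<lambda>i. c * u i) (\<lambda>i. c' * v i)) F = c ^ a * c' ^ b * cpoly_eval (case_sum u v) F"
proof -
  have *: "(\<Prod>i\<in>UNIV. (case_sum (\<lambda>i. c * u i) (\<lambda>i. c' * v i) i) ^ Poly_Mapping.lookup m i) = c ^ a * c' ^ b * (\<Prod>i\<in>UNIV. (case_sum u v i) ^ Poly_Mapping.lookup m i)"
    if "m \<in> Poly_Mapping.keys F" for m
    using assms that by (simp add: prod_sum_UNIV power_mult_distrib prod.distrib biforms_def mult_ac flip: power_sum)
  show ?thesis
    unfolding cpoly_eval_def
  proof (subst sum_distrib_left, rule sum.cong[OF refl])
    fix m assume m: "m \<in> Poly_Mapping.keys F"
    show "Poly_Mapping.lookup F m * (\<Prod>i\<in>UNIV. (case_sum (\<lambda>i. c * u i) (\<lambda>i. c' * v i) i) ^ Poly_Mapping.lookup m i) =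
      c ^ a * c' ^ b * (Poly_Mapping.lookup F m * (\<Prod>i\<in>UNIV. (case_sum u v i) ^ Poly_Mapping.lookup m i))"
      unfolding *[OF m] by (rule mult.left_commute)
  qed
qed

lemma mem_map_graph: "(P, Q) \<in> map_graph f \<longleftrightarrow> (\<exists>v. v \<noteq> 0 \<and> evf f v \<noteq> 0 \<and> P = proj_pt v \<and> Q = proj_pt (evf f v))"
  by (auto simp: map_graph_alt)

lemma mem_image_map_graph: "Q \<in> snd ` map_graph f \<longleftrightarrow> (\<exists>v. v \<noteq> 0 \<and> evf f v \<noteq> 0 \<and> Q = proj_pt (evf f v))"
  unfolding Range_snd[symmetric] Range_iff mem_map_graph by blast

lemma graph_closure_formsI:
  assumes F: "F \<in> biforms a b"
    and van: "\<And>v. v \<noteq> 0 \<Longrightarrow> evf f v \<noteq> 0 \<Longrightarrow> cpoly_eval (case_sum (($) v) (($) (evf f v))) F = 0"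
  shows "F \<in> graph_closure_forms f"
proof -
  have "cpoly_eval (case_sum (($) u) (($) w)) F = 0"
    if PQ: "(P, Q) \<in> map_graph f" and u: "u \<in> P" and w: "w \<in> Q" for P Q u w
  proof -
    obtain v where v: "v \<noteq> 0" "evf f v \<noteq> 0" "P = proj_pt v" "Q = proj_pt (evf f v)"
      using PQ unfolding mem_map_graph by blast
    obtain c where c: "u = c *s v" using u unfolding v(3) proj_pt_def by blast
    obtain c' where c': "w = c' *s evf f v" using w unfolding v(4) proj_pt_def by blast
    have "($) u = (\<lambda>i. c * v $ i)" "($) w = (\<lambda>i. c' * evf f v $ i)" unfolding c c' by (rule ext, simp)+
    then show ?thesis using cpoly_eval_biscale[OF F, of c "($) v" c' "($) (evf f v)"] van[OF v(1,2)] by (simp only: mult_zero_right)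
  qed
  then show ?thesis using F unfolding graph_closure_forms_def by blast
qed

lemma reduce_eq_0_iff_vanish:
  assumes k: "q $ k \<noteq> 0"
  shows "reduce q k F = 0 \<longleftrightarrow> (\<forall>v. dotp q v = 0 \<longrightarrow> evv v F = 0)"
proof
  assume "reduce q k F = 0"
  then obtain A where "F = lin q * A" unfolding reduce_eq_0_iff[OF k] dvd_def by blast
  then show "\<forall>v. dotp q v = 0 \<longrightarrow> evv v F = 0" by (simp add: ev.hom_mult)
next
  assume *: "\<forall>v. dotp q v = 0 \<longrightarrow> evv v F = 0"
  show "reduce q k F = 0"
  proof (rule evv_zero_imp_zero)
    fix v
    \<comment> \<open>w is the projection of v to the plane q . x = 0 along the k-th axis;
      evaluating the reduction of G at v is evaluating G at w.\<close>
    define w where "w = (\<chi> i. evv v (elim_var q k i))"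
    have w: "evv v (reduce q k G) = evv w G" for G
    proof -
      have "($) w = (\<lambda>i. evv v (elim_var q k i))" by (rule ext) (simp add: w_def)
      then show ?thesis by (simp add: reduce_def cpoly_eval_subst)
    qed
    have "dotp q w = 0" using w[of "lin q"] reduce_lin[OF k] by simp
    then show "evv v (reduce q k F) = 0" using * w by simp
  qed
qed

definition cross :: "complex ^ 3 \<Rightarrow> complex ^ 3 \<Rightarrow> complex ^ 3" where
  "cross v w = (\<chi> i. v $ (i + 1) * w $ (i + 2) - v $ (i + 2) * w $ (i + 1))"

lemma cross_nth: "cross v w $ i = v $ (i + 1) * w $ (i + 2) - v $ (i + 2) * w $ (i + 1)"
  by (simp add: cross_def)

lemma three_simps: "(0::3) + 1 = 1" "(0::3) + 2 = 2" "(1::3) + 1 = 2" "(1::3) + 2 = 0" "(2::3) + 1 = 0" "(2::3) + 2 = 1"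
  by simp_all

lemma cross_components: "cross v w $ 0 = v $ 1 * w $ 2 - v $ 2 * w $ 1"
  "cross v w $ 1 = v $ 2 * w $ 0 - v $ 0 * w $ 2"
  "cross v w $ 2 = v $ 0 * w $ 1 - v $ 1 * w $ 0"
  unfolding cross_nth three_simps by (rule refl)+

lemma dotp_3: "dotp v w = v $ 0 * w $ 0 + v $ 1 * w $ 1 + v $ 2 * w $ 2"
  unfolding dotp_def by (rule sum_3)

lemma all_3: "(\<forall>i::3. R i) \<longleftrightarrow> R 0 \<and> R 1 \<and> R 2"
  by (metis cases_3)

lemma dotp_cross_left: "dotp (cross v w) v = 0"
  and dotp_cross_right: "dotp (cross v w) w = 0"
  unfolding dotp_3 cross_components by (simp_all add: algebra_simps)

text \<open>Each two by two minor formed from \<open>cross v w\<close> and q with cyclically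
  adjacent indices is a combination of q . v and q . w.\<close>

lemma cross_parallel:
  assumes "dotp q v = 0" "dotp q w = 0"
  shows "cross v w $ i * q $ j = cross v w $ j * q $ i"
proof -
  have e: "cross v w $ i * q $ (i + 1) - cross v w $ (i + 1) * q $ i = w $ (i + 2) * dotp q v - v $ (i + 2) * dotp q w" for i
    unfolding cross_nth shift_3 dotp_def sum_3_shift[of _ i] by (simp add: algebra_simps del: shift_3)
  have n: "cross v w $ i * q $ (i + 1) = cross v w $ (i + 1) * q $ i" for i
    using e[of i] assms by simp
  have "j \<in> {i, i + 1, i + 2}" using UNIV_3_shift[of i] by blast
  then show ?thesis using n[of i] n[of "i + 2"] by (elim insertE) (simp_all del: n)
qed

lemma cross_eq_scale:
  assumes "dotp q v = 0" "dotp q w = 0" "q $ j \<noteq> 0"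
  shows "cross v w = (cross v w $ j / q $ j) *s q"
  unfolding vec_eq_iff using cross_parallel[OF assms(1,2), of _ j] assms(3) by (simp add: field_simps)

context laguerre_net
begin

lemma evf_f: "evf f v = cross v (evf g v)"
proof -
  have "evf f v $ i = cross v (evf g v) $ i" for i
    by (simp add: f_eq cross_nth ev.hom_simps)
  then show ?thesis unfolding vec_eq_iff by blast
qed

lemma dotp_f_x: "dotp (evf f v) v = 0" and dotp_f_g: "dotp (evf f v) (evf g v) = 0"
  unfolding evf_f by (rule dotp_cross_left, rule dotp_cross_right)

text \<open>f(v) is the cross product of v and g(v), both orthogonal to q. So a point of the scheme
  q . x = q . g = 0 is a base point or is mapped to q.\<close>

lemma evf_f_on_line:
  assumes "dotp q v = 0" "dotp q (evf g v) = 0" "q $ j \<noteq> 0"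
  shows "evf f v = (evv v (f j) / q $ j) *s q"
  using cross_eq_scale[OF assms] unfolding evf_f[symmetric] by simp

section \<open>The fibres\<close>

lemma lin_graph_form:
  obtains L where "L \<in> graph_closure_forms f" "\<forall>q. sub_right (\<lambda>j. Const (q $ j)) L = lin q"
proof
  let ?L = "\<Sum>j\<in>UNIV. Var (Inr j) * Var (Inl j) :: (3 + 3) cpoly"
  have "?L \<in> biforms 1 1"
    using biforms_mult[OF biforms_VarR biforms_VarL] by (intro biforms_sum) simp
  then show "?L \<in> graph_closure_forms f"
  proof (rule graph_closure_formsI)
    fix v
    have "cpoly_eval (case_sum (($) v) (($) (evf f v))) ?L = dotp (evf f v) v"
      by (simp add: dotp_def ev.hom_simps)
    then show "cpoly_eval (case_sum (($) v) (($) (evf f v))) ?L = 0" by (simp only: dotp_f_x)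
  qed
  show "\<forall>q. sub_right (\<lambda>j. Const (q $ j)) ?L = lin q"
    by (simp add: sub_right_def lin_def sb.hom_simps)
qed

lemma cdot_graph_form:
  obtains G where "G \<in> graph_closure_forms f" "\<forall>q. sub_right (\<lambda>j. Const (q $ j)) G = cdot q g"
proof
  let ?G = "\<Sum>j\<in>UNIV. Var (Inr j) * cpoly_subst (\<lambda>i. Var (Inl i)) (g j) :: (3 + 3) cpoly"
  have b: "cpoly_subst (\<lambda>i. Var (Inl i)) (g j) \<in> biforms (1 * n) (0 * n)" for j
    by (rule cpoly_subst_biforms[OF g_form biforms_VarL])
  have "Var (Inr j) * cpoly_subst (\<lambda>i. Var (Inl i)) (g j) \<in> biforms n 1" for j
    using biforms_mult[OF biforms_VarR b, of j j] by simp
  then have "?G \<in> biforms n 1" by (intro biforms_sum)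
  then show "?G \<in> graph_closure_forms f"
  proof (rule graph_closure_formsI)
    fix v
    have "cpoly_eval (case_sum (($) v) (($) (evf f v))) ?G = dotp (evf f v) (evf g v)"
      by (simp add: dotp_def ev.hom_simps cpoly_eval_subst)
    then show "cpoly_eval (case_sum (($) v) (($) (evf f v))) ?G = 0" by (simp only: dotp_f_g)
  qed
  show "\<forall>q. sub_right (\<lambda>j. Const (q $ j)) ?G = cdot q g"
    by (simp add: sub_right_def cdot_def sb.hom_simps cpoly_subst_subst cpoly_subst_Var_id)
qed

lemma fiber_ideal_eq:
  assumes q: "q \<noteq> 0"
  shows "fiber_ideal f (proj_pt q) = ideal_gen {lin q, cdot q g}"
proof
  have "sub_right (\<lambda>j. Const (v $ j)) F \<in> ideal_gen {lin q, cdot q g}"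
    if F: "F \<in> graph_closure_forms f" and v: "v \<in> proj_pt q" for F v
  proof -
    obtain c where c: "v = c *s q" "c \<noteq> 0" using v unfolding proj_pt_def by blast
    have "v \<noteq> 0" using c q by simp
    from fiber_form_mem[OF F this] have m: "sub_right (\<lambda>j. Const (v $ j)) F \<in> ideal_gen {lin v, cdot v g}" .
    have "lin v \<in> ideal_gen {lin q, cdot q g}" "cdot v g \<in> ideal_gen {lin q, cdot q g}"
      unfolding ideal_gen_pair lin_eq_cdot c(1) cdot_scale
      by (rule exI[of _ "Const c"], rule exI[of _ 0], simp, rule exI[of _ 0], rule exI[of _ "Const c"], simp)
    then have "ideal_gen {lin v, cdot v g} \<subseteq> ideal_gen {lin q, cdot q g}" by (intro ideal_gen_mono_span) simp
    then show ?thesis using m by blast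
  qed
  then show "fiber_ideal f (proj_pt q) \<subseteq> ideal_gen {lin q, cdot q g}"
    unfolding fiber_ideal_def by (intro ideal_gen_mono_span) (auto simp: sub_right_def)
  have gen: "sub_right (\<lambda>j. Const (q $ j)) F \<in> fiber_ideal f (proj_pt q)" if F: "F \<in> graph_closure_forms f" for F
    unfolding fiber_ideal_def sub_right_def
    by (rule subsetD[OF ideal_gen_superset]) (use F proj_pt_self in blast)
  obtain L where L: "L \<in> graph_closure_forms f" "\<forall>q. sub_right (\<lambda>j. Const (q $ j)) L = lin q"
    by (rule lin_graph_form)
  obtain G where G: "G \<in> graph_closure_forms f" "\<forall>q. sub_right (\<lambda>j. Const (q $ j)) G = cdot q g"
    by (rule cdot_graph_form)
  have "lin q \<in> fiber_ideal f (proj_pt q)" "cdot q g \<in> fiber_ideal f (proj_pt q)"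
    using gen[OF L(1)] gen[OF G(1)] unfolding L(2)[rule_format] G(2)[rule_format] by blast+
  then show "ideal_gen {lin q, cdot q g} \<subseteq> fiber_ideal f (proj_pt q)"
    unfolding fiber_ideal_def by (intro ideal_gen_mono_span) simp
qed

lemma zero_locus_fiber: "q \<noteq> 0 \<Longrightarrow> zero_locus (fiber_ideal f (proj_pt q)) = zero_locus {lin q, cdot q g}"
  by (simp add: fiber_ideal_eq zero_locus_ideal_gen)

lemma cdot_g_form: "cdot q g \<in> forms n"
  by (intro cdot_form g_form)

lemma proj_pt_mem_fiber:
  assumes "v \<noteq> 0"
  shows "proj_pt v \<in> zero_locus {lin q, cdot q g} \<longleftrightarrow> dotp q v = 0 \<and> dotp q (evf g v) = 0"
proof -
  have "proj_pt v \<in> zero_locus {lin q, cdot q g} \<longleftrightarrow> proj_pt v \<in> zero_locus {lin q} \<and> proj_pt v \<in> zero_locus {cdot q g}"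
    using zero_locus_insert[of "lin q" "{cdot q g}"] by blast
  then show ?thesis
    using proj_pt_zero_locus_single[OF assms cdot_g_form] proj_pt_mem_line[OF assms] by simp
qed

lemma finite_fiber_iff:
  assumes q: "q \<noteq> 0"
  shows "finite_fiber f (proj_pt q) \<longleftrightarrow> \<not> (\<forall>v. dotp q v = 0 \<longrightarrow> dotp q (evf g v) = 0)"
proof
  assume fin: "finite_fiber f (proj_pt q)"
  show "\<not> (\<forall>v. dotp q v = 0 \<longrightarrow> dotp q (evf g v) = 0)"
  proof
    assume *: "\<forall>v. dotp q v = 0 \<longrightarrow> dotp q (evf g v) = 0"
    have "zero_locus {lin q} \<subseteq> zero_locus {lin q, cdot q g}"
    proof
      fix P assume P: "P \<in> zero_locus {lin q}"
      then obtain v where v: "v \<noteq> 0" "P = proj_pt v" using zero_locus_P2 P2_cases by blast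
      then show "P \<in> zero_locus {lin q, cdot q g}" using P * by (simp add: proj_pt_mem_fiber)
    qed
    then show False
      using fin infinite_line[OF q] finite_subset unfolding finite_fiber_def zero_locus_fiber[OF q] by blast
  qed
next
  assume *: "\<not> (\<forall>v. dotp q v = 0 \<longrightarrow> dotp q (evf g v) = 0)"
  show "finite_fiber f (proj_pt q)"
    unfolding finite_fiber_def zero_locus_fiber[OF q]
  proof (rule ccontr)
    assume "infinite (zero_locus {lin q, cdot q g})"
    from line_infinite_vanish[OF q cdot_g_form this order_refl] show False using * by simp
  qed
qed

text \<open>Let c be the restriction of q . g. In degree m + 1, all forms and the forms in the ideal
  have the same summand of multiples of \<open>lin q\<close>. The other summands are the binary
  forms of degree m + 1 and those divisible by c, of dimensions m + 2 and m + 2 - n. The difference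
  n is the degree.\<close>

lemma fiber_zero_dim:
  assumes q: "q \<noteq> 0" and fin: "finite_fiber f (proj_pt q)"
  shows "zero_dim_scheme_of_degree (fiber_ideal f (proj_pt q)) n"
proof -
  obtain k where k: "q $ k \<noteq> 0" using vec_nonzero_component[OF q] by blast
  define c where "c = reduce q k (cdot q g)"
  have c0: "c \<noteq> 0"
    using fin unfolding finite_fiber_iff[OF q] c_def reduce_eq_0_iff_vanish[OF k] by simp
  have cn: "c \<in> forms n" unfolding c_def by (intro reduce_form cdot_g_form)
  have cfree: "c \<in> free_of k" unfolding c_def by (rule reduce_free)
  obtain B0 where B0: "cdot q g - c = lin q * B0"
    using lin_dvd_diff_reduce[OF k, of "cdot q g"] unfolding c_def dvd_def by blast
  have l0: "lin q \<noteq> 0" by (rule lin_nonzero[OF q])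
  have "cdim (forms (Suc m) :: 3 cpoly set) = cdim (ideal_gen {lin q, cdot q g} \<inter> forms (Suc m)) + n" if m: "n \<le> m" for m
  proof -
    let ?V = "(*) (lin q) ` forms m" and ?W = "(*) c ` binary_forms k (Suc m - n)"
    have eq: "ideal_gen {lin q, cdot q g} \<inter> forms (Suc m) = {x + y | x y. x \<in> ?V \<and> y \<in> ?W}"
    proof (intro equalityI subsetI)
      fix F assume F: "F \<in> ideal_gen {lin q, cdot q g} \<inter> forms (Suc m)"
      then obtain A B where AB: "F = A * lin q + B * cdot q g" unfolding Int_iff ideal_gen_pair by blast
      have F': "F \<in> forms (Suc m)" using F by blast
      have r: "reduce q k F = c * reduce q k B"
        unfolding AB by (simp add: reduce.hom_simps reduce_lin[OF k] c_def)
      have "c * reduce q k B \<in> forms (Suc m)" unfolding r[symmetric] by (rule reduce_form[OF F'])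
      then have "reduce q k B \<in> forms (Suc m - n)" using forms_cofactor[OF _ cn c0] m by simp
      then have "reduce q k F \<in> ?W" unfolding r binary_forms_def using reduce_free by blast
      moreover obtain A' where "F - reduce q k F = lin q * A'" "A' \<in> forms m"
        using forms_decomp_lin[OF k F'] by auto
      ultimately have "F - reduce q k F \<in> ?V" "reduce q k F \<in> ?W" by auto
      moreover have "F = (F - reduce q k F) + reduce q k F" by simp
      ultimately show "F \<in> {x + y | x y. x \<in> ?V \<and> y \<in> ?W}" by blast
    next
      fix F assume "F \<in> {x + y | x y. x \<in> ?V \<and> y \<in> ?W}"
      then obtain A b where F: "F = lin q * A + c * b" and A: "A \<in> forms m" and b: "b \<in> binary_forms k (Suc m - n)"
        by blast
      have "F = lin q * A + (cdot q g - (cdot q g - c)) * b" using F by simp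
      also have "\<dots> = (A - B0 * b) * lin q + b * cdot q g" unfolding B0 by (simp add: algebra_simps)
      finally have "F \<in> ideal_gen {lin q, cdot q g}" unfolding ideal_gen_pair by blast
      moreover have "lin q * A \<in> forms (Suc m)" using forms_mult[OF lin_form A] by simp
      moreover have "c * b \<in> forms (Suc m)" using forms_mult[OF cn, of b "Suc m - n"] b m by (simp add: binary_forms_def)
      ultimately show "F \<in> ideal_gen {lin q, cdot q g} \<inter> forms (Suc m)" unfolding F using forms_add by blast
    qed
    have W: "?W \<subseteq> binary_forms k (Suc m)"
      using forms_mult[OF cn, of _ "Suc m - n"] free_of_mult[OF cfree] m by (auto simp: binary_forms_def)
    have fV: "cs.fd_subspace ?V" "cs.dim ?V = cs.dim (forms m :: 3 cpoly set)" by (rule fd_mult_image[OF fd_forms l0])+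
    have fW: "cs.fd_subspace ?W" "cs.dim ?W = cs.dim (binary_forms k (Suc m - n))" by (rule fd_mult_image[OF fd_binary_forms c0])+
    have "?V \<inter> ?W \<subseteq> {0}"
      using Int_mono[OF order_refl W] lin_mult_inter_binary[OF k] by (rule subset_trans)
    from cs.dim_direct_sum[OF fV(1) fW(1) this]
    have 1: "cs.dim (ideal_gen {lin q, cdot q g} \<inter> forms (Suc m)) = cs.dim (forms m :: 3 cpoly set) + (Suc m - n + 1)"
      unfolding eq fV(2) fW(2) dim_binary_forms .
    from cs.dim_direct_sum[OF fV(1) fd_binary_forms[of k "Suc m"] lin_mult_inter_binary[OF k]]
    have 2: "cs.dim (forms (Suc m) :: 3 cpoly set) = cs.dim (forms m :: 3 cpoly set) + (Suc m + 1)"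
      unfolding forms_Suc_decomp[OF k, of m, symmetric] fV(2) dim_binary_forms .
    show ?thesis unfolding cdim_eq 1 2 using m by simp
  qed
  then have "cdim (forms m :: 3 cpoly set) = cdim (ideal_gen {lin q, cdot q g} \<inter> forms m) + n" if "m \<ge> Suc n" for m
    using that by (cases m) auto
  then have ev: "\<forall>\<^sub>F m in sequentially. cdim (forms m :: 3 cpoly set) = cdim (ideal_gen {lin q, cdot q g} \<inter> forms m) + n"
    unfolding eventually_sequentially by blast
  \<comment> \<open>The empty set does not satisfy \<open>has_dim\<close> with 0, so a point of the
    fibre has to be exhibited; this is where n > 0 enters.\<close>
  obtain v where v: "v \<noteq> 0" "dotp q v = 0" "evv v (cdot q g) = 0"
    using line_meets[OF cdot_g_form n_pos q] by blast
  have "proj_pt v \<in> zero_locus {lin q, cdot q g}"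
    using v by (simp add: proj_pt_mem_fiber)
  then have "has_dim (zero_locus {lin q, cdot q g}) 0"
    using fin unfolding finite_fiber_def zero_locus_fiber[OF q]
    by (intro has_dim_0_if_finite zero_locus_P2) auto
  then show ?thesis
    unfolding zero_dim_scheme_of_degree_def fiber_ideal_eq[OF q] zero_locus_ideal_gen using ev by blast
qed

lemma fiber_in_line:
  assumes q: "q \<noteq> 0"
  shows "scheme_contained_in_line (fiber_ideal f (proj_pt q))"
proof -
  have "F \<in> saturation (ideal_gen {lin q, cdot q g})" if "F \<in> ideal_gen {lin q}" for F
  proof -
    have "F \<in> ideal_gen {lin q, 0}"
      using that ideal_gen_mono_span[of "{lin q}" "{lin q, 0}"] ideal_gen_superset[of "{lin q, 0}"] by auto
    then obtain A where "F = A * lin q" unfolding ideal_gen_pair by auto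
    then have "G * F = (G * A) * lin q + 0 * cdot q g" for G by (simp add: mult.assoc)
    then have "\<forall>G\<in>forms 0. G * F \<in> ideal_gen {lin q, cdot q g}" unfolding ideal_gen_pair by blast
    then show ?thesis unfolding saturation_def by blast
  qed
  then show ?thesis
    unfolding scheme_contained_in_line_def subscheme_of_def fiber_ideal_eq[OF q]
    using lin_form lin_nonzero[OF q] by blast
qed

section \<open>Dominance and contracted curves\<close>

text \<open>A form on the dual plane: it vanishes at q exactly when the line q . x = 0 passes
  through a base point.\<close>

definition Zprod :: "3 cpoly" where
  "Zprod = (\<Prod>P\<in>Z. lin (rep P))"

lemma Zprod_form: "Zprod \<in> forms (card Z)"
  unfolding Zprod_def using forms_prod[of Z "\<lambda>P. lin (rep P)" "\<lambda>_. 1"] lin_form by simp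

lemma Zprod_nonzero: "Zprod \<noteq> 0"
  unfolding Zprod_def using finite_Z lin_nonzero[OF rep_nonzero] Z_P2 by (auto simp: prod_zero_iff)

lemma Zprod_avoids:
  assumes "evv q Zprod \<noteq> 0" "v \<noteq> 0" "dotp q v = 0"
  shows "evf f v \<noteq> 0"
proof
  assume "evf f v = 0"
  then have P: "proj_pt v \<in> Z" using mem_Z assms(2) by blast
  then have "proj_pt (rep (proj_pt v)) = proj_pt v" using proj_pt_rep Z_P2 by blast
  then obtain c where c: "v = c *s rep (proj_pt v)" unfolding proj_pt_eq_iff by blast
  have "c \<noteq> 0" using c assms(2) by auto
  have "evv q (lin (rep (proj_pt v))) \<noteq> 0"
    using assms(1) P finite_Z unfolding Zprod_def ev.hom_prod by (auto simp: prod_zero_iff)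
  then have "dotp q (rep (proj_pt v)) \<noteq> 0" by (simp add: dotp_commute)
  moreover have "dotp q v = c * dotp q (rep (proj_pt v))" by (subst c) simp
  ultimately show False using assms(3) \<open>c \<noteq> 0\<close> by simp
qed

text \<open>The line q . x = 0 meets the curve q . g = 0. The meeting point v is not a base point,
  so f(v) is a nonzero multiple of q.\<close>

lemma mem_image_generic:
  assumes q: "q \<noteq> 0" "evv q Zprod \<noteq> 0"
  shows "proj_pt q \<in> snd ` map_graph f"
proof -
  obtain j where j: "q $ j \<noteq> 0" using vec_nonzero_component[OF q(1)] by blast
  obtain v where v: "v \<noteq> 0" "dotp q v = 0" "evv v (cdot q g) = 0"
    using line_meets[OF cdot_g_form n_pos q(1)] by blast
  have nz: "evf f v \<noteq> 0" by (rule Zprod_avoids[OF q(2) v(1,2)])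
  define c where "c = evv v (f j) / q $ j"
  have c: "evf f v = c *s q" unfolding c_def using v(2,3) by (intro evf_f_on_line[OF _ _ j]) simp_all
  have "c \<noteq> 0" using nz c by auto
  then have "proj_pt q = proj_pt (evf f v)" unfolding proj_pt_eq_iff using c by blast
  then show ?thesis unfolding mem_image_map_graph using v(1) nz by blast
qed

text \<open>The image contains the dense set of all q whose line avoids the base points.\<close>

lemma form_zero_if_vanishes_on_image:
  assumes "F \<in> forms m" "\<And>v. v \<noteq> 0 \<Longrightarrow> evf f v \<noteq> 0 \<Longrightarrow> evv (evf f v) F = 0"
  shows "F = 0"
proof -
  \<comment> \<open>The extra linear factor vanishes at the zero vector and so guarantees that q is
    nonzero.\<close>
  have nz: "lin (axis 0 1) * Zprod \<noteq> 0" using Zprod_nonzero lin_nonzero[of "axis 0 1"] by (simp add: axis_eq_0_iff)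
  show ?thesis
  proof (rule evv_zero_generic[OF nz])
    fix q assume "evv q (lin (axis 0 1) * Zprod) \<noteq> 0"
    then have q: "q \<noteq> 0" "evv q Zprod \<noteq> 0" by (auto simp: ev.hom_mult dotp_def)
    obtain v where v: "v \<noteq> 0" "evf f v \<noteq> 0" "proj_pt q = proj_pt (evf f v)"
      using mem_image_generic[OF q] unfolding mem_image_map_graph by blast
    then have "q \<in> proj_pt (evf f v)" using proj_pt_self[of q] by simp
    then show "evv q F = 0" using evv_proj_pt[OF assms(1)] assms(2)[OF v(1,2)] by blast
  qed
qed

lemma dominant: "dominant_map f"
  unfolding dominant_map_def
proof (intro allI impI)
  fix W assume W: "zariski_closed W \<and> snd ` map_graph f \<subseteq> W"
  then obtain S where S: "\<forall>F\<in>S. \<exists>m. F \<in> forms m" "W = zero_locus S" unfolding zariski_closed_def by blast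
  have "F = 0" if F: "F \<in> S" for F
  proof -
    obtain m where m: "F \<in> forms m" using S(1) F by blast
    show ?thesis
    proof (rule form_zero_if_vanishes_on_image[OF m])
      fix v assume v: "v \<noteq> 0" "evf f v \<noteq> 0"
      then have "proj_pt (evf f v) \<in> snd ` map_graph f" unfolding mem_image_map_graph by blast
      then have "proj_pt (evf f v) \<in> zero_locus S" using W S(2) by blast
      then show "evv (evf f v) F = 0" using F proj_pt_self unfolding zero_locus_def by blast
    qed
  qed
  then have "S \<subseteq> {0}" by blast
  then have "\<forall>F\<in>S. cpoly_eval v F = 0" for v by auto
  then show "W = P2" unfolding S(2) zero_locus_def by blast
qed

text \<open>If q . g vanished on the line, f would be (f_j / q_j) q there. Any zero of f_j on the
  line would be a base point, and a zero exists because f_j has positive degree.\<close>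

lemma generic_finite_fiber:
  assumes q: "q \<noteq> 0" "evv q Zprod \<noteq> 0"
  shows "finite_fiber f (proj_pt q)"
  unfolding finite_fiber_iff[OF q(1)]
proof
  assume *: "\<forall>v. dotp q v = 0 \<longrightarrow> dotp q (evf g v) = 0"
  obtain j where j: "q $ j \<noteq> 0" using vec_nonzero_component[OF q(1)] by blast
  obtain v where v: "v \<noteq> 0" "dotp q v = 0" "evv v (f j) = 0"
    using line_meets[OF f_form _ q(1)] by auto
  have "evf f v = (evv v (f j) / q $ j) *s q" using * v(2) by (intro evf_f_on_line[OF _ _ j]) simp_all
  then have "evf f v = 0" using v(3) by simp
  then show False using Zprod_avoids[OF q(2) v(1,2)] by simp
qed

lemma generically_finite: "\<exists>W. zariski_closed W \<and> W \<noteq> P2 \<and> (\<forall>Q \<in> P2 - W. finite_fiber f Q)"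
proof (intro exI conjI ballI)
  show "zariski_closed (zero_locus {Zprod})" by (rule zariski_closed_zero_locus_single[OF Zprod_form])
  have nz: "Zprod * lin (axis 0 1) \<noteq> 0" using Zprod_nonzero lin_nonzero[of "axis 0 1"] by (simp add: axis_eq_0_iff)
  then obtain q where "evv q (Zprod * lin (axis 0 1)) \<noteq> 0" using evv_nonzero by blast
  then have q: "q \<noteq> 0" "evv q Zprod \<noteq> 0" by (auto simp: ev.hom_mult dotp_def)
  then have "proj_pt q \<in> P2" "proj_pt q \<notin> zero_locus {Zprod}"
    by (simp_all add: proj_pt_zero_locus_single[OF _ Zprod_form])
  then show "zero_locus {Zprod} \<noteq> P2" by blast
  fix Q assume Q: "Q \<in> P2 - zero_locus {Zprod}"
  then obtain q where q: "q \<noteq> 0" "Q = proj_pt q" using P2_cases by blast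
  then have "evv q Zprod \<noteq> 0" using Q by (auto simp: proj_pt_zero_locus_single[OF _ Zprod_form])
  then show "finite_fiber f Q" unfolding q(2) by (rule generic_finite_fiber[OF q(1)])
qed

text \<open>Off Z the curve lies in one fibre, hence on q . x = 0. It is infinite, irreducible and Z
  is finite, so all of it lies on that line. Every equation of C then vanishes at infinitely many
  points of the line, so C is the line, and likewise q . g vanishes on it.\<close>

lemma contracted_curve_line:
  assumes "contracted_curve f C"
  obtains q where "q \<noteq> 0" "C = zero_locus {lin q}" "\<forall>v. dotp q v = 0 \<longrightarrow> dotp q (evf g v) = 0"
proof -
  have irr: "irreducible_closed C" and inf: "infinite C"
    using assms irreducible_curve_infinite unfolding contracted_curve_def irreducible_curve_def by blast+
  obtain Q where Q: "map_graph f `` C = {Q}" using assms unfolding contracted_curve_def by blast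
  then obtain P where "(P, Q) \<in> map_graph f" by blast
  then obtain q where q: "q \<noteq> 0" "Q = proj_pt q" unfolding mem_map_graph by blast
  have C2: "C \<subseteq> P2" using irr zariski_closed_P2 unfolding irreducible_closed_def by blast
  have on: "P \<in> zero_locus {lin q, cdot q g}" if P: "P \<in> C - Z" for P
  proof -
    obtain v where v: "v \<noteq> 0" "P = proj_pt v" using P C2 P2_cases by blast
    have nz: "evf f v \<noteq> 0" using P v mem_Z by blast
    then have "(P, proj_pt (evf f v)) \<in> map_graph f" unfolding mem_map_graph v(2) using v(1) by blast
    then have "proj_pt (evf f v) = proj_pt q" using Q q(2) P by blast
    then obtain c where c: "q = c *s evf f v" unfolding proj_pt_eq_iff by blast
    have "dotp q v = 0" "dotp q (evf g v) = 0" unfolding c dotp_scale dotp_f_x dotp_f_g by simp_all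
    then show ?thesis unfolding v(2) using v(1) by (simp add: proj_pt_mem_fiber)
  qed
  have inf': "infinite (C - Z)" using inf finite_Z by simp
  have cC: "zariski_closed C"
    and irr': "\<And>A B. zariski_closed A \<Longrightarrow> zariski_closed B \<Longrightarrow> C = A \<union> B \<Longrightarrow> C = A \<or> C = B"
    using irr unfolding irreducible_closed_def by blast+
  have "zero_locus {lin q, cdot q g} \<subseteq> zero_locus {lin q}"
    using zero_locus_insert[of "lin q" "{cdot q g}"] by simp
  then have "C - Z \<subseteq> zero_locus {lin q}" using on by blast
  then have "C = (C \<inter> Z) \<union> (C \<inter> zero_locus {lin q})" by blast
  from irr'[OF zariski_closed_Int[OF cC zariski_closed_finite[OF finite_Z Z_P2]]
      zariski_closed_Int[OF cC zariski_closed_zero_locus_single[OF lin_form]] this]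
  have "C = C \<inter> Z \<or> C = C \<inter> zero_locus {lin q}" .
  moreover have "C \<noteq> C \<inter> Z"
  proof
    assume "C = C \<inter> Z"
    then have "C \<subseteq> Z" by blast
    then show False using inf finite_Z finite_subset by blast
  qed
  ultimately have sub: "C \<subseteq> zero_locus {lin q}" by blast
  obtain S where S: "\<forall>F\<in>S. \<exists>m. F \<in> forms m" "C = zero_locus S"
    using irr unfolding irreducible_closed_def zariski_closed_def by blast
  have "zero_locus {lin q} \<subseteq> C"
  proof
    fix P assume P: "P \<in> zero_locus {lin q}"
    then obtain v where v: "v \<noteq> 0" "P = proj_pt v" using zero_locus_P2 P2_cases by blast
    then have 0: "dotp q v = 0" using P by simp
    have "evv v F = 0" if F: "F \<in> S" for F
    proof -
      obtain m where m: "F \<in> forms m" using S(1) F by blast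
      have "C \<subseteq> zero_locus {lin q, F}" using sub F unfolding S(2) zero_locus_def by blast
      then show ?thesis by (rule line_infinite_vanish[OF q(1) m inf _ 0])
    qed
    then show "P \<in> C" unfolding S(2) v(2) using S(1) by (subst proj_pt_zero_locus[OF v(1)]) auto
  qed
  then have "C = zero_locus {lin q}" using sub by blast
  moreover have "\<forall>v. dotp q v = 0 \<longrightarrow> dotp q (evf g v) = 0"
    using line_infinite_vanish[OF q(1) cdot_g_form inf'] on by auto
  ultimately show ?thesis using that q(1) by blast
qed

lemma contracted_curve_proj_line: "contracted_curve f C \<Longrightarrow> proj_line C"
  unfolding plane_curve_def using contracted_curve_line lin_form lin_nonzero by metis

end

section \<open>Partial derivatives\<close>

text \<open>This is F with x_i replaced by x_i + s. Its linear coefficient in s is the formal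
  partial derivative, and the product rule is the formula for the linear coefficient of a
  product.\<close>

definition shift_poly :: "3 \<Rightarrow> 3 cpoly \<Rightarrow> 3 cpoly poly" where
  "shift_poly i = pm_eval (\<lambda>c. [:Const c:]) (\<lambda>j. [:Var j, if j = i then 1 else 0:])"

interpretation shift_poly: comm_ring_hom "shift_poly i" for i
  unfolding shift_poly_def by (rule comm_ring_hom_pm_eval[OF comm_ring_hom_const_Const])

lemma shift_poly_Const [simp]: "shift_poly i (Const c) = [:Const c:]"
  and shift_poly_Var [simp]: "shift_poly i (Var j) = [:Var j, if j = i then 1 else 0:]"
  by (simp_all add: shift_poly_def comm_ring_hom_const_Const)

definition pd :: "3 \<Rightarrow> 3 cpoly \<Rightarrow> 3 cpoly" where
  "pd i F = Polynomial.coeff (shift_poly i F) 1"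

lemma coeff_mult_0: "Polynomial.coeff (p * q) 0 = Polynomial.coeff p 0 * Polynomial.coeff (q :: 'a::comm_ring_1 poly) 0"
  and coeff_mult_1: "Polynomial.coeff (p * q) 1 = Polynomial.coeff p 0 * Polynomial.coeff q 1 + Polynomial.coeff p 1 * Polynomial.coeff q 0"
  by (simp_all add: coeff_mult)

lemma coeff_shift_poly_0: "Polynomial.coeff (shift_poly i F) 0 = F"
  by (induction F rule: cpoly_induct) (simp_all add: shift_poly.hom_simps coeff_mult_0)

lemma pd_Const [simp]: "pd i (Const c) = 0"
  and pd_Var: "pd i (Var j) = (if j = i then 1 else 0)"
  and pd_add: "pd i (F + G) = pd i F + pd i G"
  and pd_mult: "pd i (F * G) = F * pd i G + pd i F * G"
  unfolding pd_def by (simp_all add: shift_poly.hom_simps coeff_mult_1[unfolded One_nat_def] coeff_shift_poly_0)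

lemma pd_sum: "pd i (sum u A) = (\<Sum>x\<in>A. pd i (u x))"
  by (induction A rule: infinite_finite_induct) (simp_all add: pd_add, simp_all add: pd_def)

lemma pd_cdot: "pd i (cdot q G) = (\<Sum>j\<in>UNIV. Const (q $ j) * pd i (G j))"
  by (simp add: cdot_def pd_sum pd_mult)

text \<open>Homogeneity of degree s when the new variable also counts with degree 1. Applied to
  \<open>shift_poly\<close> it shows that a partial derivative lowers the degree by one.\<close>

definition graded_poly :: "nat \<Rightarrow> 3 cpoly poly \<Rightarrow> bool" where
  "graded_poly s p \<longleftrightarrow> (\<forall>k. (k \<le> s \<longrightarrow> Polynomial.coeff p k \<in> forms (s - k)) \<and> (s < k \<longrightarrow> Polynomial.coeff p k = 0))"

lemma graded_poly_mult:
  assumes "graded_poly s p" "graded_poly t q"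
  shows "graded_poly (s + t) (p * q)"
  unfolding graded_poly_def
proof (intro allI conjI impI)
  fix k
  have zero: "Polynomial.coeff p i * Polynomial.coeff q (k - i) = 0" if "\<not> (i \<le> s \<and> k - i \<le> t)" for i
  proof -
    have "s < i \<or> t < k - i" using that by auto
    then show ?thesis using assms unfolding graded_poly_def by auto
  qed
  show "Polynomial.coeff (p * q) k = 0" if "s + t < k"
    unfolding coeff_mult by (intro sum.neutral ballI zero) (use that in auto)
  show "Polynomial.coeff (p * q) k \<in> forms (s + t - k)" if k: "k \<le> s + t"
    unfolding coeff_mult
  proof (rule forms_sum)
    fix i assume i: "i \<in> {..k}"
    show "Polynomial.coeff p i * Polynomial.coeff q (k - i) \<in> forms (s + t - k)"
    proof (cases "i \<le> s \<and> k - i \<le> t")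
      case True
      then have "Polynomial.coeff p i \<in> forms (s - i)" "Polynomial.coeff q (k - i) \<in> forms (t - (k - i))"
        using assms unfolding graded_poly_def by auto
      moreover have "s - i + (t - (k - i)) = s + t - k" using True i k by auto
      ultimately show ?thesis using forms_mult[of "Polynomial.coeff p i" "s - i" "Polynomial.coeff q (k - i)" "t - (k - i)"] by simp
    next
      case False
      then have "Polynomial.coeff p i * Polynomial.coeff q (k - i) = 0" by (rule zero)
      then show ?thesis by auto
    qed
  qed
qed

lemma graded_poly_const: "F \<in> forms 0 \<Longrightarrow> graded_poly 0 [:F:]"
  by (auto simp: graded_poly_def coeff_pCons split: nat.split)

lemma graded_poly_power: "graded_poly s p \<Longrightarrow> graded_poly (s * k) (p ^ k)"
proof (induction k)
  case 0
  show ?case using graded_poly_const[OF forms_one] by (simp add: one_pCons)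
next
  case (Suc k)
  then show ?case using graded_poly_mult[of s p "s * k" "p ^ k"] by simp
qed

lemma graded_poly_prod:
  "(\<And>x. x \<in> A \<Longrightarrow> graded_poly (e x) (u x)) \<Longrightarrow> finite A \<Longrightarrow> graded_poly (sum e A) (prod u A)"
proof (induction A rule: infinite_finite_induct)
  case empty
  show ?case using graded_poly_const[OF forms_one] by (simp add: one_pCons)
next
  case (insert x A)
  then show ?case using graded_poly_mult[of "e x" "u x" "sum e A" "prod u A"] by simp
qed simp

lemma graded_poly_sum: "(\<And>x. x \<in> A \<Longrightarrow> graded_poly s (u x)) \<Longrightarrow> graded_poly s (sum u A)"
  unfolding graded_poly_def by (simp add: coeff_sum forms_sum)

lemma graded_poly_shift_poly:
  assumes F: "F \<in> forms m"
  shows "graded_poly m (shift_poly i F)"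
  unfolding shift_poly_def pm_eval_def
proof (rule graded_poly_sum)
  fix x assume x: "x \<in> Poly_Mapping.keys F"
  have gp: "graded_poly (1 * Poly_Mapping.lookup x j) ([:Var j, if j = i then 1 else 0:] ^ Poly_Mapping.lookup x j)" for j
    by (rule graded_poly_power) (auto simp: graded_poly_def coeff_pCons split: nat.split)
  have "graded_poly (\<Sum>j\<in>UNIV. 1 * Poly_Mapping.lookup x j) (\<Prod>j\<in>UNIV. [:Var j, if j = i then 1 else 0:] ^ Poly_Mapping.lookup x j)"
    by (rule graded_poly_prod[OF gp finite])
  moreover have s: "(\<Sum>j\<in>UNIV. 1 * Poly_Mapping.lookup x j) = m" using F x by (simp add: forms_def)
  ultimately have gm: "graded_poly m (\<Prod>j\<in>UNIV. [:Var j, if j = i then 1 else 0:] ^ Poly_Mapping.lookup x j)"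
    by (simp only: s)
  have "graded_poly (0 + m) ([:Const (Poly_Mapping.lookup F x):] * (\<Prod>j\<in>UNIV. [:Var j, if j = i then 1 else 0:] ^ Poly_Mapping.lookup x j))"
    by (rule graded_poly_mult[OF graded_poly_const[OF forms_Const] gm])
  then show "graded_poly m ([:Const (Poly_Mapping.lookup F x):] * (\<Prod>j\<in>UNIV. [:Var j, if j = i then 1 else 0:] ^ Poly_Mapping.lookup x j))"
    by simp
qed

lemma pd_form: "F \<in> forms m \<Longrightarrow> m > 0 \<Longrightarrow> pd i F \<in> forms (m - 1)"
  using graded_poly_shift_poly[of F m i] unfolding graded_poly_def pd_def by (simp add: Suc_le_eq)

definition dir_deriv :: "complex ^ 3 \<Rightarrow> complex ^ 3 \<Rightarrow> 3 cpoly \<Rightarrow> complex" where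
  "dir_deriv w v F = (\<Sum>i\<in>UNIV. w $ i * evv v (pd i F))"

interpretation line_poly: comm_ring_hom "line_poly a b" for a b
  unfolding line_poly_def by (rule comm_ring_hom_pm_eval[OF comm_ring_hom_const_poly])

lemma line_poly_Const [simp]: "line_poly a b (Const c) = [:c:]"
  and line_poly_Var [simp]: "line_poly a b (Var j) = [:a $ j, b $ j:]"
  by (simp_all add: line_poly_def comm_ring_hom_const_poly)

lemma coeff_line_poly_0: "Polynomial.coeff (line_poly a b F) 0 = evv a F"
  using poly_line_poly[of a b F 0] by (simp add: poly_0_coeff_0)

lemma coeff_line_poly_1: "Polynomial.coeff (line_poly v w F) 1 = dir_deriv w v F"
proof (induction F rule: cpoly_induct)
  case (Const c)
  then show ?case by (simp add: dir_deriv_def)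
next
  case (Var j)
  have "dir_deriv w v (Var j) = (\<Sum>i\<in>UNIV. if i = j then w $ i else 0)"
    unfolding dir_deriv_def pd_Var by (rule sum.cong) auto
  then show ?case by simp
next
  case (add F G)
  then show ?case by (simp add: line_poly.hom_add dir_deriv_def pd_add ev.hom_add ring_distribs sum.distrib)
next
  case (mult F G)
  have "dir_deriv w v (F * G) = evv v F * dir_deriv w v G + dir_deriv w v F * evv v G"
    unfolding dir_deriv_def pd_mult ev.hom_add ev.hom_mult
    by (simp add: sum_distrib_left sum_distrib_right sum.distrib[symmetric] algebra_simps)
  then show ?case unfolding line_poly.hom_mult coeff_mult_1 coeff_line_poly_0 mult by simp
qed

lemma dir_deriv_along_zero_line:
  assumes "\<And>t. evv (v + t *s w) F = 0"
  shows "dir_deriv w v F = 0"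
proof -
  have "poly (line_poly v w F) t = 0" for t using assms by (simp add: poly_line_poly)
  then have "line_poly v w F = 0" using poly_all_0_iff_0 by blast
  then show ?thesis using coeff_line_poly_1[of v w F] by simp
qed

lemma coeff_linear_power: "Polynomial.coeff ([:1, 1::complex:] ^ m) 0 = 1" "Polynomial.coeff ([:1, 1::complex:] ^ m) 1 = of_nat m"
proof -
  show 0: "Polynomial.coeff ([:1, 1::complex:] ^ m) 0 = 1" for m by (induction m) (simp_all add: coeff_mult_0)
  show "Polynomial.coeff ([:1, 1::complex:] ^ m) 1 = of_nat m"
  proof (induction m)
    case (Suc m)
    then show ?case unfolding power_Suc coeff_mult_1 0 by simp
  qed simp
qed

text \<open>The linear coefficients of F(v + t v) = (1 + t)^m F(v) are compared.\<close>

lemma euler: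
  assumes F: "F \<in> forms m"
  shows "dir_deriv v v F = of_nat m * evv v F"
proof -
  have "poly (line_poly v v F) t = poly (Polynomial.smult (evv v F) ([:1, 1:] ^ m)) t" for t
  proof -
    have "v + t *s v = (1 + t) *s v" by (simp add: vec_eq_iff distrib_right)
    then show ?thesis using evv_scale[OF F] by (simp add: poly_line_poly poly_power mult.commute)
  qed
  then have "line_poly v v F = Polynomial.smult (evv v F) ([:1, 1:] ^ m)"
    using poly_eq_poly_eq_iff by blast
  then show ?thesis using coeff_line_poly_1[of v v F] coeff_linear_power(2)[of m] by (simp add: mult.commute)
qed

text \<open>Each line splits off a linear factor. The cofactor still vanishes on the remaining
  lines, because two different lines meet in finitely many points and the rest of a line is
  infinite.\<close>

lemma form_vanishing_on_lines:
  assumes "F \<in> forms m" "finite A" "card A > m"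
    and "\<And>L. L \<in> A \<Longrightarrow> \<exists>q. q \<noteq> 0 \<and> L = zero_locus {lin q} \<and> (\<forall>v. dotp q v = 0 \<longrightarrow> evv v F = 0)"
  shows "F = 0"
  using assms
proof (induction m arbitrary: F A)
  case 0
  then obtain L where "L \<in> A" by fastforce
  then obtain q where q: "q \<noteq> 0" "\<forall>v. dotp q v = 0 \<longrightarrow> evv v F = 0" using 0(4) by blast
  \<comment> \<open>The zero vector satisfies q . v = 0, and a constant is determined by its value
    there.\<close>
  have "evv 0 F = 0" using q(2) by (simp add: dotp_def)
  then show ?case using forms_0_Const[OF 0(1)] by auto
next
  case (Suc m)
  then obtain L where L: "L \<in> A" by fastforce
  then obtain q where q: "q \<noteq> 0" "L = zero_locus {lin q}" "\<forall>v. dotp q v = 0 \<longrightarrow> evv v F = 0" using Suc.prems(4) by blast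
  obtain k where k: "q $ k \<noteq> 0" using vec_nonzero_component[OF q(1)] by blast
  have "reduce q k F = 0" using q(3) unfolding reduce_eq_0_iff_vanish[OF k] .
  then obtain G where G: "F = lin q * G" unfolding reduce_eq_0_iff[OF k] dvd_def by blast
  have Gm: "G \<in> forms m" using forms_cofactor[of "lin q" G "Suc m" 1] Suc.prems(1) G lin_form lin_nonzero[OF q(1)] by simp
  have "G = 0"
  proof (rule Suc.IH[OF Gm, of "A - {L}"])
    show "finite (A - {L})" "m < card (A - {L})" using Suc.prems L by auto
    fix L' assume L': "L' \<in> A - {L}"
    then obtain q' where q': "q' \<noteq> 0" "L' = zero_locus {lin q'}" "\<forall>v. dotp q' v = 0 \<longrightarrow> evv v F = 0" using Suc.prems(4) by blast
    have sub: "zero_locus {lin q'} \<subseteq> zero_locus {lin q}" if "infinite (L \<inter> L')" "q \<noteq> 0" "q' \<noteq> 0" "L = zero_locus {lin q}" "L' = zero_locus {lin q'}" for q q' L L'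
    proof
      fix P assume P: "P \<in> zero_locus {lin q'}"
      then obtain v where v: "v \<noteq> 0" "P = proj_pt v" using zero_locus_P2 P2_cases by blast
      have "L \<inter> L' \<subseteq> zero_locus {lin q', lin q}" using zero_locus_insert[of "lin q'" "{lin q}"] that(4,5) by blast
      from line_infinite_vanish[OF that(3) lin_form that(1) this] have "dotp q v = 0" using P v by simp
      then show "P \<in> zero_locus {lin q}" using v by simp
    qed
    have "finite (L \<inter> L')"
    proof (rule ccontr)
      assume inf: "infinite (L \<inter> L')"
      then have "infinite (L' \<inter> L)" by (simp add: Int_commute)
      then have "L = L'" using sub[OF inf q(1) q'(1) q(2) q'(2)] sub[OF _ q'(1) q(1) q'(2) q(2)] q(2) q'(2) by blast
      then show False using L' by blast
    qed
    then have inf: "infinite (L' - L)" using infinite_line[OF q'(1)] q'(2) by (metis Diff_Diff_Int Int_commute finite_Diff2 finite_Int)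
    have "L' - L \<subseteq> zero_locus {lin q', G}"
    proof
      fix P assume P: "P \<in> L' - L"
      then obtain v where v: "v \<noteq> 0" "P = proj_pt v" using q'(2) zero_locus_P2 P2_cases by blast
      have "dotp q' v = 0" "dotp q v \<noteq> 0" using P v q(2) q'(2) by auto
      then have "evv v F = 0" using q'(3) by blast
      then have "evv v G = 0" using \<open>dotp q v \<noteq> 0\<close> G by (simp add: ev.hom_mult)
      then show "P \<in> zero_locus {lin q', G}"
        using v \<open>dotp q' v = 0\<close> zero_locus_insert[of "lin q'" "{G}"] by (simp add: proj_pt_zero_locus_single[OF _ Gm])
    qed
    from line_infinite_vanish[OF q'(1) Gm inf this]
    show "\<exists>q. q \<noteq> 0 \<and> L' = zero_locus {lin q} \<and> (\<forall>v. dotp q v = 0 \<longrightarrow> evv v G = 0)" using q'(1,2) by blast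
  qed
  then show ?case using G by simp
qed

text \<open>For y = f(v) it expresses the direction \<open>cross y c\<close> of the line y . x = 0
  through the two directions g(v) and v.\<close>

lemma cross_cross: "cross (cross v w) c = dotp v c *s w + (- dotp w c) *s v"
proof -
  have "\<forall>i. cross (cross v w) c $ i = (dotp v c *s w + (- dotp w c) *s v) $ i"
    unfolding all_3 cross_components vector_add_component vector_smult_component dotp_3 by (simp add: algebra_simps)
  then show ?thesis unfolding vec_eq_iff .
qed

lemma cross_surj_on_line:
  assumes k: "q $ k \<noteq> 0" and v: "dotp q v = 0"
  shows "\<exists>c. cross q c = v"
proof -
  \<comment> \<open>With c_k = 0 the entries k + 1 and k + 2 of the equation determine c; the entry
    k follows from q . v = 0.\<close>
  define c :: "complex ^ 3" where "c = axis (k + 1) (v $ (k + 2) / q $ k) + axis (k + 2) (- (v $ (k + 1) / q $ k))"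
  note neq = shift_3_neq[of k] shift_3_neq[of k, symmetric]
  have c: "c $ k = 0" "c $ (k + 1) = v $ (k + 2) / q $ k" "c $ (k + 2) = - (v $ (k + 1) / q $ k)"
    using neq by (simp_all add: c_def axis_def)
  have v': "q $ k * v $ k + q $ (k + 1) * v $ (k + 1) + q $ (k + 2) * v $ (k + 2) = 0"
    using v unfolding dotp_def sum_3_shift[of _ k] .
  have "cross q c $ i = v $ i" for i
  proof -
    have "i \<in> {k, k + 1, k + 2}" using UNIV_3_shift[of k] by blast
    moreover have "cross q c $ (k + 1) = v $ (k + 1)" "cross q c $ (k + 2) = v $ (k + 2)"
      unfolding cross_nth shift_3 c using k by simp_all
    moreover have "q $ k * cross q c $ k = q $ k * v $ k"
    proof -
      have "q $ k * cross q c $ k = - (q $ (k + 1) * v $ (k + 1) + q $ (k + 2) * v $ (k + 2))"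
        unfolding cross_nth c using k by (simp add: right_diff_distrib)
      also have "\<dots> = q $ k * v $ k" using v' by (simp add: add.assoc eq_neg_iff_add_eq_0 [symmetric])
      finally show ?thesis .
    qed
    ultimately show ?thesis using k by auto
  qed
  then have "cross q c = v" unfolding vec_eq_iff by blast
  then show ?thesis by blast
qed

section \<open>The curve containing all contracted lines\<close>

context laguerre_net
begin

text \<open>The curve of degree \<open>3n\<close> where \<open>f\<close> is stationary along the direction \<open>g\<close>; it contains every
  contracted line. If it were the whole plane, the derivatives of \<open>q \<cdot> g\<close> along the line
  \<open>q \<cdot> x = 0\<close> would vanish on every fibre, hence on the line for degree reasons.\<close>

definition ext :: "3 cpoly" where
  "ext = (\<Sum>i\<in>UNIV. \<Sum>j\<in>UNIV. f i * (g j * pd j (g i)))"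

lemma ext_form: "ext \<in> forms (3 * n)"
proof -
  have "f i * (g j * pd j (g i)) \<in> forms (3 * n)" for i j
  proof -
    \<comment> \<open>The degrees n + 1 of f, n of g and n - 1 of its derivative add up to 3n, the
      bound on contracted lines.\<close>
    have "f i * (g j * pd j (g i)) \<in> forms ((n + 1) + (n + (n - 1)))"
      by (intro forms_mult f_form g_form pd_form n_pos)
    moreover have e: "(n + 1) + (n + (n - 1)) = 3 * n" using n_pos by simp
    ultimately show ?thesis unfolding e by blast
  qed
  then show ?thesis unfolding ext_def by (intro forms_sum)
qed

lemma evv_ext: "evv v ext = (\<Sum>i\<in>UNIV. evv v (f i) * dir_deriv (evf g v) v (g i))"
  by (simp add: ext_def ev.hom_simps dir_deriv_def sum_distrib_left)

lemma dir_deriv_cdot: "dir_deriv w v (cdot q g) = (\<Sum>i\<in>UNIV. q $ i * dir_deriv w v (g i))"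
proof -
  have "dir_deriv w v (cdot q g) = (\<Sum>j\<in>UNIV. \<Sum>i\<in>UNIV. w $ j * (q $ i * evv v (pd j (g i))))"
    by (simp add: dir_deriv_def pd_cdot ev.hom_simps sum_distrib_left)
  also have "\<dots> = (\<Sum>i\<in>UNIV. \<Sum>j\<in>UNIV. w $ j * (q $ i * evv v (pd j (g i))))" by (rule sum.swap)
  also have "\<dots> = (\<Sum>i\<in>UNIV. q $ i * dir_deriv w v (g i))"
    by (simp add: dir_deriv_def sum_distrib_left mult.left_commute)
  finally show ?thesis .
qed

text \<open>At a point v of the line, f(v) is a multiple of q and g(v) is a direction along the
  line. So the value of \<open>ext\<close> is a multiple of the derivative of q . g along a line on
  which q . g vanishes.\<close>

lemma ext_vanishes_on_contracted:
  assumes q: "q \<noteq> 0" and van: "\<forall>v. dotp q v = 0 \<longrightarrow> dotp q (evf g v) = 0" and v: "dotp q v = 0"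
  shows "evv v ext = 0"
proof -
  obtain j where j: "q $ j \<noteq> 0" using vec_nonzero_component[OF q] by blast
  define c where "c = evv v (f j) / q $ j"
  have w: "dotp q (evf g v) = 0" using van v by blast
  have "evf f v = c *s q" unfolding c_def by (rule evf_f_on_line[OF v w j])
  then have f: "evv v (f i) = c * q $ i" for i by (metis evf_nth vector_smult_component)
  have "dir_deriv (evf g v) v (cdot q g) = 0"
  proof (rule dir_deriv_along_zero_line)
    fix t
    have "dotp q (v + t *s evf g v) = 0" using v w by (simp add: dotp_add)
    then show "evv (v + t *s evf g v) (cdot q g) = 0" using van by simp
  qed
  then have "c * (\<Sum>i\<in>UNIV. q $ i * dir_deriv (evf g v) v (g i)) = 0" unfolding dir_deriv_cdot by simp
  then show ?thesis unfolding evv_ext f by (simp add: sum_distrib_left mult.assoc)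
qed

lemma dir_deriv_add_scale: "dir_deriv (a *s w + b *s u) v F = a * dir_deriv w v F + b * dir_deriv u v F"
  by (simp add: dir_deriv_def sum_distrib_left sum.distrib[symmetric] algebra_simps)

text \<open>In coordinates (x, y) this is the derivative of y . g at x in the direction
  \<open>cross y c\<close>, which runs along the line y . x = 0. It has degree n - 1 in x.\<close>

definition deriv_form :: "complex ^ 3 \<Rightarrow> (3 + 3) cpoly" where
  "deriv_form c = (\<Sum>i\<in>UNIV. \<Sum>j\<in>UNIV. Var (Inr i) * ((Var (Inr (j + 1)) * Const (c $ (j + 2)) - Var (Inr (j + 2)) * Const (c $ (j + 1)))
     * cpoly_subst (\<lambda>i. Var (Inl i)) (pd j (g i))))"

lemma deriv_form_biform: "deriv_form c \<in> biforms (n - 1) 2"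
proof -
  have b: "cpoly_subst (\<lambda>i. Var (Inl i)) (pd j (g i)) \<in> biforms (1 * (n - 1)) (0 * (n - 1))" for i j
    by (rule cpoly_subst_biforms[OF pd_form[OF g_form n_pos] biforms_VarL])
  have vc: "Var (Inr a) * Const d \<in> biforms (0 + 0) (1 + 0)" for a d
    by (rule biforms_mult[OF biforms_VarR biforms_Const])
  have "Var (Inr i) * ((Var (Inr (j + 1)) * Const (c $ (j + 2)) - Var (Inr (j + 2)) * Const (c $ (j + 1)))
     * cpoly_subst (\<lambda>i. Var (Inl i)) (pd j (g i))) \<in> biforms (0 + ((0 + 0) + 1 * (n - 1))) (1 + ((1 + 0) + 0 * (n - 1)))" for i j
    by (intro biforms_mult biforms_diff biforms_VarR biforms_Const b vc)
  then show ?thesis unfolding deriv_form_def by (intro biforms_sum) (simp add: numeral_2_eq_2)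
qed

lemma eval_deriv_form:
  "cpoly_eval (case_sum (($) v) (($) y)) (deriv_form c) = (\<Sum>i\<in>UNIV. y $ i * dir_deriv (cross y c) v (g i))"
  by (simp add: deriv_form_def ev.hom_simps cpoly_eval_subst dir_deriv_def cross_nth sum_distrib_left)

text \<open>Over v, with y = f(v), the direction \<open>cross y c\<close> is a combination of g(v)
  and v. The derivative of y . g along g(v) is the value of \<open>ext\<close>, and the one along v
  is n times y . g(v) = 0 by Euler.\<close>

lemma deriv_form_graph:
  assumes "ext = 0"
  shows "deriv_form c \<in> graph_closure_forms f"
proof (rule graph_closure_formsI[OF deriv_form_biform])
  fix v
  let ?y = "evf f v" and ?w = "evf g v"
  have 1: "(\<Sum>i\<in>UNIV. ?y $ i * dir_deriv ?w v (g i)) = 0" using evv_ext[of v] assms by simp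
  have "(\<Sum>i\<in>UNIV. ?y $ i * dir_deriv v v (g i)) = of_nat n * dotp ?y ?w"
    by (simp add: euler[OF g_form] dotp_def sum_distrib_left mult.left_commute)
  then have 2: "(\<Sum>i\<in>UNIV. ?y $ i * dir_deriv v v (g i)) = 0" by (simp only: dotp_f_g mult_zero_right)
  have "(\<Sum>i\<in>UNIV. ?y $ i * dir_deriv (cross ?y c) v (g i)) =
    dotp v c * (\<Sum>i\<in>UNIV. ?y $ i * dir_deriv ?w v (g i)) + (- dotp ?w c) * (\<Sum>i\<in>UNIV. ?y $ i * dir_deriv v v (g i))"
    unfolding evf_f cross_cross dir_deriv_add_scale
    by (simp only: sum_distrib_left sum.distrib[symmetric] distrib_left mult.left_commute)
  then show "cpoly_eval (case_sum (($) v) (($) ?y)) (deriv_form c) = 0"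
    unfolding eval_deriv_form 1 2 by simp
qed

text \<open>If \<open>ext\<close> were 0, \<open>deriv_form\<close> would be an equation of the
  graph of degree n - 1 in x, hence zero on every line. Choosing c with \<open>cross q c = v\<close>
  makes v itself the direction, and Euler gives q . g(v) = 0 on the whole line. A generic q has a
  finite fibre, which contradicts this.\<close>

lemma ext_nonzero: "ext \<noteq> 0"
proof
  assume e: "ext = 0"
  have nz: "Zprod * lin (axis 0 1) \<noteq> 0" using Zprod_nonzero lin_nonzero[of "axis 0 1"] by (simp add: axis_eq_0_iff)
  then obtain q where "evv q (Zprod * lin (axis 0 1)) \<noteq> 0" using evv_nonzero by blast
  then have q: "q \<noteq> 0" "evv q Zprod \<noteq> 0" by (auto simp: ev.hom_mult dotp_def)
  obtain k where k: "q $ k \<noteq> 0" using vec_nonzero_component[OF q(1)] by blast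
  have "dotp q (evf g v) = 0" if v: "dotp q v = 0" for v
  proof -
    obtain c where c: "cross q c = v" using cross_surj_on_line[OF k v] by blast
    have "reduce q k (sub_right (\<lambda>j. Const (q $ j)) (deriv_form c)) = 0"
      by (rule reduce_low_degree[OF deriv_form_graph[OF e] deriv_form_biform k]) (use n_pos in simp)
    then have "evv v (sub_right (\<lambda>j. Const (q $ j)) (deriv_form c)) = 0"
      using v unfolding reduce_eq_0_iff_vanish[OF k] by blast
    moreover have "evf (\<lambda>j. Const (q $ j)) v = q" by (simp add: vec_eq_iff)
    ultimately have "dir_deriv v v (cdot q g) = 0"
      unfolding evv_sub_right dir_deriv_cdot using eval_deriv_form[of v q c] c by simp
    then show ?thesis using euler[OF cdot_g_form, of v q] n_pos by simp
  qed
  then show False using generic_finite_fiber[OF q] finite_fiber_iff[OF q(1)] by blast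
qed

text \<open>Finite families are bounded before finiteness is known, since \<open>card\<close> of an
  infinite set is 0; the bound then yields finiteness.\<close>

lemma card_contracted_subset:
  assumes "finite A" "A \<subseteq> {C. contracted_curve f C}"
  shows "card A \<le> 3 * n"
proof (rule ccontr)
  assume "\<not> card A \<le> 3 * n"
  then have c: "card A > 3 * n" by simp
  have "\<exists>q. q \<noteq> 0 \<and> L = zero_locus {lin q} \<and> (\<forall>v. dotp q v = 0 \<longrightarrow> evv v ext = 0)" if L: "L \<in> A" for L
  proof -
    have "contracted_curve f L" using L assms(2) by blast
    then obtain q where "q \<noteq> 0" "L = zero_locus {lin q}" "\<forall>v. dotp q v = 0 \<longrightarrow> dotp q (evf g v) = 0"
      by (rule contracted_curve_line)
    then show ?thesis using ext_vanishes_on_contracted by blast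
  qed
  from form_vanishing_on_lines[OF ext_form assms(1) c this] show False using ext_nonzero by blast
qed

lemma contracted_lines: "finite {C. contracted_curve f C}" "card {C. contracted_curve f C} \<le> 3 * n"
proof -
  show fin: "finite {C. contracted_curve f C}"
  proof (rule ccontr)
    assume "infinite {C. contracted_curve f C}"
    then obtain A where "finite A" "card A = 3 * n + 1" "A \<subseteq> {C. contracted_curve f C}"
      using infinite_arbitrarily_large by blast
    then show False using card_contracted_subset[of A] by simp
  qed
  show "card {C. contracted_curve f C} \<le> 3 * n" by (rule card_contracted_subset[OF fin order_refl])
qed

section \<open>Base points on curves\<close>

lemma prime_elem_factor:
  fixes p :: "'r::idom"
  assumes p: "prime_elem p" and ab: "p = a * b"
  shows "a dvd 1 \<or> b dvd 1"
proof -
  have p0: "p \<noteq> 0" using p unfolding prime_elem_def by blast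
  have unit: "b dvd 1" if "p dvd a" "p = a * b" for a b
  proof -
    obtain c where c: "a = p * c" using \<open>p dvd a\<close> by (auto simp: dvd_def)
    have "p * 1 = p * (c * b)" using that(2) c by (simp add: mult.assoc)
    then have "1 = b * c" using p0 unfolding mult_cancel_left by (simp add: mult.commute)
    then show ?thesis by (rule dvdI)
  qed
  have "p dvd a \<or> p dvd b" by (rule prime_elem_dvd_multD[OF p]) (simp add: ab)
  moreover have "p = b * a" using ab by (simp only: mult.commute)
  ultimately show ?thesis using unit ab by blast
qed

lemma base_points_prime:
  assumes h: "h \<in> forms k" "prime_elem h" and S: "finite S" "S \<subseteq> Z" "S \<subseteq> zero_locus {h}"
  shows "card S \<le> k * (n + 1)"
proof -
  obtain i where i: "\<not> h dvd f i"
    using common_divisor_f[of h] h(2) unfolding prime_elem_def by blast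
  have "zero_locus (range f) \<subseteq> zero_locus {f i}" by (auto simp: zero_locus_def)
  then have "S \<subseteq> zero_locus {h, f i}" using S zero_locus_insert[of h "{f i}"] unfolding Z_def by blast
  then show ?thesis using bezout_inequality[OF h f_form i S(1)] by blast
qed

text \<open>With p = f(v), each p_i f_j - p_j f_i vanishes on S and at v, one point more than the
  Bezout inequality permits. So h divides it, and f is proportional to p along the curve. This puts
  the curve off Z on the line p . x = 0, and primality of h makes h a constant multiple of
  \<open>lin p\<close>.\<close>

lemma base_points_prime_eq:
  assumes h: "h \<in> forms k" "prime_elem h" and S: "finite S" "S \<subseteq> Z" "S \<subseteq> zero_locus {h}"
    and card: "card S = k * (n + 1)" and v: "v \<noteq> 0" "evv v h = 0" "evf f v \<noteq> 0"
  shows "k = 1 \<and> zero_locus {h} = zero_locus {lin (evf f v)}"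
proof -
  let ?p = "evf f v"
  have h0: "h \<noteq> 0" and hu: "\<not> h dvd 1" using h(2) unfolding prime_elem_def by blast+
  have k0: "k > 0" by (rule nonunit_form_degree[OF h(1) h0 hu])
  have dvd: "h dvd Const (?p $ i) * f j - Const (?p $ j) * f i" for i j
  proof (rule ccontr)
    let ?F = "Const (?p $ i) * f j - Const (?p $ j) * f i"
    assume nd: "\<not> h dvd ?F"
    have F: "?F \<in> forms (n + 1)" by (intro forms_diff forms_Const_mult f_form)
    have "proj_pt v \<in> zero_locus {h}" "proj_pt v \<in> zero_locus {?F}"
      unfolding proj_pt_zero_locus_single[OF v(1) h(1)] proj_pt_zero_locus_single[OF v(1) F]
      using v(2) by (simp_all add: ev.hom_simps)
    moreover have "S \<subseteq> zero_locus {?F}"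
    proof -
      have "zero_locus (range f) \<subseteq> zero_locus {?F}" by (auto simp: zero_locus_def ev.hom_simps)
      then show ?thesis using S(2) unfolding Z_def by blast
    qed
    ultimately have "insert (proj_pt v) S \<subseteq> zero_locus {h, ?F}"
      using S(3) zero_locus_insert[of h "{?F}"] by blast
    from bezout_inequality[OF h F nd _ this] S(1) have "card (insert (proj_pt v) S) \<le> k * (n + 1)" by blast
    moreover have "proj_pt v \<notin> S" using S(2) mem_Z[OF v(1)] v(3) by blast
    ultimately show False using S(1) card by simp
  qed
  have "zero_locus {h} - Z \<subseteq> zero_locus {lin ?p, h}"
  proof
    fix P assume P: "P \<in> zero_locus {h} - Z"
    then obtain w where w: "w \<noteq> 0" "P = proj_pt w" using zero_locus_P2 P2_cases by blast
    have hw: "evv w h = 0" using P unfolding w(2) by (simp add: proj_pt_zero_locus_single[OF w(1) h(1)])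
    have par: "?p $ i * evf f w $ j = ?p $ j * evf f w $ i" for i j
    proof -
      obtain B where "Const (?p $ i) * f j - Const (?p $ j) * f i = h * B" using dvd by (auto simp: dvd_def)
      then have "evv w (Const (?p $ i) * f j - Const (?p $ j) * f i) = evv w h * evv w B" by (simp add: ev.hom_mult)
      then show ?thesis using hw by (simp add: ev.hom_simps)
    qed
    have "evf f w \<noteq> 0" using P w mem_Z[OF w(1)] by blast
    then obtain j where j: "evf f w $ j \<noteq> 0" using vec_nonzero_component by blast
    \<comment> \<open>Proportionality of f(w) and p transfers the identity f(w) . w = 0 to p . w =
      0.\<close>
    have "evf f w $ j * dotp ?p w = ?p $ j * dotp (evf f w) w"
      unfolding dotp_def sum_distrib_left
    proof (rule sum.cong[OF refl])
      fix i
      show "evf f w $ j * (?p $ i * w $ i) = ?p $ j * (evf f w $ i * w $ i)"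
        using par[of i j] by (metis mult.assoc mult.commute)
    qed
    then have "dotp ?p w = 0" using j dotp_f_x[of w] by simp
    then show "P \<in> zero_locus {lin ?p, h}"
      using P zero_locus_insert[of "lin ?p" "{h}"] w by simp
  qed
  moreover have "infinite (zero_locus {h} - Z)" using infinite_zero_locus[OF h(1) k0] finite_Z by simp
  ultimately have van: "\<forall>u. dotp ?p u = 0 \<longrightarrow> evv u h = 0"
    using line_infinite_vanish[OF v(3) h(1)] by blast
  obtain i where i: "?p $ i \<noteq> 0" using vec_nonzero_component[OF v(3)] by blast
  then obtain A where A: "h = lin ?p * A"
    using van unfolding reduce_eq_0_iff_vanish[OF i, symmetric] reduce_eq_0_iff[OF i] dvd_def by blast
  have "lin ?p dvd 1 \<or> A dvd 1" by (rule prime_elem_factor[OF h(2) A])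
  moreover have "\<not> lin ?p dvd 1"
  proof
    assume "lin ?p dvd 1"
    from forms_degree_unique[OF lin_form unit_form[OF this] lin_nonzero[OF v(3)]] show False by simp
  qed
  ultimately have "A dvd 1" by blast
  then have "A \<in> forms 0" by (rule unit_form)
  then obtain c where c: "A = Const c" using forms_0_Const by blast
  have "h \<in> forms 1" using A c forms_mult[OF lin_form \<open>A \<in> forms 0\<close>] by simp
  then have "k = 1" using forms_degree_unique[OF h(1) _ h0] by blast
  moreover have "zero_locus {h} = zero_locus {lin ?p}"
  proof -
    have "c \<noteq> 0" using c A h0 by auto
    then have "evv u h = 0 \<longleftrightarrow> evv u (lin ?p) = 0" for u unfolding A c by (simp add: ev.hom_mult)
    then show ?thesis unfolding zero_locus_def by auto
  qed
  ultimately show ?thesis by blast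
qed

text \<open>The weak bound for all degrees and the strict one from degree 2 on go through the
  induction together. If a product attains equality, both factors attain it and share no point of S.
  Strictness leaves only two lines, and their common point v decides: if it is a base point, one
  line has too many; otherwise both lines are p . x = 0 for p = f(v), so they carry the same points
  of S.\<close>

lemma base_points_curve:
  assumes "h \<in> forms k" "h \<noteq> 0" "k > 0" "finite S" "S \<subseteq> Z" "S \<subseteq> zero_locus {h}"
  shows "card S \<le> k * (n + 1) \<and> (k \<ge> 2 \<longrightarrow> card S < k * (n + 1))"
  using assms
proof (induction k arbitrary: h S rule: less_induct)
  case (less k h S)
  have hu: "\<not> h dvd 1"
  proof
    assume "h dvd 1"
    from forms_degree_unique[OF less.prems(1) unit_form[OF this] less.prems(2)] less.prems(3) show False by simp
  qed
  show ?case
  proof (cases "irreducible h")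
    case True
    then have p: "prime_elem h" by (rule irreducible_imp_prime_elem_cpoly)
    have le: "card S \<le> k * (n + 1)" by (rule base_points_prime[OF less.prems(1) p less.prems(4-6)])
    moreover have "card S \<noteq> k * (n + 1)" if "k \<ge> 2"
    proof
      assume eq: "card S = k * (n + 1)"
      have "infinite (zero_locus {h} - Z)" using infinite_zero_locus[OF less.prems(1,3)] finite_Z by simp
      then obtain P where P: "P \<in> zero_locus {h}" "P \<notin> Z" by (metis Diff_iff all_not_in_conv finite.emptyI)
      then obtain v where v: "v \<noteq> 0" "P = proj_pt v" using zero_locus_P2 P2_cases by blast
      have "evv v h = 0" "evf f v \<noteq> 0" using P v proj_pt_zero_locus_single[OF v(1) less.prems(1)] mem_Z[OF v(1)] by simp_all
      from base_points_prime_eq[OF less.prems(1) p less.prems(4-6) eq v(1) this] show False using \<open>k \<ge> 2\<close> by simp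
    qed
    ultimately show ?thesis by linarith
  next
    case False
    from reducible_form[OF less.prems(1,2) hu this] obtain A B a b where
      AB: "h = A * B" "A \<in> forms a" "B \<in> forms b" "a + b = k" "a > 0" "b > 0" .
    have nz: "A \<noteq> 0" "B \<noteq> 0" using AB(1) less.prems(2) by auto
    define SA where "SA = S \<inter> zero_locus {A}"
    define SB where "SB = S \<inter> zero_locus {B}"
    have Su: "S = SA \<union> SB" using less.prems(6) unfolding SA_def SB_def AB(1) zero_locus_mult[OF AB(2,3)] by blast
    have fin: "finite SA" "finite SB" and sub: "SA \<subseteq> Z" "SB \<subseteq> Z" "SA \<subseteq> zero_locus {A}" "SB \<subseteq> zero_locus {B}"
      using less.prems unfolding SA_def SB_def by auto
    have IA: "card SA \<le> a * (n + 1) \<and> (a \<ge> 2 \<longrightarrow> card SA < a * (n + 1))"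
      using AB by (intro less.IH[OF _ AB(2) nz(1) AB(5) fin(1) sub(1,3)]) simp
    have IB: "card SB \<le> b * (n + 1) \<and> (b \<ge> 2 \<longrightarrow> card SB < b * (n + 1))"
      using AB by (intro less.IH[OF _ AB(3) nz(2) AB(6) fin(2) sub(2,4)]) simp
    have kab: "k * (n + 1) = a * (n + 1) + b * (n + 1)" unfolding AB(4)[symmetric] by (rule distrib_right)
    have cu: "card S + card (SA \<inter> SB) = card SA + card SB" unfolding Su using card_Un_Int[OF fin] by simp
    have "card S \<noteq> k * (n + 1)"
    proof
      assume eq: "card S = k * (n + 1)"
      then have cA: "card SA = a * (n + 1)" and cB: "card SB = b * (n + 1)" and "card (SA \<inter> SB) = 0"
        using kab cu IA IB by linarith+
      then have disj: "SA \<inter> SB = {}" using fin by simp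
      \<comment> \<open>The induction hypothesis is strict from degree 2 on, so only lines can
        attain equality.\<close>
      have "a = 1" "b = 1" using IA IB cA cB AB(5,6) by auto
      then have A1: "A \<in> forms 1" "card SA = 1 * (n + 1)" and B1: "B \<in> forms 1" "card SB = 1 * (n + 1)"
        using AB cA cB by simp_all
      have irr: "prime_elem D" if D: "D \<in> forms 1" "D \<noteq> 0" for D :: "3 cpoly"
      proof (rule irreducible_imp_prime_elem_cpoly, rule ccontr)
        have nu: "\<not> D dvd 1"
        proof
          assume "D dvd 1"
          from forms_degree_unique[OF D(1) unit_form[OF this] D(2)] show False by simp
        qed
        assume "\<not> irreducible D"
        from reducible_form[OF D nu this] obtain a b :: nat where "a + b = 1" "a > 0" "b > 0" by blast
        then show False by simp
      qed
      obtain q where q: "B = lin q" using linear_form_eq_lin[OF B1(1)] by blast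
      have "q \<noteq> 0" using q nz(2) by (auto simp: lin_def)
      then obtain v where v: "v \<noteq> 0" "dotp q v = 0" "evv v A = 0" using line_meets[OF A1(1) zero_less_one] by blast
      have vB: "evv v B = 0" using v(2) unfolding q by simp
      have mem: "proj_pt v \<in> zero_locus {A}" "proj_pt v \<in> zero_locus {B}"
        using proj_pt_zero_locus_single[OF v(1) A1(1)] proj_pt_zero_locus_single[OF v(1) B1(1)] v(3) vB by simp_all
      show False
      proof (cases "evf f v = 0")
        case True
        then have PZ: "proj_pt v \<in> Z" using mem_Z[OF v(1)] by simp
        \<comment> \<open>A line with n + 1 base points already counted admits no further
          one.\<close>
        have no: False if "D \<in> forms 1" "D \<noteq> 0" "finite SD" "SD \<subseteq> Z" "SD \<subseteq> zero_locus {D}" "card SD = 1 * (n + 1)"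
          "proj_pt v \<in> zero_locus {D}" "proj_pt v \<notin> SD" for D SD
          using base_points_prime[OF that(1) irr[OF that(1,2)], of "insert (proj_pt v) SD"] that PZ by simp
        have "proj_pt v \<notin> SA \<or> proj_pt v \<notin> SB" using disj by blast
        then show False
          using no[OF A1(1) nz(1) fin(1) sub(1,3) A1(2) mem(1)] no[OF B1(1) nz(2) fin(2) sub(2,4) B1(2) mem(2)] by blast
      next
        case False
        have "zero_locus {A} = zero_locus {lin (evf f v)}" "zero_locus {B} = zero_locus {lin (evf f v)}"
          using base_points_prime_eq[OF A1(1) irr[OF A1(1) nz(1)] fin(1) sub(1,3) A1(2) v(1,3) False]
            base_points_prime_eq[OF B1(1) irr[OF B1(1) nz(2)] fin(2) sub(2,4) B1(2) v(1) vB False] by blast+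
        then have "SA = SB" unfolding SA_def SB_def by simp
        then have "SA = {}" using disj by blast
        then show False using A1(2) by simp
      qed
    qed
    moreover have "card S \<le> k * (n + 1)" using kab cu IA IB by linarith
    ultimately show ?thesis by linarith
  qed
qed

lemma base_points_plane_curve:
  assumes "k \<ge> 2" "S \<subseteq> Z" "card S = k * (n + 1)" "plane_curve k C"
  shows "\<not> S \<subseteq> C"
proof
  assume SC: "S \<subseteq> C"
  obtain h where h: "h \<in> forms k" "h \<noteq> 0" "C = zero_locus {h}" using assms(4) unfolding plane_curve_def by blast
  have "finite S" using finite_Z assms(2) finite_subset by blast
  then have "card S < k * (n + 1)"
    using base_points_curve[OF h(1,2) _ _ assms(2)] assms(1) SC h(3) by auto
  then show False using assms(3) by simp
qed

end

section \<open>Simple extensions with a power basis\<close>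

lemma type_ring_simps:
  "carrier (ring_of_type_algebra :: 'a::comm_ring_1 ring) = UNIV"
  "x \<otimes>\<^bsub>ring_of_type_algebra\<^esub> y = x * (y :: 'a)"
  "x \<oplus>\<^bsub>ring_of_type_algebra\<^esub> y = x + y"
  "\<one>\<^bsub>ring_of_type_algebra\<^esub> = (1 :: 'a)"
  "\<zero>\<^bsub>ring_of_type_algebra\<^esub> = (0 :: 'a)"
  by (simp_all add: ring_of_type_algebra_def)

lemma type_field_simps:
  fixes x :: "'a::Fields.field"
  shows "\<ominus>\<^bsub>ring_of_type_algebra\<^esub> x = - x"
    and "x \<noteq> 0 \<Longrightarrow> inv\<^bsub>ring_of_type_algebra\<^esub> x = inverse x"
proof -
  interpret R: field "ring_of_type_algebra :: 'a ring" by (rule field_from_type_algebra)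
  show "\<ominus>\<^bsub>ring_of_type_algebra\<^esub> x = - x"
    by (rule R.minus_equality) (simp_all add: type_ring_simps)
  show "x \<noteq> 0 \<Longrightarrow> inv\<^bsub>ring_of_type_algebra\<^esub> x = inverse x"
    by (rule R.inv_char) (simp_all add: type_ring_simps)
qed

definition power_span :: "'a::Fields.field set \<Rightarrow> 'a \<Rightarrow> nat \<Rightarrow> 'a set" where
  "power_span K t m = {\<Sum>j<m. c j * t ^ j | c. \<forall>j. c j \<in> K}"

lemma power_spanI: "(\<And>j. c j \<in> K) \<Longrightarrow> x = (\<Sum>j<m. c j * t ^ j) \<Longrightarrow> x \<in> power_span K t m"
  unfolding power_span_def by (rule CollectI, rule exI[of _ c]) simp

lemma power_spanE:
  assumes "x \<in> power_span K t m"
  obtains c where "\<forall>j. c j \<in> K" "x = (\<Sum>j<m. c j * t ^ j)"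
  using assms unfolding power_span_def by blast

lemma subfield_type_algebra:
  fixes K :: "'a::Fields.field set"
  assumes "1 \<in> K" "\<And>x. x \<in> K \<Longrightarrow> - x \<in> K" "\<And>x y. x \<in> K \<Longrightarrow> y \<in> K \<Longrightarrow> x + y \<in> K"
    "\<And>x y. x \<in> K \<Longrightarrow> y \<in> K \<Longrightarrow> x * y \<in> K" "\<And>x. x \<in> K \<Longrightarrow> x \<noteq> 0 \<Longrightarrow> inverse x \<in> K"
  shows "subfield K ring_of_type_algebra"
proof -
  interpret R: field "ring_of_type_algebra :: 'a ring" by (rule field_from_type_algebra)
  show ?thesis
    by (intro R.subfieldI' R.subringI) (use assms in \<open>auto simp: type_ring_simps type_field_simps\<close>)
qed

lemma subring_type_algebraD:
  fixes K :: "'a::Fields.field set"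
  assumes "subring K ring_of_type_algebra"
  shows "0 \<in> K" "1 \<in> K" "\<And>x. x \<in> K \<Longrightarrow> - x \<in> K" "\<And>x y. x \<in> K \<Longrightarrow> y \<in> K \<Longrightarrow> x * y \<in> K"
    "\<And>x y. x \<in> K \<Longrightarrow> y \<in> K \<Longrightarrow> x + y \<in> K"
  using subringE(2,3)[OF assms] subringE(5)[OF assms] subringE(6,7)[OF assms]
  by (simp_all add: type_ring_simps type_field_simps)

lemma subfield_type_algebra_inverse:
  fixes K :: "'a::Fields.field set"
  assumes "subfield K ring_of_type_algebra" "x \<in> K" "x \<noteq> 0"
  shows "inverse x \<in> K"
proof -
  interpret R: field "ring_of_type_algebra :: 'a ring" by (rule field_from_type_algebra)
  have "inv\<^bsub>ring_of_type_algebra\<^esub> x \<in> K"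
    using R.subfield_m_inv(1)[OF assms(1)] assms(2,3) by (simp add: type_ring_simps)
  then show ?thesis using assms(3) by (simp add: type_field_simps)
qed

text \<open>By independence each power of t enlarges the span by one dimension. The relation for
  \<open>t ^ m\<close> makes the span closed under multiplication by t, so it is the simple
  extension of K by t. Being finite-dimensional over K, that ring is a field.\<close>

lemma power_basis_extension:
  fixes K :: "'a::Fields.field set"
  assumes K: "subfield K ring_of_type_algebra" and m: "m > 0"
    and indep: "\<And>c. (\<And>j. c j \<in> K) \<Longrightarrow> (\<Sum>j<m. c j * t ^ j) = 0 \<Longrightarrow> \<forall>j<m. c j = 0"
    and rel: "t ^ m \<in> power_span K t m"
  shows "ring.dimension ring_of_type_algebra m K (power_span K t m)"
    and "subfield (power_span K t m) ring_of_type_algebra"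
    and "K \<subseteq> power_span K t m" and "t \<in> power_span K t m"
proof -
  interpret R: field "ring_of_type_algebra :: 'a ring" by (rule field_from_type_algebra)
  have sK: "subring K ring_of_type_algebra" by (rule subfieldE(1)[OF K])
  note K_closed = subring_type_algebraD[OF sK]
  have line: "power_span K t (Suc i) = R.line_extension K (t ^ i) (power_span K t i)" for i
  proof (intro Set.set_eqI)
    fix u
    show "u \<in> power_span K t (Suc i) \<longleftrightarrow> u \<in> R.line_extension K (t ^ i) (power_span K t i)"
    proof
      assume "u \<in> power_span K t (Suc i)"
      then obtain c where c: "\<forall>j. c j \<in> K" "u = (\<Sum>j<Suc i. c j * t ^ j)" unfolding power_span_def by blast
      then have "u = c i * t ^ i + (\<Sum>j<i. c j * t ^ j)" by (simp add: add.commute)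
      moreover have "(\<Sum>j<i. c j * t ^ j) \<in> power_span K t i" by (rule power_spanI[OF _ refl]) (use c(1) in blast)
      ultimately show "u \<in> R.line_extension K (t ^ i) (power_span K t i)"
        unfolding R.line_extension_mem_iff type_ring_simps using c(1) by blast
    next
      assume "u \<in> R.line_extension K (t ^ i) (power_span K t i)"
      then obtain k v where kv: "k \<in> K" "v \<in> power_span K t i" "u = k * t ^ i + v"
        unfolding R.line_extension_mem_iff type_ring_simps by blast
      then obtain c where c: "\<forall>j. c j \<in> K" "v = (\<Sum>j<i. c j * t ^ j)" unfolding power_span_def by blast
      let ?c = "\<lambda>j. if j = i then k else c j"
      show "u \<in> power_span K t (Suc i)"
        by (rule power_spanI[of ?c]) (use kv c in \<open>simp_all add: add.commute\<close>)
    qed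
  qed
  have "R.dimension i K (power_span K t i)" if "i \<le> m" for i
    using that
  proof (induction i)
    case 0
    have "0 \<in> power_span K t 0" by (rule power_spanI[of "\<lambda>_. 0"]) (use K_closed(1) in simp_all)
    then have "power_span K t 0 = {0}" by (auto elim: power_spanE)
    then show ?case using R.zero_dim[of K] by (simp add: type_ring_simps)
  next
    case (Suc i)
    have "t ^ i \<notin> power_span K t i"
    proof
      assume "t ^ i \<in> power_span K t i"
      then obtain c where c: "\<forall>j. c j \<in> K" "t ^ i = (\<Sum>j<i. c j * t ^ j)" unfolding power_span_def by blast
      \<comment> \<open>The coefficient -1 at position i turns the expression for
        \<open>t ^ i\<close> into a nontrivial relation, padded with zeros up to length m.\<close>
      define e where "e = (\<lambda>j. if j < i then c j else if j = i then - 1 else 0)"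
      have e1: "(\<Sum>j<m. e j * t ^ j) = (\<Sum>j\<in>{..<Suc i}. e j * t ^ j)"
      proof (rule sum.mono_neutral_right)
        show "{..<Suc i} \<subseteq> {..<m}" using Suc.prems by auto
        show "\<forall>j\<in>{..<m} - {..<Suc i}. e j * t ^ j = 0" by (simp add: e_def)
      qed simp
      have e2: "(\<Sum>j\<in>{..<i}. e j * t ^ j) = t ^ i"
        unfolding c(2) by (rule sum.cong) (simp_all add: e_def)
      have "(\<Sum>j<m. e j * t ^ j) = 0"
        unfolding e1 sum.lessThan_Suc e2 by (simp add: e_def)
      then have "\<forall>j<m. e j = 0"
        by (intro indep) (use c(1) K_closed in \<open>auto simp: e_def\<close>)
      then have "e i = 0" using Suc.prems by simp
      then show False by (simp add: e_def)
    qed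
    then show ?case unfolding line using Suc by (intro R.Suc_dim) (simp_all add: type_ring_simps)
  qed
  then show dim: "R.dimension m K (power_span K t m)" by simp
  have mem: "k * t ^ j \<in> power_span K t m" if "k \<in> K" "j < m" for k j
  proof -
    have "(\<Sum>i<m. (if i = j then k else 0) * t ^ i) = (\<Sum>i<m. if i = j then k * t ^ j else 0)"
      by (rule sum.cong) auto
    then have "k * t ^ j = (\<Sum>i<m. (if i = j then k else 0) * t ^ i)" using that(2) by simp
    then show ?thesis by (rule power_spanI[rotated]) (use that(1) K_closed(1) in simp)
  qed
  have add: "x + y \<in> power_span K t m" if x: "x \<in> power_span K t m" and y: "y \<in> power_span K t m" for x y
  proof -
    obtain c where c: "\<forall>j. c j \<in> K" "x = (\<Sum>j<m. c j * t ^ j)" using power_spanE[OF x] by blast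
    obtain e where e: "\<forall>j. e j \<in> K" "y = (\<Sum>j<m. e j * t ^ j)" using power_spanE[OF y] by blast
    show ?thesis
      by (rule power_spanI[of "\<lambda>j. c j + e j"]) (use c e K_closed in \<open>simp_all add: distrib_right sum.distrib\<close>)
  qed
  have smult: "k * x \<in> power_span K t m" if k: "k \<in> K" and x: "x \<in> power_span K t m" for k x
  proof -
    obtain c where c: "\<forall>j. c j \<in> K" "x = (\<Sum>j<m. c j * t ^ j)" using power_spanE[OF x] by blast
    show ?thesis
      by (rule power_spanI[of "\<lambda>j. k * c j"]) (use c k K_closed in \<open>simp_all add: sum_distrib_left mult.assoc\<close>)
  qed
  have sum_mem: "(\<Sum>j\<in>A. u j) \<in> power_span K t m" if "\<And>j. j \<in> A \<Longrightarrow> u j \<in> power_span K t m" "finite A" for u and A :: "nat set"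
    using that(2,1)
  proof (induction A rule: finite_induct)
    case empty
    show ?case using mem[OF K_closed(1) m] by simp
  qed (simp add: add)
  have times_t: "x * t \<in> power_span K t m" if x: "x \<in> power_span K t m" for x
  proof -
    obtain c where c: "\<forall>j. c j \<in> K" "x = (\<Sum>j<m. c j * t ^ j)" using power_spanE[OF x] by blast
    have "c j * t ^ Suc j \<in> power_span K t m" if "j < m" for j
    proof (cases "Suc j < m")
      case True
      then show ?thesis using mem c(1) by blast
    next
      case False
      then have "Suc j = m" using that by simp
      then show ?thesis using smult rel c(1) by simp
    qed
    then have "(\<Sum>j<m. c j * t ^ Suc j) \<in> power_span K t m" by (intro sum_mem) auto
    moreover have "x * t = (\<Sum>j<m. c j * t ^ Suc j)" unfolding c(2) sum_distrib_right power_Suc2 mult.assoc by (rule refl)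
    ultimately show ?thesis by simp
  qed
  have K_sub: "k \<in> power_span K t m" if "k \<in> K" for k using mem[OF that m] by simp
  then show "K \<subseteq> power_span K t m" by blast
  have "1 * t \<in> power_span K t m" by (rule times_t[OF K_sub[OF K_closed(2)]])
  then show "t \<in> power_span K t m" by simp
  have eq: "power_span K t m = R.simple_extension K t"
  proof
    show "R.simple_extension K t \<subseteq> power_span K t m"
    proof
      fix x assume "x \<in> R.simple_extension K t"
      then show "x \<in> power_span K t m"
      proof (induction rule: R.simple_extension.induct)
        case zero
        then show ?case using K_sub[OF K_closed(1)] by (simp add: type_ring_simps)
      next
        case (lin k1 k2)
        then show ?case using add[OF times_t K_sub] by (simp add: type_ring_simps)
      qed
    qed
    have t: "t \<in> carrier ring_of_type_algebra" by (simp add: type_ring_simps)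
    have sE: "subring (R.simple_extension K t) ring_of_type_algebra" by (rule R.simple_extension_is_subring[OF sK t])
    note E_closed = subring_type_algebraD[OF sE]
    have KE: "K \<subseteq> R.simple_extension K t" using R.simple_extension_incl[OF _ t] by (simp add: type_ring_simps)
    have tE: "t \<in> R.simple_extension K t" by (rule R.simple_extension_mem[OF sK t])
    have pw: "t ^ j \<in> R.simple_extension K t" for j by (induction j) (use E_closed tE in auto)
    show "power_span K t m \<subseteq> R.simple_extension K t"
    proof
      fix x assume "x \<in> power_span K t m"
      then obtain c where c: "\<forall>j. c j \<in> K" "x = (\<Sum>j<m. c j * t ^ j)" unfolding power_span_def by blast
      have "c j * t ^ j \<in> R.simple_extension K t" for j
        by (rule E_closed(4)[OF _ pw]) (use KE c(1) in blast)
      then have "(\<Sum>j<i. c j * t ^ j) \<in> R.simple_extension K t" for i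
        by (induction i) (use E_closed in auto)
      then show "x \<in> R.simple_extension K t" unfolding c(2) .
    qed
  qed
  have "subfield (R.simple_extension K t) ring_of_type_algebra"
  proof -
    have t: "t \<in> carrier ring_of_type_algebra" by (simp add: type_ring_simps)
    have "R.finite_dimension K (R.simple_extension K t)"
      using R.finite_dimensionI[OF dim] unfolding eq .
    then show ?thesis
      using R.finite_dimension_simple_extension[OF K t] R.simple_extension_is_subfield[OF K t] by simp
  qed
  then show "subfield (power_span K t m) ring_of_type_algebra" unfolding eq .
qed

section \<open>Evaluation at linear polynomials\<close>

lemma coeff_mult_bounds:
  fixes p q :: "'a::comm_ring_1 poly"
  assumes "Polynomial.degree p \<le> a" "Polynomial.degree q \<le> b"
  shows "Polynomial.coeff (p * q) (a + b) = Polynomial.coeff p a * Polynomial.coeff q b"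
proof -
  have "Polynomial.coeff (p * q) (a + b) = (\<Sum>i\<le>a + b. if i = a then Polynomial.coeff p a * Polynomial.coeff q b else 0)"
    unfolding coeff_mult
  proof (rule sum.cong[OF refl])
    fix i assume "i \<in> {..a + b}"
    show "Polynomial.coeff p i * Polynomial.coeff q (a + b - i) = (if i = a then Polynomial.coeff p a * Polynomial.coeff q b else 0)"
    proof (cases i a rule: linorder_cases)
      case less
      then have "b < a + b - i" by simp
      then have "Polynomial.coeff q (a + b - i) = 0" using assms(2) by (intro coeff_eq_0) simp
      then show ?thesis using less by simp
    next
      case greater
      then have "Polynomial.coeff p i = 0" using assms(1) by (intro coeff_eq_0) simp
      then show ?thesis using greater by simp
    qed simp
  qed
  also have "\<dots> = Polynomial.coeff p a * Polynomial.coeff q b" by simp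
  finally show ?thesis .
qed

text \<open>A leading coefficient with respect to a prescribed degree bound; it may be 0, so it is
  compatible with sums and products without any condition on actual degrees.\<close>

definition top_coeff :: "nat \<Rightarrow> 'a::comm_ring_1 poly \<Rightarrow> 'a \<Rightarrow> bool" where
  "top_coeff a p c \<longleftrightarrow> Polynomial.degree p \<le> a \<and> Polynomial.coeff p a = c"

lemma top_coeff_mult: "top_coeff a p c \<Longrightarrow> top_coeff b q d \<Longrightarrow> top_coeff (a + b) (p * q) (c * d)"
  unfolding top_coeff_def using coeff_mult_bounds[of p a q b] Polynomial.degree_mult_le[of p q] by auto

lemma top_coeff_const: "top_coeff 0 [:c:] c"
  by (simp add: top_coeff_def)

lemma top_coeff_power: "top_coeff a p c \<Longrightarrow> top_coeff (a * k) (p ^ k) (c ^ k)"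
proof (induction k)
  case 0
  show ?case using top_coeff_const[of 1] by (simp add: one_pCons)
next
  case (Suc k)
  then show ?case using top_coeff_mult[of a p c "a * k" "p ^ k" "c ^ k"] by simp
qed

lemma top_coeff_prod:
  "finite A \<Longrightarrow> (\<And>x. x \<in> A \<Longrightarrow> top_coeff (e x) (u x) (c x)) \<Longrightarrow> top_coeff (sum e A) (prod u A) (prod c A)"
proof (induction A rule: finite_induct)
  case empty
  show ?case using top_coeff_const[of 1] by (simp add: one_pCons)
next
  case (insert x A)
  then show ?case using top_coeff_mult[of "e x" "u x" "c x" "sum e A" "prod u A" "prod c A"] by simp
qed

lemma top_coeff_sum:
  "finite A \<Longrightarrow> (\<And>x. x \<in> A \<Longrightarrow> top_coeff a (u x) (c x)) \<Longrightarrow> top_coeff a (sum u A) (sum c A)"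
  unfolding top_coeff_def by (auto simp: coeff_sum intro!: degree_sum_le)

text \<open>Every monomial of a form contributes exactly m factors of degree bound 1, so all of them
  reach the same bound and their top coefficients add up.\<close>

lemma top_coeff_pm_eval:
  fixes F :: "'v::finite cpoly"
  assumes F: "F \<in> forms m" and s: "\<And>i. top_coeff 1 (s i) (c i)"
  shows "top_coeff m (pm_eval (\<lambda>z. [:\<phi> z:]) s F) (pm_eval \<phi> c F)"
  unfolding pm_eval_def
proof (rule top_coeff_sum[OF finite_keys])
  fix x assume x: "x \<in> Poly_Mapping.keys F"
  have "top_coeff (\<Sum>i\<in>UNIV. 1 * Poly_Mapping.lookup x i) (\<Prod>i\<in>UNIV. s i ^ Poly_Mapping.lookup x i) (\<Prod>i\<in>UNIV. c i ^ Poly_Mapping.lookup x i)"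
    by (intro top_coeff_prod finite top_coeff_power s)
  moreover have e: "(\<Sum>i\<in>UNIV. 1 * Poly_Mapping.lookup x i) = m" using F x by (simp add: forms_def)
  ultimately have t: "top_coeff m (\<Prod>i\<in>UNIV. s i ^ Poly_Mapping.lookup x i) (\<Prod>i\<in>UNIV. c i ^ Poly_Mapping.lookup x i)"
    by (simp only: e)
  show "top_coeff m ([:\<phi> (Poly_Mapping.lookup F x):] * (\<Prod>i\<in>UNIV. s i ^ Poly_Mapping.lookup x i))
      (\<phi> (Poly_Mapping.lookup F x) * (\<Prod>i\<in>UNIV. c i ^ Poly_Mapping.lookup x i))"
    using top_coeff_mult[OF top_coeff_const t] by simp
qed

section \<open>The extension of function fields\<close>

lemma comm_ring_hom_to_fract: "comm_ring_hom to_fract"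
  by unfold_locales simp_all

interpretation to_fract: comm_ring_hom to_fract
  by (rule comm_ring_hom_to_fract)

lemma comm_ring_hom_fract_Const: "comm_ring_hom (\<lambda>z. to_fract (Const z :: 3 cpoly))"
  by (rule comm_ring_hom_comp[OF comm_ring_hom_to_fract comm_ring_hom_Const])

lemma pm_eval_closed:
  assumes z: "0 \<in> S" "1 \<in> S" and add: "\<And>x y. x \<in> S \<Longrightarrow> y \<in> S \<Longrightarrow> x + y \<in> S"
    and mult: "\<And>x y. x \<in> S \<Longrightarrow> y \<in> S \<Longrightarrow> x * y \<in> S"
    and c: "\<And>z. \<phi> z \<in> S" and v: "\<And>i. v i \<in> S"
  shows "pm_eval \<phi> v F \<in> S"
proof -
  have pw: "x ^ k \<in> S" if "x \<in> S" for x k by (induction k) (use z mult that in auto)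
  have pr: "finite A \<Longrightarrow> (\<And>i. i \<in> A \<Longrightarrow> u i \<in> S) \<Longrightarrow> prod u A \<in> S" for A u
    by (induction A rule: finite_induct) (use z mult in auto)
  have sm: "finite A \<Longrightarrow> (\<And>i. i \<in> A \<Longrightarrow> u i \<in> S) \<Longrightarrow> sum u A \<in> S" for A and u :: "('b \<Rightarrow>\<^sub>0 nat) \<Rightarrow> 'a"
    by (induction A rule: finite_induct) (use z add in auto)
  show ?thesis unfolding pm_eval_def by (intro sm mult c pr pw v finite finite_keys)
qed

lemma pm_eval_to_fract:
  fixes w :: "'v::finite \<Rightarrow> 3 cpoly"
  shows "pm_eval (\<lambda>z. to_fract (Const z)) (\<lambda>i. to_fract (w i)) F = to_fract (cpoly_subst w F)"
  by (rule comm_ring_hom_unique[OF comm_ring_hom_pm_eval[OF comm_ring_hom_fract_Const]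
        comm_ring_hom_comp[OF comm_ring_hom_to_fract comm_ring_hom_cpoly_subst]])
    (simp_all add: comm_ring_hom_fract_Const)

lemma poly_pm_eval:
  assumes "comm_ring_hom \<phi>"
  shows "poly (pm_eval (\<lambda>z. [:\<phi> z:]) s F) x = pm_eval \<phi> (\<lambda>i. poly (s i) x) F"
proof -
  have h: "comm_ring_hom (\<lambda>z. [:\<phi> z:])" by (rule comm_ring_hom_comp[OF comm_ring_hom_const_poly assms])
  show ?thesis
    by (rule comm_ring_hom_unique[OF comm_ring_hom_comp[OF comm_ring_hom_poly comm_ring_hom_pm_eval[OF h]] comm_ring_hom_pm_eval[OF assms]])
      (simp_all add: h assms)
qed

lemma mem_function_field:
  "x \<in> function_field \<longleftrightarrow> (\<exists>F G m. F \<in> forms m \<and> G \<in> forms m \<and> G \<noteq> 0 \<and> x = to_fract F / to_fract G)"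
  unfolding function_field_def Fract_conv_to_fract by blast

lemma function_field_add:
  assumes "x \<in> function_field" "y \<in> function_field"
  shows "x + y \<in> function_field"
proof -
  obtain F G m where x: "F \<in> forms m" "G \<in> forms m" "G \<noteq> 0" "x = to_fract F / to_fract G"
    using assms(1) unfolding mem_function_field by blast
  obtain F' G' m' where y: "F' \<in> forms m'" "G' \<in> forms m'" "G' \<noteq> 0" "y = to_fract F' / to_fract G'"
    using assms(2) unfolding mem_function_field by blast
  have "x + y = to_fract (F * G' + F' * G) / to_fract (G * G')"
    using x y by (simp add: add_frac_eq)
  moreover have "F * G' + F' * G \<in> forms (m + m')" "G * G' \<in> forms (m + m')"
    using forms_mult[OF x(1) y(2)] forms_mult[OF y(1) x(2)] forms_mult[OF x(2) y(2)] forms_add by (simp_all add: add.commute)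
  moreover have "G * G' \<noteq> 0" using x y by simp
  ultimately show ?thesis unfolding mem_function_field by blast
qed

lemma function_field_mult:
  assumes "x \<in> function_field" "y \<in> function_field"
  shows "x * y \<in> function_field"
proof -
  obtain F G m where x: "F \<in> forms m" "G \<in> forms m" "G \<noteq> 0" "x = to_fract F / to_fract G"
    using assms(1) unfolding mem_function_field by blast
  obtain F' G' m' where y: "F' \<in> forms m'" "G' \<in> forms m'" "G' \<noteq> 0" "y = to_fract F' / to_fract G'"
    using assms(2) unfolding mem_function_field by blast
  have "x * y = to_fract (F * F') / to_fract (G * G')" using x y by simp
  moreover have "F * F' \<in> forms (m + m')" "G * G' \<in> forms (m + m')"
    using forms_mult[OF x(1) y(1)] forms_mult[OF x(2) y(2)] by simp_all
  moreover have "G * G' \<noteq> 0" using x y by simp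
  ultimately show ?thesis unfolding mem_function_field by blast
qed

section \<open>The pulled back field and its generator over the function field\<close>

context laguerre_net
begin

abbreviation pb :: "3 cpoly \<Rightarrow> 3 cpoly" where
  "pb \<equiv> cpoly_subst f"

lemma pb_form: "F \<in> forms m \<Longrightarrow> pb F \<in> forms ((n + 1) * m)"
  by (rule cpoly_subst_forms[OF _ f_form])

lemma evv_pb: "evv v (pb F) = evv (evf f v) F"
proof -
  have "($) (evf f v) = (\<lambda>i. evv v (f i))" by (rule ext) simp
  then show ?thesis by (simp add: cpoly_eval_subst)
qed

text \<open>A form with zero pullback vanishes on the image of f, which is dense.\<close>

lemma pb_inj: "F \<in> forms m \<Longrightarrow> pb F = 0 \<Longrightarrow> F = 0"
  by (erule form_zero_if_vanishes_on_image) (simp flip: evv_pb)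

lemma mem_pullback_field:
  "x \<in> pullback_field f \<longleftrightarrow> (\<exists>F G m. F \<in> forms m \<and> G \<in> forms m \<and> pb G \<noteq> 0 \<and> x = to_fract (pb F) / to_fract (pb G))"
  unfolding pullback_field_def Fract_conv_to_fract by blast

lemma pullback_subfield: "subfield (pullback_field f) ring_of_type_algebra"
proof (rule subfield_type_algebra)
  show "1 \<in> pullback_field f"
    unfolding mem_pullback_field by (rule exI[of _ 1], rule exI[of _ 1], rule exI[of _ 0]) simp
next
  fix x assume "x \<in> pullback_field f"
  then obtain F G m where x: "F \<in> forms m" "G \<in> forms m" "pb G \<noteq> 0" "x = to_fract (pb F) / to_fract (pb G)"
    unfolding mem_pullback_field by blast
  have "- x = to_fract (pb (- F)) / to_fract (pb G)" using x by (simp add: sb.hom_uminus)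
  then show "- x \<in> pullback_field f" unfolding mem_pullback_field using x forms_uminus by blast
  assume "x \<noteq> 0"
  then have nz: "pb F \<noteq> 0" using x by auto
  have "inverse x = to_fract (pb G) / to_fract (pb F)" unfolding x(4) by (rule inverse_divide)
  then show "inverse x \<in> pullback_field f" unfolding mem_pullback_field using x nz by blast
next
  fix x y assume "x \<in> pullback_field f" "y \<in> pullback_field f"
  then obtain F G m F' G' m' where x: "F \<in> forms m" "G \<in> forms m" "pb G \<noteq> 0" "x = to_fract (pb F) / to_fract (pb G)"
    and y: "F' \<in> forms m'" "G' \<in> forms m'" "pb G' \<noteq> 0" "y = to_fract (pb F') / to_fract (pb G')"
    unfolding mem_pullback_field by blast
  have f: "F * G' + F' * G \<in> forms (m + m')" "F * F' \<in> forms (m + m')" "G * G' \<in> forms (m + m')"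
    using forms_mult[OF x(1) y(2)] forms_mult[OF y(1) x(2)] forms_mult[OF x(1) y(1)] forms_mult[OF x(2) y(2)] forms_add
    by (simp_all add: add.commute)
  have nz: "pb (G * G') \<noteq> 0" using x y by (simp add: sb.hom_mult)
  have "x + y = to_fract (pb (F * G' + F' * G)) / to_fract (pb (G * G'))"
    using x y by (simp add: add_frac_eq sb.hom_add sb.hom_mult)
  then show "x + y \<in> pullback_field f" unfolding mem_pullback_field using f nz by blast
  have "x * y = to_fract (pb (F * F')) / to_fract (pb (G * G'))" using x y by (simp add: sb.hom_mult)
  then show "x * y \<in> pullback_field f" unfolding mem_pullback_field using f nz by blast
qed

lemmas pullback_closed = subring_type_algebraD[OF subfieldE(1)[OF pullback_subfield]]

text \<open>A common denominator and a common degree e are what make a relation bihomogeneous once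
  denominators are cleared.\<close>

lemma pullback_common_denominator:
  fixes m :: nat
  assumes "\<And>j. c j \<in> pullback_field f"
  shows "\<exists>A G e. (\<forall>j<m. A j \<in> forms e \<and> c j = to_fract (pb (A j)) / to_fract (pb G)) \<and> G \<in> forms e \<and> pb G \<noteq> 0"
proof (induction m)
  case 0
  show ?case by (rule exI[of _ "\<lambda>_. 0"], rule exI[of _ 1], rule exI[of _ 0]) simp
next
  case (Suc m)
  then obtain A G e where A: "\<forall>j<m. A j \<in> forms e \<and> c j = to_fract (pb (A j)) / to_fract (pb G)" and G: "G \<in> forms e" "pb G \<noteq> 0"
    by blast
  obtain F H s where FH: "F \<in> forms s" "H \<in> forms s" "pb H \<noteq> 0" "c m = to_fract (pb F) / to_fract (pb H)"
    using assms[of m] unfolding mem_pullback_field by blast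
  define A' where "A' = (\<lambda>j. if j = m then F * G else A j * H)"
  have "A' j \<in> forms (e + s) \<and> c j = to_fract (pb (A' j)) / to_fract (pb (G * H))" if "j < Suc m" for j
  proof (cases "j = m")
    case True
    then show ?thesis using FH G forms_mult[OF FH(1) G(1)] by (simp add: A'_def sb.hom_mult add.commute)
  next
    case False
    then have Aj: "A j \<in> forms e" "c j = to_fract (pb (A j)) / to_fract (pb G)" using A that by auto
    show ?thesis using False FH G forms_mult[OF Aj(1) FH(2)] by (simp add: A'_def sb.hom_mult Aj(2))
  qed
  moreover have "G * H \<in> forms (e + s)" "pb (G * H) \<noteq> 0" using G FH forms_mult by (simp_all add: sb.hom_mult)
  ultimately show ?case by blast
qed

text \<open>Replacing the pullbacks by forms in the second set of variables gives an equation of the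
  graph of bidegree (n - 1, e), which vanishes on every line q . x = 0. If q_2 is nonzero, x_0 and
  x_1 are free coordinates on that line, so all coefficients A_j(q) are 0.\<close>

lemma pullback_independent_forms:
  assumes A: "\<And>j. j < n \<Longrightarrow> A j \<in> forms e"
    and rel: "(\<Sum>j<n. pb (A j) * (Var 0 ^ j * Var 1 ^ (n - 1 - j))) = 0" and j: "j < n"
  shows "A j = 0"
proof -
  define P :: "(3 + 3) cpoly" where
    "P = (\<Sum>j<n. cpoly_subst (\<lambda>i. Var (Inr i)) (A j) * (Var (Inl 0) ^ j * Var (Inl 1) ^ (n - 1 - j)))"
  have "cpoly_subst (\<lambda>i. Var (Inr i)) (A j) * (Var (Inl 0) ^ j * Var (Inl 1) ^ (n - 1 - j)) \<in> biforms (n - 1) e" if "j < n" for j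
  proof -
    have "cpoly_subst (\<lambda>i. Var (Inr i)) (A j) * (Var (Inl 0) ^ j * Var (Inl 1) ^ (n - 1 - j)) \<in>
      biforms (0 * e + (1 * j + 1 * (n - 1 - j))) (1 * e + (0 * j + 0 * (n - 1 - j)))"
      by (intro biforms_mult biforms_power biforms_VarL cpoly_subst_biforms[OF A[OF that]] biforms_VarR)
    then show ?thesis using that by simp
  qed
  then have Pb: "P \<in> biforms (n - 1) e" unfolding P_def by (intro biforms_sum) simp
  have evP: "cpoly_eval (case_sum (($) v) (($) y)) P = (\<Sum>j<n. evv y (A j) * (v $ 0 ^ j * v $ 1 ^ (n - 1 - j)))" for v y
    by (simp add: P_def ev.hom_simps cpoly_eval_subst)
  have "P \<in> graph_closure_forms f"
  proof (rule graph_closure_formsI[OF Pb])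
    fix v
    have "evv v (\<Sum>j<n. pb (A j) * (Var 0 ^ j * Var 1 ^ (n - 1 - j))) = 0" unfolding rel by simp
    then show "cpoly_eval (case_sum (($) v) (($) (evf f v))) P = 0"
      unfolding evP by (simp add: ev.hom_simps evv_pb)
  qed
  note PG = this Pb
  show "A j = 0"
  proof (rule evv_zero_generic[OF Var_neq_0[of 2]])
    fix q assume "evv q (Var 2) \<noteq> 0"
    then have q2: "q $ 2 \<noteq> 0" by simp
    let ?S = "sub_right (\<lambda>j. Const (q $ j)) P"
    have r0: "reduce q 2 ?S = 0" by (rule reduce_low_degree[OF PG q2]) (use n_pos in simp)
    define a where "a = (\<Sum>j<n. Polynomial.monom (evv q (A j)) j)"
    have "poly a x = 0" for x
    proof -
      \<comment> \<open>The point of the line q . x = 0 with x_0 = x and x_1 = 1.\<close>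
      define v :: "complex ^ 3" where "v = (\<chi> i. if i = 0 then x else if i = 1 then 1 else - (q $ 0 * x + q $ 1) / q $ 2)"
      have v: "v $ 0 = x" "v $ 1 = 1" "v $ 2 = - (q $ 0 * x + q $ 1) / q $ 2" by (simp_all add: v_def)
      have "dotp q v = 0" unfolding dotp_3 v using q2 by simp
      then have "evv v ?S = 0" using r0 unfolding reduce_eq_0_iff_vanish[OF q2] by blast
      moreover have "evf (\<lambda>j. Const (q $ j)) v = q" by (simp add: vec_eq_iff)
      ultimately have "(\<Sum>j<n. evv q (A j) * x ^ j) = 0" unfolding evv_sub_right evP v by simp
      then show ?thesis by (simp add: a_def poly_sum poly_monom)
    qed
    then have "a = 0" using poly_all_0_iff_0 by blast
    then have "Polynomial.coeff a j = 0" by simp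
    moreover have "Polynomial.coeff a j = (\<Sum>i<n. if i = j then evv q (A j) else 0)"
      unfolding a_def coeff_sum by (rule sum.cong) auto
    ultimately show "evv q (A j) = 0" using j by simp
  qed
qed

definition tt :: "3 cpoly fract" where
  "tt = to_fract (Var 0) / to_fract (Var 1)"

lemma tt_independent:
  assumes c: "\<And>j. c j \<in> pullback_field f" and rel: "(\<Sum>j<n. c j * tt ^ j) = 0"
  shows "\<forall>j<n. c j = 0"
proof -
  obtain A G e where A: "\<forall>j<n. A j \<in> forms e \<and> c j = to_fract (pb (A j)) / to_fract (pb G)" and G: "G \<in> forms e" "pb G \<noteq> 0"
    using pullback_common_denominator[of c n] c by blast
  let ?x0 = "to_fract (Var 0 :: 3 cpoly)" and ?x1 = "to_fract (Var 1 :: 3 cpoly)"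
  have x1: "?x1 \<noteq> 0" using Var_neq_0 by simp
  \<comment> \<open>The relation is multiplied by the common denominator and by x_1^(n - 1), which
    turns it into a relation between forms.\<close>
  have e: "to_fract (pb (A j) * (Var 0 ^ j * Var 1 ^ (n - 1 - j))) = (to_fract (pb G) * ?x1 ^ (n - 1)) * (c j * tt ^ j)" if j: "j < n" for j
  proof -
    have "?x1 ^ (n - 1) = ?x1 ^ j * ?x1 ^ (n - 1 - j)" using j by (simp flip: power_add)
    then have "?x1 ^ (n - 1) * tt ^ j = ?x0 ^ j * ?x1 ^ (n - 1 - j)"
      unfolding tt_def using x1 by (simp add: power_divide)
    moreover have "to_fract (pb G) * c j = to_fract (pb (A j))" using A G j by simp
    ultimately have "(to_fract (pb G) * c j) * (?x1 ^ (n - 1) * tt ^ j) = to_fract (pb (A j)) * (?x0 ^ j * ?x1 ^ (n - 1 - j))" by simp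
    then show ?thesis by (simp add: to_fract.hom_power mult_ac)
  qed
  have "to_fract (\<Sum>j<n. pb (A j) * (Var 0 ^ j * Var 1 ^ (n - 1 - j))) = (\<Sum>j<n. (to_fract (pb G) * ?x1 ^ (n - 1)) * (c j * tt ^ j))"
    unfolding to_fract.hom_sum by (rule sum.cong[OF refl]) (use e in blast)
  also have "\<dots> = 0" unfolding sum_distrib_left[symmetric] rel by simp
  finally have "(\<Sum>j<n. pb (A j) * (Var 0 ^ j * Var 1 ^ (n - 1 - j))) = 0" unfolding to_fract_eq_0_iff .
  then have "A j = 0" if "j < n" for j using pullback_independent_forms[of A e j] A that by blast
  then show ?thesis using A by simp
qed

lemma f_dot_g: "(\<Sum>i\<in>UNIV. f i * g i) = 0"
proof (rule evv_zero_imp_zero)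
  fix v
  have "evv v (\<Sum>i\<in>UNIV. f i * g i) = dotp (evf f v) (evf g v)" by (simp add: dotp_def ev.hom_simps)
  then show "evv v (\<Sum>i\<in>UNIV. f i * g i) = 0" by (simp only: dotp_f_g)
qed

lemma f2_nonzero: "f 2 \<noteq> 0"
  using pb_inj[OF forms_Var, of 2] Var_neq_0[of 2] by auto

lemma fract_relation_tt:
  "- (to_fract (f 1) / to_fract (f 2)) - to_fract (f 0) / to_fract (f 2) * tt = to_fract (Var 2) / to_fract (Var 1)"
proof -
  let ?x0 = "to_fract (Var 0 :: 3 cpoly)" and ?x1 = "to_fract (Var 1 :: 3 cpoly)" and ?x2 = "to_fract (Var 2 :: 3 cpoly)"
  have nz: "?x1 \<noteq> 0" "to_fract (f 2) \<noteq> 0" using Var_neq_0 f2_nonzero by simp_all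
  have "Var 2 * f 2 = - (Var 0 * f 0 + Var 1 * f 1)" using x_dot_f[of 2] unfolding three_simps .
  then have "to_fract (Var 2 * f 2) = to_fract (- (Var 0 * f 0 + Var 1 * f 1))" by (simp only:)
  then have "?x2 * to_fract (f 2) = - (?x0 * to_fract (f 0) + ?x1 * to_fract (f 1))"
    by (simp only: to_fract_mult to_fract_uminus to_fract_add)
  then have "?x2 / ?x1 = - (?x0 * to_fract (f 0) + ?x1 * to_fract (f 1)) / (to_fract (f 2) * ?x1)"
    using nz by (simp add: frac_eq_eq)
  also have "\<dots> = - (to_fract (f 1) / to_fract (f 2)) - to_fract (f 0) / to_fract (f 2) * tt"
    using nz by (simp add: tt_def diff_divide_distrib mult.commute)
  finally show ?thesis by simp
qed

text \<open>Coefficient of the top power of \<open>x\<^sub>0\<close> in \<open>y \<cdot> g\<close> restricted to the line \<open>y \<cdot> x = 0\<close>; it is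
  nonzero because otherwise the line \<open>x\<^sub>1 = 0\<close> would consist of base points.\<close>

definition top_form :: "3 cpoly" where
  "top_form = (\<Sum>r\<in>UNIV. Var r * cpoly_subst (\<lambda>i. if i = 0 then Var 2 else if i = 1 then 0 else - Var 0) (g r))"

lemma top_form_form: "top_form \<in> forms (1 + 1 * n)"
  unfolding top_form_def
  by (intro forms_sum forms_mult forms_Var cpoly_subst_forms[OF g_form]) (auto intro: forms_uminus)

lemma top_form_nonzero: "top_form \<noteq> 0"
proof
  assume 0: "top_form = 0"
  have ev0: "dotp y (evf g z) = 0" if "z $ 0 = y $ 2" "z $ 1 = 0" "z $ 2 = - y $ 0" for y z
  proof -
    have "(\<lambda>i. evv y (if i = 0 then Var 2 else if i = 1 then 0 else - Var 0)) = ($) z"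
    proof
      fix i show "evv y (if i = 0 then Var 2 else if i = 1 then 0 else - Var 0) = z $ i"
        using cases_3[of i] that by (auto simp: ev.hom_simps)
    qed
    then have "evv y top_form = dotp y (evf g z)"
      by (simp add: top_form_def ev.hom_simps cpoly_eval_subst dotp_def)
    then show ?thesis using 0 by simp
  qed
  have "evf f z = 0" if z: "z $ 1 = 0" for z
  proof -
    \<comment> \<open>The vectors (-z_2, a, z_0) are orthogonal to z for every a, since z_1 = 0. The
      resulting relation is affine in a, so its slope g_1(z) and its constant term vanish
      separately.\<close>
    define y :: "complex \<Rightarrow> complex ^ 3" where "y a = (\<chi> i. if i = 0 then - z $ 2 else if i = 1 then a else z $ 0)" for a
    have y: "y a $ 0 = - z $ 2" "y a $ 1 = a" "y a $ 2 = z $ 0" for a by (simp_all add: y_def)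
    have e: "- z $ 2 * evv z (g 0) + a * evv z (g 1) + z $ 0 * evv z (g 2) = 0" for a
      using ev0[of z "y a"] z unfolding dotp_3 y by simp
    have g1: "evv z (g 1) = 0" using e[of 0] e[of 1] by simp
    have g02: "z $ 2 * evv z (g 0) = z $ 0 * evv z (g 2)" using e[of 0] by simp
    have "\<forall>i. evf f z $ i = 0"
      unfolding all_3 evf_f cross_components evf_nth using z g1 g02 by simp
    then show ?thesis by (simp add: vec_eq_iff)
  qed
  note base = this
  have sub: "zero_locus {lin (axis 1 1)} \<subseteq> Z"
  proof
    fix P assume P: "P \<in> zero_locus {lin (axis 1 1)}"
    then have "P \<in> P2" using zero_locus_P2 by blast
    then obtain v where v: "v \<noteq> 0" "P = proj_pt v" by (rule P2_cases)
    have "dotp (axis 1 1) v = 0" using P v by simp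
    then have "v $ 1 = 0" using dotp_commute[of "axis 1 1" v] by simp
    from base[OF this] show "P \<in> Z" unfolding v(2) mem_Z[OF v(1)] .
  qed
  have nz: "axis 1 1 \<noteq> (0 :: complex ^ 3)" by (simp add: axis_eq_0_iff)
  show False using infinite_line[OF nz] finite_subset[OF sub finite_Z] by blast
qed

text \<open>The point x / x_1 is (t, 1, -u_1 - u_0 t) with u_r = f_r / f_2 in K. Inserting it into f
  . g = 0 divided by f_2 gives a polynomial P over K of degree at most n with root t; the relation
  follows on dividing by its n-th coefficient.\<close>

lemma tt_relation: "tt ^ n \<in> power_span (pullback_field f) tt n"
proof -
  let ?K = "pullback_field f" and ?C = "\<lambda>z. to_fract (Const z :: 3 cpoly)"
  let ?x1 = "to_fract (Var 1 :: 3 cpoly)" and ?f2 = "to_fract (f 2)"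
  have x1: "?x1 \<noteq> 0" and f2: "?f2 \<noteq> 0" using Var_neq_0 f2_nonzero by simp_all
  define u where "u r = to_fract (f r) / ?f2" for r
  have uK: "u r \<in> ?K" for r
    unfolding mem_pullback_field u_def
    by (rule exI[of _ "Var r"], rule exI[of _ "Var 2"], rule exI[of _ 1]) (use f2_nonzero in simp)
  have CK: "?C z \<in> ?K" for z
    unfolding mem_pullback_field by (rule exI[of _ "Const z"], rule exI[of _ 1], rule exI[of _ 0]) simp
  \<comment> \<open>The coordinates of x / x_1 as polynomials in t; c below lists their coefficients
    of t, so the n-th coefficient of each g_r(s) is g_r(c).\<close>
  define s where "s i = (if i = 0 then [:0, 1:] else if i = 1 then [:1:] else [:- u 1, - u 0:])" for i :: 3
  define c where "c i = (if i = 0 then 1 else if i = 1 then 0 else - u 0)" for i :: 3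
  define p where "p r = pm_eval (\<lambda>z. [:?C z:]) s (g r)" for r
  define P where "P = (\<Sum>r\<in>UNIV. [:u r:] * p r)"
  define S where "S = {q. \<forall>k. Polynomial.coeff q k \<in> ?K}"
  have sumK: "finite A \<Longrightarrow> (\<And>x. x \<in> A \<Longrightarrow> w x \<in> ?K) \<Longrightarrow> sum w A \<in> ?K" for A and w :: "nat \<Rightarrow> 3 cpoly fract"
    by (induction A rule: finite_induct) (use pullback_closed in auto)
  have S_mult: "x * y \<in> S" if "x \<in> S" "y \<in> S" for x y
    using that pullback_closed(4) unfolding S_def by (auto simp: coeff_mult intro!: sumK)
  have S_add: "x + y \<in> S" if "x \<in> S" "y \<in> S" for x y
    using that pullback_closed(5) unfolding S_def by simp
  have S_const: "[:z:] \<in> S" if "z \<in> ?K" for z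
    using that pullback_closed(1) unfolding S_def by (auto simp: coeff_pCons split: nat.split)
  have S_lin: "[:z, w:] \<in> S" if "z \<in> ?K" "w \<in> ?K" for z w
    using that pullback_closed(1) unfolding S_def by (auto simp: coeff_pCons split: nat.split)
  have sS: "s i \<in> S" for i
    unfolding s_def using S_lin S_const pullback_closed uK by auto
  have z1: "0 \<in> S" "1 \<in> S" using S_const[OF pullback_closed(1)] S_const[OF pullback_closed(2)] by (simp_all add: one_pCons)
  have pS: "p r \<in> S" for r
    unfolding p_def by (rule pm_eval_closed) (use z1 S_add S_mult S_const[OF CK] sS in auto)
  have PS: "P \<in> S"
    unfolding P_def sum_3 by (intro S_add S_mult S_const uK pS)
  have top: "top_coeff n P (\<Sum>r\<in>UNIV. u r * pm_eval ?C c (g r))"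
    unfolding P_def
  proof (rule top_coeff_sum)
    fix r
    have "top_coeff 1 (s i) (c i)" for i unfolding top_coeff_def s_def c_def by simp
    then have "top_coeff n (p r) (pm_eval ?C c (g r))" unfolding p_def by (rule top_coeff_pm_eval[OF g_form])
    from top_coeff_mult[OF top_coeff_const this] show "top_coeff n ([:u r:] * p r) (u r * pm_eval ?C c (g r))" by simp
  qed simp
  have val: "poly P tt = 0"
  proof -
    have st: "poly (s i) tt = (1 / ?x1) * to_fract (Var i)" for i
    proof -
      have "- u 1 - u 0 * tt = to_fract (Var 2) / ?x1"
        unfolding u_def using fract_relation_tt .
      then show ?thesis using cases_3[of i] x1 by (auto simp: s_def tt_def algebra_simps)
    qed
    have "poly (p r) tt = (1 / ?x1) ^ n * to_fract (g r)" for r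
    proof -
      have "poly (p r) tt = pm_eval ?C (\<lambda>i. (1 / ?x1) * to_fract (Var i)) (g r)"
        unfolding p_def poly_pm_eval[OF comm_ring_hom_fract_Const] st ..
      also have "\<dots> = (1 / ?x1) ^ n * to_fract (g r)"
        unfolding pm_eval_scale[OF g_form] pm_eval_to_fract cpoly_subst_Var_id ..
      finally show ?thesis .
    qed
    then have "u r * poly (p r) tt = (1 / ?f2 * (1 / ?x1) ^ n) * to_fract (f r * g r)" for r
      by (simp add: u_def mult_ac)
    moreover have "poly P tt = (\<Sum>r\<in>UNIV. u r * poly (p r) tt)"
      by (simp add: P_def poly_sum)
    ultimately have "poly P tt = (\<Sum>r\<in>UNIV. (1 / ?f2 * (1 / ?x1) ^ n) * to_fract (f r * g r))"
      by (simp only:)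
    also have "\<dots> = (1 / ?f2 * (1 / ?x1) ^ n) * to_fract (\<Sum>r\<in>UNIV. f r * g r)"
      unfolding to_fract.hom_sum sum_distrib_left ..
    finally show ?thesis unfolding f_dot_g by simp
  qed
  \<comment> \<open>The n-th coefficient is the pullback of \<open>top_form\<close> divided by
    f_2^(n + 1), and pullback is injective on forms.\<close>
  have lead: "(\<Sum>r\<in>UNIV. u r * pm_eval ?C c (g r)) \<noteq> 0"
  proof -
    define w where "w i = (if i = 0 then f 2 else if i = 1 then 0 else - f 0)" for i :: 3
    have "c = (\<lambda>i. (1 / ?f2) * to_fract (w i))"
      using f2 by (auto simp: c_def w_def u_def)
    then have pc: "pm_eval ?C c (g r) = (1 / ?f2) ^ n * to_fract (cpoly_subst w (g r))" for r
      by (simp only: pm_eval_scale[OF g_form] pm_eval_to_fract)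
    have pt: "pb top_form = (\<Sum>r\<in>UNIV. f r * cpoly_subst w (g r))"
    proof -
      have "(\<lambda>i. pb (if i = 0 then Var 2 else if i = 1 then 0 else - Var 0)) = w"
        by (auto simp: w_def sb.hom_uminus)
      then show ?thesis by (simp add: top_form_def sb.hom_simps cpoly_subst_subst)
    qed
    have "u r * pm_eval ?C c (g r) = (1 / ?f2 * (1 / ?f2) ^ n) * to_fract (f r * cpoly_subst w (g r))" for r
      unfolding pc u_def by (simp add: mult_ac)
    then have "(\<Sum>r\<in>UNIV. u r * pm_eval ?C c (g r)) = (\<Sum>r\<in>UNIV. (1 / ?f2 * (1 / ?f2) ^ n) * to_fract (f r * cpoly_subst w (g r)))"
      by (simp only:)
    also have "\<dots> = (1 / ?f2 * (1 / ?f2) ^ n) * to_fract (pb top_form)"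
      unfolding pt to_fract.hom_sum sum_distrib_left ..
    finally show ?thesis using f2 pb_inj[OF top_form_form] top_form_nonzero by auto
  qed
  define l where "l = Polynomial.coeff P n"
  have l0: "l \<noteq> 0" and deg: "Polynomial.degree P \<le> n" using top lead unfolding top_coeff_def l_def by auto
  have lK: "l \<in> ?K" and coK: "Polynomial.coeff P k \<in> ?K" for k using PS unfolding S_def l_def by auto
  have "poly P tt = (\<Sum>j\<le>n. Polynomial.coeff P j * tt ^ j)"
    unfolding poly_altdef
  proof (rule sum.mono_neutral_left)
    show "\<forall>j\<in>{..n} - {..Polynomial.degree P}. Polynomial.coeff P j * tt ^ j = 0"
      by (simp add: coeff_eq_0)
  qed (use deg in auto)
  also have "\<dots> = (\<Sum>j<n. Polynomial.coeff P j * tt ^ j) + l * tt ^ n"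
    unfolding l_def lessThan_Suc_atMost[symmetric] by (rule sum.lessThan_Suc)
  finally have "(\<Sum>j<n. Polynomial.coeff P j * tt ^ j) + l * tt ^ n = 0" using val by (simp only:)
  then have "l * tt ^ n = - (\<Sum>j<n. Polynomial.coeff P j * tt ^ j)" by (rule minus_unique[symmetric])
  then have "inverse l * (l * tt ^ n) = inverse l * - (\<Sum>j<n. Polynomial.coeff P j * tt ^ j)" by (simp only:)
  moreover have "inverse l * l = 1" using l0 by simp
  then have "inverse l * (l * tt ^ n) = tt ^ n" by (simp only: mult.assoc[symmetric] mult_1_left)
  ultimately have "tt ^ n = inverse l * - (\<Sum>j<n. Polynomial.coeff P j * tt ^ j)" by (simp only:)
  also have "\<dots> = (\<Sum>j<n. (- inverse l * Polynomial.coeff P j) * tt ^ j)"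
    by (simp only: sum_distrib_left mult.assoc mult_minus_left mult_minus_right sum_negf)
  finally have e: "tt ^ n = (\<Sum>j<n. (- inverse l * Polynomial.coeff P j) * tt ^ j)" .
  have k: "- inverse l * Polynomial.coeff P j \<in> ?K" for j
    by (intro pullback_closed(3,4) coK subfield_type_algebra_inverse[OF pullback_subfield lK l0])
  show ?thesis unfolding e by (rule power_spanI[OF k refl])
qed

lemmas tt_extension = power_basis_extension[OF pullback_subfield n_pos tt_independent tt_relation]

text \<open>The span is a field containing the constants and all x_i / x_1, hence F / x_1^m for each
  form F of degree m, and so every quotient of two forms of equal degree. Conversely K and t consist
  of such quotients.\<close>

lemma power_span_eq_function_field: "power_span (pullback_field f) tt n = function_field"
proof
  have K: "x \<in> function_field" if x: "x \<in> pullback_field f" for x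
  proof -
    obtain F G m where e: "F \<in> forms m" "G \<in> forms m" "pb G \<noteq> 0" "x = to_fract (pb F) / to_fract (pb G)"
      using x unfolding mem_pullback_field by (elim exE conjE)
    show ?thesis unfolding mem_function_field
      by (intro exI conjI) (rule pb_form[OF e(1)], rule pb_form[OF e(2)], rule e(3), rule e(4))
  qed
  have tt: "tt \<in> function_field"
    unfolding mem_function_field tt_def using forms_Var Var_neq_0 by blast
  have pw: "tt ^ j \<in> function_field" for j
    by (induction j) (use tt function_field_mult K[OF pullback_closed(2)] in auto)
  show "power_span (pullback_field f) tt n \<subseteq> function_field"
  proof
    fix x assume "x \<in> power_span (pullback_field f) tt n"
    then obtain c where c: "\<forall>j. c j \<in> pullback_field f" "x = (\<Sum>j<n. c j * tt ^ j)" by (rule power_spanE)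
    have "(\<Sum>j<i. c j * tt ^ j) \<in> function_field" for i
      by (induction i) (use K[OF pullback_closed(1)] function_field_add function_field_mult pw K c(1) in auto)
    then show "x \<in> function_field" unfolding c(2) .
  qed
  let ?E = "power_span (pullback_field f) tt n"
  let ?C = "\<lambda>z. to_fract (Const z :: 3 cpoly)" and ?x1 = "to_fract (Var 1 :: 3 cpoly)"
  have sE: "subfield ?E ring_of_type_algebra" and KE: "pullback_field f \<subseteq> ?E" and tE: "tt \<in> ?E"
    using tt_extension(2-4) by blast+
  note E_closed = subring_type_algebraD[OF subfieldE(1)[OF sE]]
  have x1: "?x1 \<noteq> 0" using Var_neq_0 by simp
  have x2: "(1 / ?x1) * to_fract (Var i) \<in> ?E" for i
  proof -
    define u where "u r = to_fract (f r) / to_fract (f 2)" for r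
    have u: "u r \<in> ?E" for r
    proof -
      have "u r \<in> pullback_field f"
        unfolding mem_pullback_field u_def
        by (rule exI[of _ "Var r"], rule exI[of _ "Var 2"], rule exI[of _ 1]) (use f2_nonzero in simp)
      then show ?thesis using KE by blast
    qed
    have "(1 / ?x1) * to_fract (Var 2) = - u 1 + - (u 0 * tt)"
      unfolding u_def using fract_relation_tt by simp
    moreover have "- u 1 + - (u 0 * tt) \<in> ?E"
      by (intro E_closed(3-5) u tE)
    ultimately have 2: "(1 / ?x1) * to_fract (Var 2) \<in> ?E" by simp
    have 0: "(1 / ?x1) * to_fract (Var 0) \<in> ?E" using tE by (simp add: tt_def)
    have 1: "(1 / ?x1) * to_fract (Var 1) \<in> ?E" using E_closed(2) x1 by simp
    show ?thesis using cases_3[of i] 0 1 2 by blast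
  qed
  have C: "?C z \<in> ?E" for z
  proof -
    have "?C z \<in> pullback_field f"
      unfolding mem_pullback_field by (rule exI[of _ "Const z"], rule exI[of _ 1], rule exI[of _ 0]) simp
    then show ?thesis using KE by blast
  qed
  have dehom: "(1 / ?x1) ^ m * to_fract F \<in> ?E" if F: "F \<in> forms m" for F m
  proof -
    have "pm_eval ?C (\<lambda>i. (1 / ?x1) * to_fract (Var i)) F \<in> ?E"
      by (rule pm_eval_closed) (use E_closed C x2 in auto)
    then show ?thesis unfolding pm_eval_scale[OF F] pm_eval_to_fract cpoly_subst_Var_id .
  qed
  show "function_field \<subseteq> ?E"
  proof
    fix x assume "x \<in> function_field"
    then obtain F G m where x: "F \<in> forms m" "G \<in> forms m" "G \<noteq> 0" "x = to_fract F / to_fract G"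
      unfolding mem_function_field by blast
    let ?d = "(1 / ?x1) ^ m"
    have d0: "?d \<noteq> 0" using x1 by simp
    have "inverse (?d * to_fract G) \<in> ?E"
      by (rule subfield_type_algebra_inverse[OF sE dehom[OF x(2)]]) (use d0 x(3) in simp)
    then have "(?d * to_fract F) * inverse (?d * to_fract G) \<in> ?E" by (rule E_closed(4)[OF dehom[OF x(1)]])
    moreover have "(?d * to_fract F) * inverse (?d * to_fract G) = x" using x d0 by (simp add: field_simps)
    ultimately show "x \<in> ?E" by simp
  qed
qed

lemma function_field_dimension:
  "ring.dimension ring_of_type_algebra n (pullback_field f) function_field"
  using tt_extension(1) unfolding power_span_eq_function_field .

end

section \<open>Tensors\<close>

lemma prod_list_Var_form: "(\<Prod>j\<leftarrow>js. Var j) \<in> forms (length js)"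
  by (induction js) (use forms_mult[OF forms_Var] in auto)

lemma tensor_form_form: "tensor_form d T i \<in> forms (d - 1)"
  unfolding tensor_form_def
proof (intro forms_sum forms_Const_mult)
  fix js :: "3 list" assume "js \<in> {js. length js = d - 1}"
  then show "(\<Prod>j\<leftarrow>js. Var j) \<in> forms (d - 1)" using prod_list_Var_form[of js] by simp
qed

theorem theorem5p5:
  fixes d :: nat and T :: tensor
  assumes "d \<ge> 4"
    and "has_dim (zero_locus (eigenscheme d T)) 0"
    and "reduced_scheme (eigenscheme d T)"
  shows "generically_finite_of_degree (laguerre d T) (d - 1) \<and>
    (\<forall>Q \<in> P2. finite_fiber (laguerre d T) Q \<longrightarrow>
       zero_dim_scheme_of_degree (fiber_ideal (laguerre d T) Q) (d - 1) \<and>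
       scheme_contained_in_line (fiber_ideal (laguerre d T) Q)) \<and>
    (\<forall>C. contracted_curve (laguerre d T) C \<longrightarrow> proj_line C) \<and>
    finite {C. proj_line C \<and> contracted_curve (laguerre d T) C} \<and>
    card {C. proj_line C \<and> contracted_curve (laguerre d T) C} \<le> 3 * (d - 1) \<and>
    (\<forall>k \<in> {2..d - 1}. \<not> (\<exists>S C. S \<subseteq> zero_locus (eigenscheme d T) \<and> card S = k * d \<and>
       plane_curve k C \<and> S \<subseteq> C))"
proof -
  interpret N: laguerre_net "d - 1" "tensor_form d T" "laguerre d T"
  proof
    show "d - 1 > 0" using assms(1) by simp
    show "has_dim (zero_locus (range (laguerre d T))) 0"
      using assms(2) by (simp add: eigenscheme_def zero_locus_ideal_gen)
  qed (rule tensor_form_form laguerre_def)+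
  have Z: "zero_locus (eigenscheme d T) = N.Z" by (simp add: N.Z_def eigenscheme_def zero_locus_ideal_gen)
  have d: "d - 1 + 1 = d" using assms(1) by simp
  have sub: "{C. proj_line C \<and> contracted_curve (laguerre d T) C} \<subseteq> {C. contracted_curve (laguerre d T) C}"
    by blast
  show ?thesis
  proof (intro conjI allI ballI impI)
    show "generically_finite_of_degree (laguerre d T) (d - 1)"
      unfolding generically_finite_of_degree_def
      by (intro conjI N.dominant N.generically_finite N.function_field_dimension)
    show "zero_dim_scheme_of_degree (fiber_ideal (laguerre d T) Q) (d - 1)"
      if "Q \<in> P2" "finite_fiber (laguerre d T) Q" for Q
      using that N.fiber_zero_dim by (auto elim!: P2_cases)
    show "scheme_contained_in_line (fiber_ideal (laguerre d T) Q)" if "Q \<in> P2" for Q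
      using that N.fiber_in_line by (auto elim!: P2_cases)
    show "proj_line C" if "contracted_curve (laguerre d T) C" for C
      using that by (rule N.contracted_curve_proj_line)
    show "finite {C. proj_line C \<and> contracted_curve (laguerre d T) C}"
      by (rule finite_subset[OF sub N.contracted_lines(1)])
    show "card {C. proj_line C \<and> contracted_curve (laguerre d T) C} \<le> 3 * (d - 1)"
      using card_mono[OF N.contracted_lines(1) sub] N.contracted_lines(2) by (rule le_trans)
    show "\<not> (\<exists>S C. S \<subseteq> zero_locus (eigenscheme d T) \<and> card S = k * d \<and> plane_curve k C \<and> S \<subseteq> C)"
      if "k \<in> {2..d - 1}" for k
      using that N.base_points_plane_curve[of k] unfolding d Z by auto
  qed
qed

end
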